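(* Let $\Omega\subset\mathbb{R}^d$ be a bounded domain with $C^1$ boundary, $Y=(0,1)^d$ and $0<T<\infty$. Let $\sigma\in L^\infty(\Omega;C_{\rm per}(Y))$ satisfy $\sigma(x,y)\ge\sigma_{\min}$ for all $(x,y)\in\Omega\times Y$, for some constant $\sigma_{\min}>0$; let $f\in L^\infty((0,T)\times\Omega;C_{\rm per}(Y))$ and $u_{\rm in}\in L^2(\Omega;C_{\rm per}(Y))$. For $\varepsilon>0$ let $u^\varepsilon(t,x)$ be the solution of $$\partial_t u^\varepsilon(t,x)+\sigma\left(x,\tfrac{x}{\varepsilon}\right)u^\varepsilon(t,x)=f\left(t,x,\tfrac{x}{\varepsilon}\right)\quad\text{for }(t,x)\in(0,T)\times\Omega,\qquad u^\varepsilon(0,x)=u_{\rm in}\left(x,\tfrac{x}{\varepsilon}\right)\quad\text{for }x\in\Omega.$$ Then, as $\varepsilon\to0$, $$u^\varepsilon\rightharpoonup u_{\rm hom}\quad\text{weakly in }L^2((0,T)\times\Omega),$$ and $u_{\rm hom}(t,x)$ solves the integro-differential equation $$\partial_t u_{\rm hom}(t,x)+\langle\sigma\rangle(x)\,u_{\rm hom}(t,x)-\int_0^t\mathcal{K}(t-s,x)\,u_{\rm hom}(s,x)\,ds=\mathcal{S}(t,x),\qquad u_{\rm hom}(0,x)=\langle u_{\rm in}\rangle(x),$$ where the memory kernel is $$\mathcal{K}(\tau,x):=\int_Y\sigma(x,y)\,e^{-\tau\mathcal{L}_\sigma}\mathcal{L}_1\sigma(x,y)\,dy$$ and the source term is $$\mathcal{S}(t,x):=\langle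 f\rangle(t,x)-\int_0^t\int_Y\sigma(x,y)\,e^{-(t-s)\mathcal{L}_\sigma}\mathcal{L}_1 f(s,x,y)\,dy\,ds-\int_Y\sigma(x,y)\,e^{-t\mathcal{L}_\sigma}\mathcal{L}_1u_{\rm in}(x,y)\,dy.$$
   Context: $C_{\rm per}(Y)$ denotes the continuous functions on $\mathbb{R}^d$ that are $Y$-periodic, and $L^2_{\rm per}(Y)$ the $Y$-periodic functions that are square integrable on $Y$. For a function $v$ depending on $y$ (and possibly on $t,x$), $\langle v\rangle:=\int_Y v(y)\,dy$ is the average in the $y$ variable. For $g\in L^\infty(Y)$, $\mathcal{L}_g$ is the bounded linear operator on $L^2_{\rm per}(Y)$ defined by $\mathcal{L}_g v:=gv-\langle gv\rangle$; it generates the uniformly continuous semigroup $e^{t\mathcal{L}_g}=\sum_{n\ge0}\frac{t^n}{n!}\mathcal{L}_g^n$. In particular $\mathcal{L}_1v=v-\langle v\rangle$. The operators $\mathcal{L}_\sigma$ and $e^{-t\mathcal{L}_\sigma}$ act in the $y$ variable, with $x$ (and time) as a fixed parameter, i.e. $\mathcal{L}_\sigma=\mathcal{L}_{\sigma(x,\cdot)}$. An expression such as $\int_Y\sigma(x,y)\,e^{-\tau\mathcal{L}_\sigma}\mathcal{L}_1\sigma(x,y)\,dy$ means: apply $e^{-\tau\mathcal{L}_{\sigma(x,\cdot)}}$ to the function $y\mapsto\sigma(x,y)-\langle\sigma\rangle(x)$, multiply the result by $\sigma(x,\cdot)$, and integrate over $Y$. *)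

theory Defs
  imports "HOL-Analysis.Analysis"
begin

section \<open>Domains with C1 boundary\<close>

definition C1_function :: "(real ^ 'n \<Rightarrow> real) \<Rightarrow> bool" where
  "C1_function \<gamma> \<longleftrightarrow>
     (\<exists>G :: real ^ 'n \<Rightarrow> real ^ 'n.
        continuous_on UNIV G \<and> (\<forall>x. (\<gamma> has_derivative (\<lambda>h. G x \<bullet> h)) (at x)))"

text \<open>
  Near each boundary point the set is, in a suitable orthonormal frame, the region above the graph
  of a C1 function of the other \<open>d - 1\<close> coordinates. The unit vector \<open>\<nu>\<close> is the last
  axis of the frame, and a function of the remaining coordinates is rendered as a function on the
  whole space that is invariant under translation along \<open>\<nu>\<close>.
\<close>
definition C1_boundary :: "(real ^ 'n) set \<Rightarrow> bool" where
  "C1_boundary \<Omega> \<longleftrightarrow>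
     (\<forall>p \<in> frontier \<Omega>. \<exists>r > 0. \<exists>\<nu> \<gamma>.
        norm \<nu> = 1 \<and> C1_function \<gamma> \<and> (\<forall>x s. \<gamma> (x + s *\<^sub>R \<nu>) = \<gamma> x) \<and>
        \<Omega> \<inter> ball p r = {x \<in> ball p r. \<gamma> x < x \<bullet> \<nu>})"

definition bounded_C1_domain :: "(real ^ 'n) set \<Rightarrow> bool" where
  "bounded_C1_domain \<Omega> \<longleftrightarrow>
     open \<Omega> \<and> connected \<Omega> \<and> \<Omega> \<noteq> {} \<and> bounded \<Omega> \<and> C1_boundary \<Omega>"


section \<open>Function spaces\<close>

definition unit_cell :: "(real ^ 'n) set" where
  "unit_cell = box 0 1"

text \<open>
  A continuous periodic function is bounded, so nothing is lost by working inside the Banach space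
  of bounded continuous functions, whose norm is the supremum norm.
\<close>
definition C_per :: "((real ^ 'n) \<Rightarrow>\<^sub>C real) set" where
  "C_per = {v. \<forall>k y. apply_bcontfun v (y + axis k 1) = apply_bcontfun v y}"

text \<open>
  Bochner spaces of maps with values in a subspace \<open>V\<close>. An element is given by a
  representative; two representatives are identified if they agree almost everywhere.
\<close>
definition strongly_measurable ::
    "'a measure \<Rightarrow> 'b::real_normed_vector set \<Rightarrow> ('a \<Rightarrow> 'b) \<Rightarrow> bool" where
  "strongly_measurable M V F \<longleftrightarrow>
     (\<exists>s :: nat \<Rightarrow> 'a \<Rightarrow> 'b.
        (\<forall>i. simple_function M (s i) \<and> s i \<in> space M \<rightarrow> V) \<and>
        (AE z in M. (\<lambda>i. s i z) \<longlonglongrightarrow> F z))"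

definition Bochner_Linf ::
    "'a measure \<Rightarrow> 'b::real_normed_vector set \<Rightarrow> ('a \<Rightarrow> 'b) set" where
  "Bochner_Linf M V =
     {F. F \<in> space M \<rightarrow> V \<and> strongly_measurable M V F \<and> (\<exists>C. AE z in M. norm (F z) \<le> C)}"

definition Bochner_L2 ::
    "'a measure \<Rightarrow> 'b::real_normed_vector set \<Rightarrow> ('a \<Rightarrow> 'b) set" where
  "Bochner_L2 M V =
     {F. F \<in> space M \<rightarrow> V \<and> strongly_measurable M V F \<and>
         (\<integral>\<^sup>+ z. ennreal ((norm (F z))\<^sup>2) \<partial>M) < \<infinity>}"

definition L2 :: "'a measure \<Rightarrow> ('a \<Rightarrow> real) set" where
  "L2 M = {g. g \<in> borel_measurable M \<and> integrable M (\<lambda>z. (g z)\<^sup>2)}"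

text \<open>By the Riesz representation theorem, testing against \<open>g \<in> L2 M\<close> is testing against the dual.\<close>
definition weakly_converges_L2 ::
    "'a measure \<Rightarrow> ('i \<Rightarrow> 'a \<Rightarrow> real) \<Rightarrow> ('a \<Rightarrow> real) \<Rightarrow> 'i filter \<Rightarrow> bool" where
  "weakly_converges_L2 M u l F \<longleftrightarrow>
     (\<forall>\<^sub>F i in F. u i \<in> L2 M) \<and> l \<in> L2 M \<and>
     (\<forall>g \<in> L2 M. ((\<lambda>i. LINT z|M. u i z * g z) \<longlongrightarrow> (LINT z|M. l z * g z)) F)"


section \<open>The operators and their semigroups\<close>

definition avg :: "(real ^ 'n \<Rightarrow> real) \<Rightarrow> real" where
  "avg v = (LINT y|lebesgue_on unit_cell. v y)"

definition L_op :: "(real ^ 'n \<Rightarrow> real) \<Rightarrow> (real ^ 'n \<Rightarrow> real) \<Rightarrow> real ^ 'n \<Rightarrow> real" where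
  "L_op g v = (\<lambda>y. g y * v y - avg (\<lambda>z. g z * v z))"

text \<open>
  \<open>semigroup_L g t v\<close> is a representative of the square integrable function
  obtained by applying the operator exponential of \<open>t L_op g\<close> to \<open>v\<close>.
  For bounded \<open>g\<close> the series converges at every point and also in the square mean; see
  \<open>semigroup_L_summable\<close> and \<open>semigroup_L_tendsto_L2\<close> below.
\<close>
definition semigroup_L ::
    "(real ^ 'n \<Rightarrow> real) \<Rightarrow> real \<Rightarrow> (real ^ 'n \<Rightarrow> real) \<Rightarrow> real ^ 'n \<Rightarrow> real" where
  "semigroup_L g t v = (\<lambda>y. \<Sum>n. t ^ n / fact n * (L_op g ^^ n) v y)"


section \<open>Solutions in time\<close>

definition absolutely_continuous_fun :: "real \<Rightarrow> real \<Rightarrow> (real \<Rightarrow> real) \<Rightarrow> bool" where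
  "absolutely_continuous_fun a b h \<longleftrightarrow>
     (\<forall>e > 0. \<exists>\<delta> > 0. \<forall>(n::nat) l r.
        (\<forall>i<n. a \<le> l i \<and> l i \<le> r i \<and> r i \<le> b) \<and>
        disjoint_family_on (\<lambda>i. {l i<..<r i}) {..<n} \<and> (\<Sum>i<n. r i - l i) < \<delta>
        \<longrightarrow> (\<Sum>i<n. \<bar>h (r i) - h (l i)\<bar>) < e)"

text \<open>
  The equations below contain no derivative in \<open>x\<close> and their data are merely measurable in time. A
  solution is therefore a function which, for almost every \<open>x\<close>, is absolutely continuous on
  \<open>[0,T]\<close>, takes the initial value at \<open>t = 0\<close> and satisfies the equation
  \<open>E t x (\<partial>\<^sub>t u)\<close> at almost every \<open>t\<close>.
\<close>
definition solves_IVP ::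
    "real \<Rightarrow> (real ^ 'n) set \<Rightarrow> (real \<Rightarrow> real ^ 'n \<Rightarrow> real \<Rightarrow> bool) \<Rightarrow>
     (real ^ 'n \<Rightarrow> real) \<Rightarrow> (real \<Rightarrow> real ^ 'n \<Rightarrow> real) \<Rightarrow> bool" where
  "solves_IVP T \<Omega> E u0 u \<longleftrightarrow>
     (AE x in lebesgue_on \<Omega>.
        absolutely_continuous_fun 0 T (\<lambda>t. u t x) \<and>
        (AE t in lebesgue_on {0<..<T}.
           \<exists>D. ((\<lambda>s. u s x) has_real_derivative D) (at t) \<and> E t x D) \<and>
        u 0 x = u0 x)"

definition solves_oscillating ::
    "real \<Rightarrow> (real ^ 'n) set \<Rightarrow> (real ^ 'n \<Rightarrow> ((real ^ 'n) \<Rightarrow>\<^sub>C real)) \<Rightarrow>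
     (real \<times> (real ^ 'n) \<Rightarrow> ((real ^ 'n) \<Rightarrow>\<^sub>C real)) \<Rightarrow> (real ^ 'n \<Rightarrow> ((real ^ 'n) \<Rightarrow>\<^sub>C real)) \<Rightarrow>
     real \<Rightarrow> (real \<Rightarrow> real ^ 'n \<Rightarrow> real) \<Rightarrow> bool" where
  "solves_oscillating T \<Omega> \<sigma> f u_in \<epsilon> u \<longleftrightarrow>
     solves_IVP T \<Omega>
       (\<lambda>t x D. D + \<sigma> x (x /\<^sub>R \<epsilon>) * u t x = f (t, x) (x /\<^sub>R \<epsilon>))
       (\<lambda>x. u_in x (x /\<^sub>R \<epsilon>)) u"

definition memory_kernel :: "(real ^ 'n \<Rightarrow> ((real ^ 'n) \<Rightarrow>\<^sub>C real)) \<Rightarrow> real \<Rightarrow> real ^ 'n \<Rightarrow> real" where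
  "memory_kernel \<sigma> \<tau> x =
     (LINT y|lebesgue_on unit_cell. \<sigma> x y * semigroup_L (\<sigma> x) (- \<tau>) (L_op (\<lambda>_. 1) (\<sigma> x)) y)"

definition source_term ::
    "(real ^ 'n \<Rightarrow> ((real ^ 'n) \<Rightarrow>\<^sub>C real)) \<Rightarrow> (real \<times> (real ^ 'n) \<Rightarrow> ((real ^ 'n) \<Rightarrow>\<^sub>C real)) \<Rightarrow>
     (real ^ 'n \<Rightarrow> ((real ^ 'n) \<Rightarrow>\<^sub>C real)) \<Rightarrow> real \<Rightarrow> real ^ 'n \<Rightarrow> real" where
  "source_term \<sigma> f u_in t x =
     avg (f (t, x))
     - (LINT s|lebesgue_on {0<..<t}. LINT y|lebesgue_on unit_cell.
          \<sigma> x y * semigroup_L (\<sigma> x) (- (t - s)) (L_op (\<lambda>_. 1) (f (s, x))) y)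
     - (LINT y|lebesgue_on unit_cell.
          \<sigma> x y * semigroup_L (\<sigma> x) (- t) (L_op (\<lambda>_. 1) (u_in x)) y)"

definition solves_homogenized ::
    "real \<Rightarrow> (real ^ 'n) set \<Rightarrow> (real ^ 'n \<Rightarrow> ((real ^ 'n) \<Rightarrow>\<^sub>C real)) \<Rightarrow>
     (real \<times> (real ^ 'n) \<Rightarrow> ((real ^ 'n) \<Rightarrow>\<^sub>C real)) \<Rightarrow> (real ^ 'n \<Rightarrow> ((real ^ 'n) \<Rightarrow>\<^sub>C real)) \<Rightarrow>
     (real \<Rightarrow> real ^ 'n \<Rightarrow> real) \<Rightarrow> bool" where
  "solves_homogenized T \<Omega> \<sigma> f u_in u \<longleftrightarrow>
     solves_IVP T \<Omega>
       (\<lambda>t x D. D + avg (\<sigma> x) * u t x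
          - (LINT s|lebesgue_on {0<..<t}. memory_kernel \<sigma> (t - s) x * u s x)
          = source_term \<sigma> f u_in t x)
       (\<lambda>x. avg (u_in x)) u"


section \<open>Convergence of the exponential series\<close>

lemma emeasure_unit_cell:
  "emeasure (lebesgue_on (unit_cell :: (real ^ 'n) set)) (unit_cell :: (real ^ 'n) set) = 1"
proof -
  have "emeasure lborel (box 0 (1 :: real ^ 'n)) = 1"
    by (subst emeasure_lborel_box) (auto simp: Basis_vec_def inner_axis intro!: prod.neutral)
  then show ?thesis
    by (simp add: emeasure_restrict_space unit_cell_def)
qed

lemma measure_unit_cell [simp]:
  "measure (lebesgue_on (unit_cell :: (real ^ 'n) set)) (unit_cell :: (real ^ 'n) set) = 1"
  by (simp add: measure_def emeasure_unit_cell)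

lemma finite_measure_unit_cell: "finite_measure (lebesgue_on (unit_cell :: (real ^ 'n) set))"
  by (rule finite_measureI) (simp add: emeasure_unit_cell)

context
  fixes g v :: "real ^ 'n \<Rightarrow> real" and G t :: real
  assumes g_meas: "g \<in> borel_measurable (lebesgue_on unit_cell)"
    and g_bound: "\<And>y. \<bar>g y\<bar> \<le> G"
    and v_L2: "v \<in> L2 (lebesgue_on unit_cell)"
begin

interpretation finite_measure "lebesgue_on (unit_cell :: (real ^ 'n) set)"
  by (rule finite_measure_unit_cell)

lemma G_nonneg: "0 \<le> G"
  using g_bound[of 0] by linarith

lemma integrable_g_times:
  assumes "integrable (lebesgue_on unit_cell) w"
  shows "integrable (lebesgue_on unit_cell) (\<lambda>y. g y * w y)"
proof (rule Bochner_Integration.integrable_bound)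
  show "integrable (lebesgue_on unit_cell) (\<lambda>y. G * w y)"
    using assms by simp
  show "(\<lambda>y. g y * w y) \<in> borel_measurable (lebesgue_on unit_cell)"
    using assms g_meas by (intro borel_measurable_times) auto
  show "AE y in lebesgue_on unit_cell. norm (g y * w y) \<le> norm (G * w y)"
    using g_bound G_nonneg by (auto simp: abs_mult intro!: mult_right_mono)
qed

lemma abs_avg_le:
  assumes "integrable (lebesgue_on unit_cell) w"
  shows "\<bar>avg (\<lambda>z. g z * w z)\<bar> \<le> G * avg (\<lambda>z. \<bar>w z\<bar>)"
proof -
  have "\<bar>avg (\<lambda>z. g z * w z)\<bar> \<le> avg (\<lambda>z. \<bar>g z * w z\<bar>)"
    unfolding avg_def by (rule integral_abs_bound)
  also have "\<dots> \<le> avg (\<lambda>z. G * \<bar>w z\<bar>)"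
    unfolding avg_def using assms g_bound G_nonneg
    by (intro integral_mono integrable_abs integrable_g_times integrable_mult_right)
       (auto simp: abs_mult intro!: mult_right_mono)
  finally show ?thesis
    by (simp add: avg_def)
qed

lemma integrable_L_op:
  assumes "integrable (lebesgue_on unit_cell) w"
  shows "integrable (lebesgue_on unit_cell) (L_op g w)"
  unfolding L_op_def using assms by (intro Bochner_Integration.integrable_diff integrable_g_times) auto

lemma abs_L_op_le:
  assumes "integrable (lebesgue_on unit_cell) w"
  shows "\<bar>L_op g w y\<bar> \<le> G * \<bar>w y\<bar> + G * avg (\<lambda>z. \<bar>w z\<bar>)"
proof -
  have "\<bar>L_op g w y\<bar> \<le> \<bar>g y\<bar> * \<bar>w y\<bar> + \<bar>avg (\<lambda>z. g z * w z)\<bar>"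
    unfolding L_op_def by (metis abs_mult abs_triangle_ineq4)
  then show ?thesis
    using mult_right_mono[OF g_bound[of y], of "\<bar>w y\<bar>"] abs_avg_le[OF assms] by linarith
qed

lemma integrable_v: "integrable (lebesgue_on unit_cell) v"
  using v_L2 by (auto simp: L2_def intro: square_integrable_imp_integrable)

lemma L_op_power_bound:
  "integrable (lebesgue_on unit_cell) ((L_op g ^^ n) v) \<and>
   avg (\<lambda>z. \<bar>(L_op g ^^ n) v z\<bar>) \<le> (2 * G) ^ n * avg (\<lambda>z. \<bar>v z\<bar>) \<and>
   (\<forall>y. \<bar>(L_op g ^^ n) v y\<bar> \<le> (2 * G) ^ n * (\<bar>v y\<bar> + avg (\<lambda>z. \<bar>v z\<bar>)))"
proof (induction n)
  case 0
  have "0 \<le> avg (\<lambda>z. \<bar>v z\<bar>)"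
    unfolding avg_def by (rule integral_nonneg_AE) auto
  then show ?case
    using integrable_v by simp
next
  case (Suc n)
  let ?w = "(L_op g ^^ n) v" and ?A = "avg (\<lambda>z. \<bar>v z\<bar>)"
  have A: "0 \<le> ?A"
    unfolding avg_def by (rule integral_nonneg_AE) auto
  have w: "integrable (lebesgue_on unit_cell) ?w"
    and wA: "avg (\<lambda>z. \<bar>?w z\<bar>) \<le> (2 * G) ^ n * ?A"
    and wy: "\<And>y. \<bar>?w y\<bar> \<le> (2 * G) ^ n * (\<bar>v y\<bar> + ?A)"
    using Suc by auto
  have int: "integrable (lebesgue_on unit_cell) (L_op g ?w)"
    using w by (rule integrable_L_op)
  have "avg (\<lambda>z. \<bar>L_op g ?w z\<bar>) \<le> avg (\<lambda>z. G * \<bar>?w z\<bar> + G * avg (\<lambda>z. \<bar>?w z\<bar>))"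
    unfolding avg_def[of "\<lambda>z. \<bar>L_op g ?w z\<bar>"] avg_def[of "\<lambda>z. G * \<bar>?w z\<bar> + G * avg (\<lambda>z. \<bar>?w z\<bar>)"]
    using w int abs_L_op_le[OF w] by (intro integral_mono) auto
  also have "\<dots> = 2 * G * avg (\<lambda>z. \<bar>?w z\<bar>)"
    unfolding avg_def using w by (subst Bochner_Integration.integral_add) auto
  also have "\<dots> \<le> 2 * G * ((2 * G) ^ n * ?A)"
    using wA G_nonneg by (intro mult_left_mono) auto
  finally have 1: "avg (\<lambda>z. \<bar>L_op g ?w z\<bar>) \<le> (2 * G) ^ Suc n * ?A"
    by (simp add: mult.assoc)
  have 2: "\<bar>L_op g ?w y\<bar> \<le> (2 * G) ^ Suc n * (\<bar>v y\<bar> + ?A)" for y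
  proof -
    have "\<bar>L_op g ?w y\<bar> \<le> G * \<bar>?w y\<bar> + G * avg (\<lambda>z. \<bar>?w z\<bar>)"
      using w by (rule abs_L_op_le)
    also have "\<dots> \<le> G * ((2 * G) ^ n * (\<bar>v y\<bar> + ?A)) + G * ((2 * G) ^ n * (\<bar>v y\<bar> + ?A))"
    proof (intro add_mono mult_left_mono)
      have "(2 * G) ^ n * ?A \<le> (2 * G) ^ n * (\<bar>v y\<bar> + ?A)"
        using G_nonneg by (intro mult_left_mono) auto
      then show "avg (\<lambda>z. \<bar>?w z\<bar>) \<le> (2 * G) ^ n * (\<bar>v y\<bar> + ?A)"
        using wA by linarith
    qed (use wy G_nonneg in auto)
    finally show ?thesis
      by (simp add: mult_ac)
  qed
  show ?case
    using int 1 2 by simp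
qed

lemma semigroup_L_term_bound:
  "\<bar>t ^ n / fact n * (L_op g ^^ n) v y\<bar>
     \<le> (2 * G * \<bar>t\<bar>) ^ n / fact n * (\<bar>v y\<bar> + avg (\<lambda>z. \<bar>v z\<bar>))"
proof -
  have "\<bar>t ^ n / fact n * (L_op g ^^ n) v y\<bar> = \<bar>t\<bar> ^ n / fact n * \<bar>(L_op g ^^ n) v y\<bar>"
    by (simp add: abs_mult power_abs)
  also have "\<dots> \<le> \<bar>t\<bar> ^ n / fact n * ((2 * G) ^ n * (\<bar>v y\<bar> + avg (\<lambda>z. \<bar>v z\<bar>)))"
    using L_op_power_bound[of n] by (intro mult_left_mono) auto
  finally show ?thesis
    by (simp add: power_mult_distrib mult_ac)
qed

lemma summable_majorant: "summable (\<lambda>n. (2 * G * \<bar>t\<bar>) ^ n / fact n * (c::real))"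
  using summable_exp[of "2 * G * \<bar>t\<bar>"] by (intro summable_mult2) (simp add: field_simps)

lemma semigroup_L_summable: "summable (\<lambda>n. t ^ n / fact n * (L_op g ^^ n) v y)"
  using semigroup_L_term_bound by (intro summable_comparison_test'[OF summable_majorant]) auto

lemma semigroup_L_tendsto_L2:
  "(\<lambda>N. LINT y|lebesgue_on unit_cell.
      ((\<Sum>n<N. t ^ n / fact n * (L_op g ^^ n) v y) - semigroup_L g t v y)\<^sup>2) \<longlonglongrightarrow> 0"
proof -
  let ?M = "lebesgue_on (unit_cell :: (real ^ 'n) set)"
  let ?a = "\<lambda>n y. t ^ n / fact n * (L_op g ^^ n) v y"
  let ?S = "\<lambda>N y. \<Sum>n<N. ?a n y"
  let ?A = "avg (\<lambda>z. \<bar>v z\<bar>)" and ?q = "\<lambda>n. (2 * G * \<bar>t\<bar>) ^ n / fact n"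
  let ?E = "\<Sum>n. ?q n"
  have q: "summable ?q"
    using summable_majorant[of 1] by simp
  have q0: "0 \<le> ?q n" for n
    using G_nonneg by simp
  have A: "0 \<le> ?A"
    unfolding avg_def by (rule integral_nonneg_AE) auto
  have lim: "(\<lambda>N. ?S N y) \<longlonglongrightarrow> semigroup_L g t v y" for y
    unfolding semigroup_L_def using semigroup_L_summable[of y] by (rule summable_LIMSEQ)
  have meas_a: "?a n \<in> borel_measurable ?M" for n
    using L_op_power_bound[of n] by (intro borel_measurable_times) auto
  have meas_S: "?S N \<in> borel_measurable ?M" for N
    by (intro borel_measurable_sum meas_a)
  have meas_lim: "semigroup_L g t v \<in> borel_measurable ?M"
    by (rule borel_measurable_LIMSEQ_real[OF lim meas_S])
  have S_bound: "\<bar>?S N y\<bar> \<le> ?E * (\<bar>v y\<bar> + ?A)" for N y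
  proof -
    have "\<bar>?S N y\<bar> \<le> (\<Sum>n<N. ?q n * (\<bar>v y\<bar> + ?A))"
      using semigroup_L_term_bound by (intro order_trans[OF sum_abs] sum_mono) auto
    also have "\<dots> = (\<Sum>n<N. ?q n) * (\<bar>v y\<bar> + ?A)"
      by (simp add: sum_distrib_right)
    also have "\<dots> \<le> ?E * (\<bar>v y\<bar> + ?A)"
      using A q q0 by (intro mult_right_mono sum_le_suminf) auto
    finally show ?thesis .
  qed
  have lim_bound: "\<bar>semigroup_L g t v y\<bar> \<le> ?E * (\<bar>v y\<bar> + ?A)" for y
    using S_bound by (intro LIMSEQ_le_const2[OF tendsto_rabs[OF lim]]) auto
  let ?w = "\<lambda>y. (2 * ?E * (\<bar>v y\<bar> + ?A))\<^sup>2"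
  have "integrable ?M (\<lambda>y. (2 * ?E)\<^sup>2 * ((v y)\<^sup>2 + (2 * ?A) * \<bar>v y\<bar> + ?A\<^sup>2))"
    using v_L2 integrable_v
    by (intro integrable_mult_right Bochner_Integration.integrable_add) (auto simp: L2_def)
  then have w: "integrable ?M ?w"
    by (simp add: power_mult_distrib power2_sum mult_ac add_ac)
  have "(\<lambda>N. LINT y|?M. (?S N y - semigroup_L g t v y)\<^sup>2) \<longlonglongrightarrow> (LINT y|?M. 0)"
  proof (rule integral_dominated_convergence[where w = ?w])
    show "AE y in ?M. (\<lambda>N. (?S N y - semigroup_L g t v y)\<^sup>2) \<longlonglongrightarrow> 0"
    proof (rule AE_I2)
      fix y
      have "(\<lambda>N. (?S N y - semigroup_L g t v y)\<^sup>2) \<longlonglongrightarrow> (semigroup_L g t v y - semigroup_L g t v y)\<^sup>2"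
        by (intro tendsto_intros lim)
      then show "(\<lambda>N. (?S N y - semigroup_L g t v y)\<^sup>2) \<longlonglongrightarrow> 0"
        by simp
    qed
    show "AE y in ?M. norm ((?S N y - semigroup_L g t v y)\<^sup>2) \<le> ?w y" for N
    proof (rule AE_I2)
      fix y
      have "\<bar>?S N y - semigroup_L g t v y\<bar> \<le> 2 * ?E * (\<bar>v y\<bar> + ?A)"
        using S_bound[of y N] lim_bound[of y] by linarith
      then show "norm ((?S N y - semigroup_L g t v y)\<^sup>2) \<le> ?w y"
        by (simp add: abs_le_square_iff[symmetric] del: abs_le_square_iff)
    qed
    show "(\<lambda>y. (?S N y - semigroup_L g t v y)\<^sup>2) \<in> borel_measurable ?M" for N
      by (intro borel_measurable_power borel_measurable_diff meas_S meas_lim)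
  qed (use w in auto)
  then show ?thesis
    by simp
qed

end

end

theory Submission
  imports Defs
begin

text \<open>
  At a fixed point the equation for \<open>u \<epsilon>\<close> is a linear ordinary differential equation in time, and
  absolutely continuous solutions of such an equation are unique. Hence, for almost every \<open>x\<close>,
  \<open>u \<epsilon> t x = U t x (x / \<epsilon>)\<close>, where
  \<open>U t x y = exp (- t \<sigma>(x,y)) (u_in(x,y) + \<integral>\<^sub>0\<^sup>t exp (s \<sigma>(x,y)) f(s,x,y) ds)\<close> no longer contains
  \<open>\<epsilon>\<close> (\<open>linear_ode_unique\<close>, \<open>cell_solution\<close>). All oscillation sits in the periodic variable \<open>y\<close>.

  If a jointly measurable \<open>k z y\<close> is continuous and periodic in \<open>y\<close> and dominated, uniformly in \<open>y\<close>, by an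
  integrable function of \<open>z\<close>, then the integral of \<open>k z (x / \<epsilon>)\<close> over \<open>z = (t, x)\<close>
  tends to the integral of its cell average (\<open>two_scale_limit\<close>). For a product \<open>A z * c y\<close> this follows by
  translating \<open>x\<close> by \<open>\<epsilon> y\<close> and averaging over \<open>y\<close>: the translation changes \<open>A\<close> little in the
  mean, and the average of \<open>c (x / \<epsilon> + y)\<close> over the cell does not depend on \<open>x\<close>. The general case is
  reduced to finite sums of products by freezing \<open>y\<close> on a fine periodic grid. The weak limit of
  \<open>u \<epsilon>\<close> is therefore \<open>u_hom t x\<close>, the cell average of \<open>U t x\<close>.

  Averaging \<open>\<partial>\<^sub>t U = f - \<sigma> U\<close> leaves the unknown moment \<open>\<langle>\<sigma> U\<rangle>\<close>, and the memory term expresses it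
  through \<open>u_hom\<close>. Let \<open>\<psi> \<tau>\<close> be the image of \<open>\<sigma>\<close> under the exponential of \<open>- \<tau>\<close> times the
  transposed operator \<open>p \<mapsto> \<sigma> p - \<sigma> \<langle>p\<rangle>\<close>. Then
  \<open>\<langle>\<sigma> exp (- \<tau> L_op \<sigma>) w\<rangle> = \<langle>\<psi> \<tau> w\<rangle>\<close> for bounded \<open>w\<close> (\<open>avg_mult_semigroup_L\<close>), so a single function
  governs the kernel and both parts of the source. Integrating by parts the products \<open>\<psi> (t - s) U s\<close>
  and \<open>\<langle>\<psi> (t - s)\<rangle> \<langle>U s\<rangle>\<close> over \<open>s\<close> and subtracting yields \<open>\<langle>\<sigma> U t\<rangle>\<close> in terms of the history of
  \<open>u_hom\<close> (\<open>avg_mult_cell_solution_memory\<close>). Since \<open>u_hom\<close> is the indefinite integral of a bounded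
  function of time, Lebesgue's differentiation theorem turns this into the equation at almost every time
  (\<open>avg_cell_solution_solves\<close>).

  The data are strongly measurable with respect to completed measures. They are first replaced by Borel
  representatives that agree with them almost everywhere (\<open>Bochner_Linf_borel_representative\<close>,
  \<open>Bochner_L2_borel_representative\<close>), so that their sections and integrals over the cell are measurable.
\<close>

section \<open>Absolutely continuous functions\<close>

text \<open>
  A gauge argument. Where the derivative exists, a small gauge makes the increment of \<open>h\<close> over a
  tagged interval close to its linear approximation. The remaining points form a null set and lie in an
  open set of small measure; intervals tagged there have small total length, so absolute continuity makes
  their total increment small.
\<close>
lemma absolutely_continuous_fun_has_integral_deriv:
  assumes ab: "a \<le> b" and ac: "absolutely_continuous_fun a b h"
    and deriv: "AE t in lebesgue_on {a<..<b}. (h has_real_derivative h' t) (at t)"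
  shows "(h' has_integral (h b - h a)) {a..b}"
proof -
  define N where "N = {a, b} \<union> {t \<in> {a<..<b}. \<not> (h has_real_derivative h' t) (at t)}"
  have "{t \<in> {a<..<b}. \<not> (h has_real_derivative h' t) (at t)} \<in> null_sets lebesgue"
    using deriv by (subst (asm) AE_restrict_space_iff)
      (auto simp: completion.AE_iff_null_sets set_eq_iff elim!: back_subst[of "\<lambda>x. x \<in> _"])
  then have negN: "negligible N"
    unfolding N_def by (intro negligible_Un) (auto simp: negligible_iff_null_sets)
  \<comment> \<open>changing the integrand on a null set makes the contribution of the exceptional tags vanish\<close>
  define k where "k t = (if t \<in> N then 0 else h' t)" for t
  have "(k has_integral (h b - h a)) (cbox a b)"
    unfolding has_integral
  proof (intro allI impI)
    fix e :: real assume "0 < e"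
    then have "0 < e / 2" by simp
    with ac obtain \<delta> where "0 < \<delta>" and \<delta>: "\<And>(n::nat) l r.
        (\<forall>i<n. a \<le> l i \<and> l i \<le> r i \<and> r i \<le> b) \<Longrightarrow>
        disjoint_family_on (\<lambda>i. {l i<..<r i}) {..<n} \<Longrightarrow> (\<Sum>i<n. r i - l i) < \<delta> \<Longrightarrow>
         (\<Sum>i<n. \<bar>h (r i) - h (l i)\<bar>) < e / 2"
      unfolding absolutely_continuous_fun_def by meson
    have NL: "N \<in> null_sets lebesgue"
      using negN by (simp add: negligible_iff_null_sets)
    then have "N \<in> lmeasurable" by (simp add: fmeasurableI_null_sets)
    then obtain W where W: "open W" "N \<subseteq> W" "W - N \<in> lmeasurable" "emeasure lebesgue (W - N) < ennreal \<delta>"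
      using sets_lebesgue_outer_open[of N \<delta>] \<open>0 < \<delta>\<close> by auto
    have eW: "emeasure lebesgue W < ennreal \<delta>"
    proof -
      have "emeasure lebesgue ((W - N) \<union> N) = emeasure lebesgue (W - N)"
        using W NL by (intro emeasure_Un_null_set) auto
      moreover have "(W - N) \<union> N = W" using W by auto
      ultimately show ?thesis using W by simp
    qed
    \<comment> \<open>the \<open>+ 2\<close> keeps the denominator positive when \<open>a = b\<close>\<close>
    define e' where "e' = e / (2 * (b - a) + 2)"
    have "0 < e'" using \<open>0 < e\<close> ab by (simp add: e'_def)
    have "\<exists>d>0. \<forall>y. \<bar>y - t\<bar> < d \<longrightarrow> \<bar>h y - h t - h' t * (y - t)\<bar> \<le> e' * \<bar>y - t\<bar>"
      if "t \<in> {a..b} - N" for t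
    proof -
      have "(h has_derivative (\<lambda>y. h' t * y)) (at t)"
        using that unfolding N_def has_field_derivative_def[symmetric] by auto
      from this[unfolded has_derivative_at_alt] \<open>0 < e'\<close> show ?thesis
        by (auto simp: algebra_simps)
    qed
    then obtain d where d: "\<And>t. t \<in> {a..b} - N \<Longrightarrow> 0 < d t"
      "\<And>t y. t \<in> {a..b} - N \<Longrightarrow> \<bar>y - t\<bar> < d t \<Longrightarrow> \<bar>h y - h t - h' t * (y - t)\<bar> \<le> e' * \<bar>y - t\<bar>"
      by metis
    define \<gamma> where "\<gamma> t = (if t \<in> N then W else if t \<in> {a..b} then ball t (d t) else UNIV)" for t
    have "gauge \<gamma>"
      using W d(1) by (auto simp: gauge_def \<gamma>_def)
    moreover have "norm ((\<Sum>(x, K)\<in>\<D>. measure lborel K *\<^sub>R k x) - (h b - h a)) < e"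
      if D: "\<D> tagged_division_of (cbox a b)" and fine: "\<gamma> fine \<D>" for \<D>
    proof -
      have fin: "finite \<D>" using D by blast
      have K: "\<exists>l r. K = {l..r} \<and> a \<le> l \<and> l \<le> x \<and> x \<le> r \<and> r \<le> b" if xK: "(x, K) \<in> \<D>" for x K
      proof -
        obtain l r where lr: "K = cbox l r" using tagged_division_ofD(4)[OF D xK] by blast
        moreover have "x \<in> K" "K \<subseteq> cbox a b"
          using tagged_division_ofD(2,3)[OF D xK] by auto
        ultimately show ?thesis by (auto intro!: exI[of _ l] exI[of _ r])
      qed
      let ?h = "\<lambda>K. h (Sup K) - h (Inf K)"
      have tele: "(\<Sum>(x, K)\<in>\<D>. ?h K) = h b - h a"
        using additive_tagged_division_1[OF ab, of \<D> h] D by (simp add: split_def)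
      have eqsum: "(\<Sum>(x, K)\<in>\<D>. measure lborel K *\<^sub>R k x) - (h b - h a)
          = (\<Sum>(x, K)\<in>\<D>. measure lborel K *\<^sub>R k x - ?h K)"
        unfolding tele[symmetric] by (simp add: split_def sum_subtractf)
      let ?A = "{p \<in> \<D>. fst p \<in> N}" and ?B = "{p \<in> \<D>. fst p \<notin> N}"
      have split: "(\<Sum>(x, K)\<in>\<D>. measure lborel K *\<^sub>R k x - ?h K)
          = (\<Sum>(x, K)\<in>?A. measure lborel K *\<^sub>R k x - ?h K) + (\<Sum>(x, K)\<in>?B. measure lborel K *\<^sub>R k x - ?h K)"
        using fin by (subst sum.union_disjoint[symmetric]) (auto intro!: sum.cong)
      have sumB: "\<bar>\<Sum>(x, K)\<in>?B. measure lborel K *\<^sub>R k x - ?h K\<bar> \<le> e' * (b - a)"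
      proof -
        have "\<bar>\<Sum>(x, K)\<in>?B. measure lborel K *\<^sub>R k x - ?h K\<bar> \<le> (\<Sum>(x, K)\<in>?B. e' * measure lborel K)"
        proof (rule order_trans[OF sum_abs], rule sum_mono, clarsimp)
          fix x K assume xK: "(x, K) \<in> \<D>" "x \<notin> N"
          obtain l r where lr: "K = {l..r}" "a \<le> l" "l \<le> x" "x \<le> r" "r \<le> b" using K[OF xK(1)] by blast
          have x: "x \<in> {a..b} - N" using lr xK by auto
          have "K \<subseteq> ball x (d x)" using fineD[OF fine xK(1)] xK x by (auto simp: \<gamma>_def)
          moreover have "l \<in> K" "r \<in> K" using lr by auto
          ultimately have "l \<in> ball x (d x)" "r \<in> ball x (d x)" by blast+
          then have "\<bar>h l - h x - h' x * (l - x)\<bar> \<le> e' * \<bar>l - x\<bar>" "\<bar>h r - h x - h' x * (r - x)\<bar> \<le> e' * \<bar>r - x\<bar>"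
            using d(2)[OF x] by (auto simp: dist_real_def abs_minus_commute)
          moreover have "e' * \<bar>l - x\<bar> + e' * \<bar>r - x\<bar> = e' * (r - l)"
            using lr by (simp add: algebra_simps)
          moreover have "(r - l) * h' x - (h r - h l)
              = (h l - h x - h' x * (l - x)) - (h r - h x - h' x * (r - x))"
            by (simp add: algebra_simps)
          ultimately have "\<bar>(r - l) * h' x - (h r - h l)\<bar> \<le> e' * (r - l)" by linarith
          then show "\<bar>measure lborel K * k x - (h (Sup K) - h (Inf K))\<bar> \<le> e' * measure lborel K"
            using lr xK by (simp add: k_def)
        qed
        also have "\<dots> \<le> (\<Sum>(x, K)\<in>\<D>. e' * measure lborel K)"
          using fin \<open>0 < e'\<close> by (intro sum_mono2) auto
        also have "\<dots> = e' * (b - a)"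
          using additive_content_tagged_division[OF D] ab
          by (simp add: split_def sum_distrib_left[symmetric])
        finally show ?thesis .
      qed
      have sumA: "(\<Sum>(x, K)\<in>?A. \<bar>?h K\<bar>) < e / 2"
      proof -
        have "finite ?A" using fin by simp
        then obtain q where q: "bij_betw q {..<card ?A} ?A"
          using ex_bij_betw_nat_finite[of ?A] unfolding atLeast0LessThan by blast
        let ?n = "card ?A"
        define l where "l i = Inf (snd (q i))" for i
        define r where "r i = Sup (snd (q i))" for i
        have qA: "q i \<in> \<D>" "fst (q i) \<in> N" if "i < ?n" for i
          using bij_betwE[OF q] that by auto
        have lr: "snd (q i) = {l i..r i} \<and> a \<le> l i \<and> l i \<le> r i \<and> r i \<le> b" if "i < ?n" for i
        proof -
          have "(fst (q i), snd (q i)) \<in> \<D>" using qA[OF that] by simp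
          then obtain l' r' where lr': "snd (q i) = {l'..r'}" "a \<le> l'" "l' \<le> fst (q i)"
              "fst (q i) \<le> r'" "r' \<le> b"
            using K by blast
          have "l i = l'" "r i = r'" unfolding l_def r_def lr'(1) using lr' by auto
          with lr' show ?thesis by auto
        qed
        have disj: "disjoint_family_on (\<lambda>i. {l i<..<r i}) {..<?n}"
          unfolding disjoint_family_on_def
        proof (intro ballI impI)
          fix i j assume ij: "i \<in> {..<?n}" "j \<in> {..<?n}" "i \<noteq> j"
          then have "q i \<noteq> q j" using q by (auto simp: bij_betw_def inj_on_def)
          moreover have "(fst (q i), snd (q i)) \<in> \<D>" "(fst (q j), snd (q j)) \<in> \<D>" using qA ij by auto
          ultimately have "interior (snd (q i)) \<inter> interior (snd (q j)) = {}"
            by (intro tagged_division_ofD(5)[OF D, of "fst (q i)" _ "fst (q j)"]) (auto simp: prod_eq_iff)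
          then show "{l i<..<r i} \<inter> {l j<..<r j} = {}" using lr ij by (simp add: interior_atLeastAtMost_real)
        qed
        have "ennreal (\<Sum>i<?n. r i - l i) = (\<Sum>i<?n. emeasure lebesgue {l i<..<r i})"
          using lr by (subst sum_ennreal[symmetric]) auto
        also have "\<dots> = emeasure lebesgue (\<Union>i<?n. {l i<..<r i})"
          using disj by (intro sum_emeasure) auto
        also have "\<dots> \<le> emeasure lebesgue W"
        proof (rule emeasure_mono)
          show "(\<Union>i<?n. {l i<..<r i}) \<subseteq> W"
          proof (intro UN_least)
            fix i assume "i \<in> {..<?n}"
            then have i: "i < ?n" by simp
            have "(fst (q i), snd (q i)) \<in> \<D>" using qA[OF i] by simp
            then have "snd (q i) \<subseteq> W" using fine qA[OF i] unfolding fine_def \<gamma>_def by fastforce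
            then show "{l i<..<r i} \<subseteq> W" using lr[OF i] by auto
          qed
        qed (use W in auto)
        also have "\<dots> < ennreal \<delta>" by (rule eW)
        finally have "ennreal (\<Sum>i<?n. r i - l i) < ennreal \<delta>" .
        moreover have "0 \<le> (\<Sum>i<?n. r i - l i)" by (intro sum_nonneg) (use lr in auto)
        ultimately have "(\<Sum>i<?n. r i - l i) < \<delta>"
          by (simp add: ennreal_less_iff)
        then have "(\<Sum>i<?n. \<bar>h (r i) - h (l i)\<bar>) < e / 2"
          using lr disj by (intro \<delta>) auto
        moreover have "(\<Sum>i<?n. \<bar>h (r i) - h (l i)\<bar>) = (\<Sum>p\<in>?A. \<bar>?h (snd p)\<bar>)"
          using sum.reindex_bij_betw[OF q, of "\<lambda>p. \<bar>?h (snd p)\<bar>"] by (simp only: l_def r_def)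
        ultimately show ?thesis by (simp add: split_def)
      qed
      have "\<bar>\<Sum>(x, K)\<in>?A. measure lborel K *\<^sub>R k x - ?h K\<bar> \<le> (\<Sum>(x, K)\<in>?A. \<bar>?h K\<bar>)"
        by (rule order_trans[OF sum_abs]) (auto intro!: sum_mono simp: k_def)
      moreover have "e' * (b - a) < e / 2"
        using \<open>0 < e\<close> ab by (simp add: e'_def field_simps)
      ultimately show ?thesis
        unfolding eqsum split using sumA sumB by (simp add: real_norm_def)
    qed
    ultimately show "\<exists>\<gamma>. gauge \<gamma> \<and> (\<forall>\<D>. \<D> tagged_division_of cbox a b \<and> \<gamma> fine \<D> \<longrightarrow>
        norm ((\<Sum>(x, K)\<in>\<D>. measure lborel K *\<^sub>R k x) - (h b - h a)) < e)"
      by (intro exI[of _ "\<gamma>"]) (simp only: simp_thms, blast)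
  qed
  then have "(k has_integral (h b - h a)) {a..b}" by (simp only: box_real)
  then show ?thesis
    by (rule has_integral_spike[OF negN, rotated]) (simp add: k_def)
qed

lemma lipschitz_imp_absolutely_continuous_fun:
  assumes "\<And>s t. a \<le> s \<Longrightarrow> s \<le> t \<Longrightarrow> t \<le> b \<Longrightarrow> \<bar>h t - h s\<bar> \<le> C * (t - s)"
  shows "absolutely_continuous_fun a b h"
  unfolding absolutely_continuous_fun_def
proof (intro allI impI)
  fix e :: real assume e: "0 < e"
  define d where "d = e / (\<bar>C\<bar> + 1)"
  have "0 < d" using e by (simp add: d_def)
  moreover have "(\<Sum>i<n. \<bar>h (r i) - h (l i)\<bar>) < e"
    if lr: "\<forall>i<n. a \<le> l i \<and> l i \<le> r i \<and> r i \<le> b" and s: "(\<Sum>i<n. r i - l i) < d" for n :: nat and l r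
  proof -
    have "(\<Sum>i<n. \<bar>h (r i) - h (l i)\<bar>) \<le> (\<Sum>i<n. (\<bar>C\<bar> + 1) * (r i - l i))"
    proof (rule sum_mono)
      fix i assume "i \<in> {..<n}"
      then have "a \<le> l i" "l i \<le> r i" "r i \<le> b" using lr by auto
      then have "\<bar>h (r i) - h (l i)\<bar> \<le> C * (r i - l i)" by (rule assms)
      also have "\<dots> \<le> (\<bar>C\<bar> + 1) * (r i - l i)"
        using \<open>l i \<le> r i\<close> by (intro mult_right_mono) auto
      finally show "\<bar>h (r i) - h (l i)\<bar> \<le> (\<bar>C\<bar> + 1) * (r i - l i)" .
    qed
    also have "\<dots> = (\<bar>C\<bar> + 1) * (\<Sum>i<n. r i - l i)" by (simp add: sum_distrib_left)
    also have "\<dots> < (\<bar>C\<bar> + 1) * d" using s by (intro mult_strict_left_mono) auto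
    also have "\<dots> = e" by (simp add: d_def)
    finally show ?thesis .
  qed
  ultimately show "\<exists>\<delta>>0. \<forall>(n::nat) l r. (\<forall>i<n. a \<le> l i \<and> l i \<le> r i \<and> r i \<le> b) \<and>
      disjoint_family_on (\<lambda>i. {l i<..<r i}) {..<n} \<and> (\<Sum>i<n. r i - l i) < \<delta> \<longrightarrow>
      (\<Sum>i<n. \<bar>h (r i) - h (l i)\<bar>) < e"
    by blast
qed

lemma absolutely_continuous_fun_mult:
  assumes g: "absolutely_continuous_fun a b g" and h: "absolutely_continuous_fun a b h"
    and gB: "\<And>t. a \<le> t \<Longrightarrow> t \<le> b \<Longrightarrow> \<bar>g t\<bar> \<le> B" and hC: "\<And>t. a \<le> t \<Longrightarrow> t \<le> b \<Longrightarrow> \<bar>h t\<bar> \<le> C"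
  shows "absolutely_continuous_fun a b (\<lambda>t. g t * h t)"
  unfolding absolutely_continuous_fun_def
proof (intro allI impI)
  fix e :: real assume e: "0 < e"
  \<comment> \<open>one constant that bounds both factors and is positive\<close>
  define D where "D = \<bar>B\<bar> + \<bar>C\<bar> + 1"
  have D: "0 < D" by (simp add: D_def)
  have e': "0 < e / (2 * D)" using e D by simp
  obtain d1 where "0 < d1" and d1: "\<And>(n::nat) l r. (\<forall>i<n. a \<le> l i \<and> l i \<le> r i \<and> r i \<le> b) \<Longrightarrow>
        disjoint_family_on (\<lambda>i. {l i<..<r i}) {..<n} \<Longrightarrow> (\<Sum>i<n. r i - l i) < d1 \<Longrightarrow>
         (\<Sum>i<n. \<bar>g (r i) - g (l i)\<bar>) < e / (2 * D)"
    using g e' unfolding absolutely_continuous_fun_def by meson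
  obtain d2 where "0 < d2" and d2: "\<And>(n::nat) l r. (\<forall>i<n. a \<le> l i \<and> l i \<le> r i \<and> r i \<le> b) \<Longrightarrow>
        disjoint_family_on (\<lambda>i. {l i<..<r i}) {..<n} \<Longrightarrow> (\<Sum>i<n. r i - l i) < d2 \<Longrightarrow>
         (\<Sum>i<n. \<bar>h (r i) - h (l i)\<bar>) < e / (2 * D)"
    using h e' unfolding absolutely_continuous_fun_def by meson
  have "(\<Sum>i<n. \<bar>g (r i) * h (r i) - g (l i) * h (l i)\<bar>) < e"
    if lr: "\<forall>i<n. a \<le> l i \<and> l i \<le> r i \<and> r i \<le> b"
      and disj: "disjoint_family_on (\<lambda>i. {l i<..<r i}) {..<n}"
      and s: "(\<Sum>i<n. r i - l i) < min d1 d2" for n :: nat and l r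
  proof -
    have "(\<Sum>i<n. \<bar>g (r i) * h (r i) - g (l i) * h (l i)\<bar>)
        \<le> (\<Sum>i<n. D * \<bar>g (r i) - g (l i)\<bar> + D * \<bar>h (r i) - h (l i)\<bar>)"
    proof (rule sum_mono)
      fix i assume "i \<in> {..<n}"
      then have i: "a \<le> l i" "l i \<le> r i" "r i \<le> b" using lr by auto
      have "g (r i) * h (r i) - g (l i) * h (l i)
          = h (r i) * (g (r i) - g (l i)) + g (l i) * (h (r i) - h (l i))"
        by (simp add: algebra_simps)
      then have "\<bar>g (r i) * h (r i) - g (l i) * h (l i)\<bar>
          \<le> \<bar>h (r i)\<bar> * \<bar>g (r i) - g (l i)\<bar> + \<bar>g (l i)\<bar> * \<bar>h (r i) - h (l i)\<bar>"
        by (metis abs_mult abs_triangle_ineq)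
      also have "\<dots> \<le> D * \<bar>g (r i) - g (l i)\<bar> + D * \<bar>h (r i) - h (l i)\<bar>"
        using gB[of "l i"] hC[of "r i"] i unfolding D_def
        by (intro add_mono mult_right_mono) auto
      finally show "\<bar>g (r i) * h (r i) - g (l i) * h (l i)\<bar>
          \<le> D * \<bar>g (r i) - g (l i)\<bar> + D * \<bar>h (r i) - h (l i)\<bar>" .
    qed
    also have "\<dots> = D * (\<Sum>i<n. \<bar>g (r i) - g (l i)\<bar>) + D * (\<Sum>i<n. \<bar>h (r i) - h (l i)\<bar>)"
      by (simp add: sum.distrib sum_distrib_left)
    also have "\<dots> < D * (e / (2 * D)) + D * (e / (2 * D))"
      using D s lr disj by (intro add_strict_mono mult_strict_left_mono d1 d2) auto
    also have "\<dots> = e" using D by (simp add: field_simps)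
    finally show ?thesis .
  qed
  then show "\<exists>\<delta>>0. \<forall>(n::nat) l r. (\<forall>i<n. a \<le> l i \<and> l i \<le> r i \<and> r i \<le> b) \<and>
      disjoint_family_on (\<lambda>i. {l i<..<r i}) {..<n} \<and> (\<Sum>i<n. r i - l i) < \<delta> \<longrightarrow>
      (\<Sum>i<n. \<bar>g (r i) * h (r i) - g (l i) * h (l i)\<bar>) < e"
    using \<open>0 < d1\<close> \<open>0 < d2\<close> by (intro exI[of _ "min d1 d2"]) auto
qed

lemma absolutely_continuous_fun_imp_bounded:
  assumes "absolutely_continuous_fun a b h"
  shows "\<exists>B. \<forall>t. a \<le> t \<and> t \<le> b \<longrightarrow> \<bar>h t\<bar> \<le> B"
proof -
  have "continuous_on {a..b} h"
    unfolding continuous_on_iff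
  proof (intro ballI allI impI)
    fix x e :: real assume x: "x \<in> {a..b}" and e: "0 < e"
    obtain d where "0 < d" and d: "\<And>(n::nat) l r. (\<forall>i<n. a \<le> l i \<and> l i \<le> r i \<and> r i \<le> b) \<Longrightarrow>
        disjoint_family_on (\<lambda>i. {l i<..<r i}) {..<n} \<Longrightarrow> (\<Sum>i<n. r i - l i) < d \<Longrightarrow>
         (\<Sum>i<n. \<bar>h (r i) - h (l i)\<bar>) < e"
      using assms e unfolding absolutely_continuous_fun_def by meson
    have "dist (h y) (h x) < e" if "y \<in> {a..b}" "dist y x < d" for y
      using d[of 1 "\<lambda>_. x" "\<lambda>_. y"] d[of 1 "\<lambda>_. y" "\<lambda>_. x"] that x
      by (cases "x \<le> y") (auto simp: disjoint_family_on_def dist_real_def abs_minus_commute)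
    then show "\<exists>d>0. \<forall>y\<in>{a..b}. dist y x < d \<longrightarrow> dist (h y) (h x) < e"
      using \<open>0 < d\<close> by blast
  qed
  then have "bounded (h ` {a..b})"
    by (intro compact_imp_bounded compact_continuous_image) auto
  then show ?thesis unfolding bounded_iff by (metis atLeastAtMost_iff imageI real_norm_def)
qed

lemma bounded_deriv_imp_absolutely_continuous_fun:
  fixes f :: "real \<Rightarrow> real"
  assumes f: "\<And>s. a \<le> s \<Longrightarrow> s \<le> b \<Longrightarrow> (f has_real_derivative f' s) (at s)"
    and K: "\<And>s. a \<le> s \<Longrightarrow> s \<le> b \<Longrightarrow> \<bar>f' s\<bar> \<le> K"
  shows "absolutely_continuous_fun a b f"
proof (rule lipschitz_imp_absolutely_continuous_fun)
  fix s t assume st: "a \<le> s" "s \<le> t" "t \<le> b"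
  have "norm (f t - f s) \<le> K * norm (t - s)"
    by (rule field_differentiable_bound[of "{a..b}" f f'])
      (use st K in \<open>auto intro: has_field_derivative_at_within f\<close>)
  then show "\<bar>f t - f s\<bar> \<le> K * (t - s)" using st by simp
qed

lemma absolutely_continuous_fun_subinterval:
  assumes h: "absolutely_continuous_fun a b h" and ab: "a \<le> a'" "b' \<le> b"
  shows "absolutely_continuous_fun a' b' h"
  unfolding absolutely_continuous_fun_def
proof (intro allI impI)
  fix e :: real assume "0 < e"
  then obtain d where d: "0 < d" "\<And>(n::nat) l r.
        (\<forall>i<n. a \<le> l i \<and> l i \<le> r i \<and> r i \<le> b) \<and>
        disjoint_family_on (\<lambda>i. {l i<..<r i}) {..<n} \<and> (\<Sum>i<n. r i - l i) < d
        \<longrightarrow> (\<Sum>i<n. \<bar>h (r i) - h (l i)\<bar>) < e"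
    using h unfolding absolutely_continuous_fun_def by meson
  have "(\<Sum>i<n. \<bar>h (r i) - h (l i)\<bar>) < e"
    if "(\<forall>i<n. a' \<le> l i \<and> l i \<le> r i \<and> r i \<le> b') \<and>
        disjoint_family_on (\<lambda>i. {l i<..<r i}) {..<n} \<and> (\<Sum>i<n. r i - l i) < d" for n :: nat and l r
    using that ab by (intro d(2)[rule_format]) (meson order_trans)
  then show "\<exists>\<delta>>0. \<forall>(n::nat) l r. (\<forall>i<n. a' \<le> l i \<and> l i \<le> r i \<and> r i \<le> b') \<and>
      disjoint_family_on (\<lambda>i. {l i<..<r i}) {..<n} \<and> (\<Sum>i<n. r i - l i) < \<delta> \<longrightarrow>
      (\<Sum>i<n. \<bar>h (r i) - h (l i)\<bar>) < e"
    using d(1) by blast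
qed

section \<open>Indefinite integrals of bounded functions\<close>

lemma set_integrable_bounded_Icc:
  fixes g :: "real \<Rightarrow> real"
  assumes [measurable]: "g \<in> borel_measurable borel" and "\<And>s. a \<le> s \<Longrightarrow> s \<le> b \<Longrightarrow> \<bar>g s\<bar> \<le> B"
  shows "set_integrable lborel {a..b} g"
  unfolding set_integrable_def
proof (rule Bochner_Integration.integrable_bound)
  show "integrable lborel (\<lambda>s. B * indicator {a..b} s)"
    by (cases "a \<le> b") auto
  show "AE s in lborel. norm (indicator {a..b} s *\<^sub>R g s) \<le> norm (B * indicator {a..b} s)"
    using assms(2) by (intro AE_I2) (force simp: indicator_def)
qed simp

text \<open>
  The fundamental theorem above concerns the gauge integral, while Fubini is used for the Lebesgue
  integral; for bounded Borel functions the two coincide.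
\<close>
lemma set_lebesgue_integral_eq_HK:
  fixes g :: "real \<Rightarrow> real"
  assumes "g \<in> borel_measurable borel" and "\<And>s. a \<le> s \<Longrightarrow> s \<le> b \<Longrightarrow> \<bar>g s\<bar> \<le> B"
  shows "(g has_integral (LBINT s:{a..b}. g s)) {a..b}"
  using set_borel_integral_eq_integral[OF set_integrable_bounded_Icc[OF assms]]
  by (simp add: has_integral_iff)

lemma LBINT_singleton: "(LBINT s:{a::real}. k s) = (0::real)"
proof -
  have "AE s in lborel. indicator {a} s *\<^sub>R k s = 0"
    using AE_lborel_singleton[of a] by eventually_elim auto
  then show ?thesis
    unfolding set_lebesgue_integral_def by (rule integral_eq_zero_AE)
qed

context
  fixes g G :: "real \<Rightarrow> real" and G0 B T :: real
  assumes g_meas: "g \<in> borel_measurable borel"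
    and g_bound: "\<And>s. 0 \<le> s \<Longrightarrow> s \<le> T \<Longrightarrow> \<bar>g s\<bar> \<le> B"
    and G_eq: "\<And>s. 0 \<le> s \<Longrightarrow> s \<le> T \<Longrightarrow> G s = G0 + (LBINT r:{0..s}. g r)"
begin

lemma indefinite_integral_diff:
  assumes "0 \<le> s" "s \<le> t" "t \<le> T"
  shows "(g has_integral (G t - G s)) {s..t}"
proof -
  have 1: "(g has_integral (G s - G0)) {0..s}" "(g has_integral (G t - G0)) {0..t}"
    using set_lebesgue_integral_eq_HK[of g 0 s B] set_lebesgue_integral_eq_HK[of g 0 t B] assms g_meas g_bound
    by (auto simp: G_eq)
  have "g integrable_on {s..t}"
    by (rule integrable_on_subinterval[OF has_integral_integrable[OF 1(2)]]) (use assms in auto)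
  then have 2: "(g has_integral (integral {s..t} g)) {s..t}"
    by (rule integrable_integral)
  from has_integral_combine[OF _ _ 1(1) 2] assms have "(g has_integral (G s - G0 + integral {s..t} g)) {0..t}"
    by simp
  then have "G s - G0 + integral {s..t} g = G t - G0" using 1(2) by (rule has_integral_unique)
  then have "integral {s..t} g = G t - G s" by linarith
  with 2 show ?thesis by simp
qed

lemma indefinite_integral_lipschitz:
  assumes "0 \<le> s" "s \<le> t" "t \<le> T"
  shows "\<bar>G t - G s\<bar> \<le> B * (t - s)"
proof -
  have "0 \<le> B" using g_bound[of s] assms by force
  then have "norm (G t - G s) \<le> B * measure lborel {s..t}"
    using has_integral_bound_real[OF _ _ indefinite_integral_diff[OF assms], of B "{}"] g_bound assms by auto
  then show ?thesis using assms by simp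
qed

lemma indefinite_integral_absolutely_continuous: "absolutely_continuous_fun 0 T G"
  using indefinite_integral_lipschitz by (intro lipschitz_imp_absolutely_continuous_fun[of _ _ _ B]) auto

lemma indefinite_integral_continuous_on: "continuous_on {0..T} G"
proof (cases "0 \<le> T")
  case True
  then have "0 \<le> B" using g_bound[of 0] by force
  show ?thesis
  proof (rule lipschitz_on_continuous_on[of B], rule lipschitz_onI)
    fix x y assume "x \<in> {0..T}" "y \<in> {0..T}"
    then show "dist (G x) (G y) \<le> B * dist x y"
      using indefinite_integral_lipschitz[of x y] indefinite_integral_lipschitz[of y x]
      by (cases "x \<le> y") (auto simp: dist_real_def abs_minus_commute)
  qed fact
qed simp

text \<open>
  Averages over the intervals to the right of a point converge almost everywhere, which gives the right
  derivative. The left derivative is the same statement for the reflected function.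
\<close>
lemma AE_indefinite_integral_has_derivative:
  "AE t in lebesgue_on {0<..<T}. (G has_real_derivative g t) (at t)"
proof -
  define k where "k s = (if s \<in> {0..T} then g s else 0)" for s
  have kB: "\<bar>k s\<bar> \<le> \<bar>B\<bar>" for s using g_bound[of s] by (auto simp: k_def)
  have k_meas: "k \<in> borel_measurable borel"
    unfolding k_def using g_meas by measurable
  have int: "k integrable_on cbox a b" "(\<lambda>s. k (- s)) integrable_on cbox a b" for a b
  proof -
    have "(\<lambda>s. k (- s)) \<in> borel_measurable borel" using k_meas by measurable
    then show "k integrable_on cbox a b" "(\<lambda>s. k (- s)) integrable_on cbox a b"
      using set_lebesgue_integral_eq_HK[of k a b] set_lebesgue_integral_eq_HK[of "\<lambda>s. k (- s)" a b] k_meas kB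
      by (auto intro: has_integral_integrable)
  qed
  obtain N1 where N1: "negligible N1" "\<And>x e. x \<notin> N1 \<Longrightarrow> 0 < e \<Longrightarrow>
     \<exists>d>0. \<forall>h. 0 < h \<and> h < d \<longrightarrow> norm (integral (cbox x (x + h *\<^sub>R One)) k /\<^sub>R h ^ DIM(real) - k x) < e"
    using integrable_ccontinuous_explicit[OF int(1)] by metis
  obtain N2 where N2: "negligible N2" "\<And>x e. x \<notin> N2 \<Longrightarrow> 0 < e \<Longrightarrow>
     \<exists>d>0. \<forall>h. 0 < h \<and> h < d \<longrightarrow>
       norm (integral (cbox x (x + h *\<^sub>R One)) (\<lambda>s. k (- s)) /\<^sub>R h ^ DIM(real) - k (- x)) < e"
    using integrable_ccontinuous_explicit[OF int(2)] by metis
  have "negligible (uminus ` N2)"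
    using N2(1) by (intro negligible_differentiable_image_negligible)
      (auto intro!: derivative_intros simp: differentiable_on_def)
  then have N: "N1 \<union> uminus ` N2 \<in> null_sets lebesgue"
    using N1(1) by (metis negligible_Un negligible_iff_null_sets)
  have "(G has_real_derivative g t) (at t)" if t: "0 < t" "t < T" "t \<notin> N1 \<union> uminus ` N2" for t
    unfolding has_field_derivative_iff LIM_eq
  proof (intro allI impI)
    fix e :: real assume e: "0 < e"
    obtain d1 where d1: "d1 > 0" "\<And>h. 0 < h \<Longrightarrow> h < d1 \<Longrightarrow> \<bar>integral {t..t + h} k / h - k t\<bar> < e"
      using N1(2)[of t e] t e by (auto simp: divide_inverse mult.commute)
    have "- t \<notin> N2" using t by (metis UnI2 imageI minus_minus)
    then obtain d2 where d2: "d2 > 0"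
      "\<And>h. 0 < h \<Longrightarrow> h < d2 \<Longrightarrow> \<bar>integral {- t..- t + h} (\<lambda>s. k (- s)) / h - k t\<bar> < e"
      using N2(2)[of "- t" e] e by (auto simp: divide_inverse mult.commute)
    have Gk: "integral {u..v} k = G v - G u" if "0 \<le> u" "u \<le> v" "v \<le> T" for u v
    proof -
      have "integral {u..v} k = integral {u..v} g"
        by (rule integral_cong) (use that in \<open>auto simp: k_def\<close>)
      also have "\<dots> = G v - G u" using indefinite_integral_diff[OF that] by (rule integral_unique)
      finally show ?thesis .
    qed
    define d where "d = min (min d1 d2) (min t (T - t))"
    have "0 < d" using d1 d2 t by (simp add: d_def)
    moreover have "norm ((G y - G t) / (y - t) - g t) < e" if y: "y \<noteq> t" "norm (y - t) < d" for y
    proof (cases "t < y")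
      case True
      then have "\<bar>integral {t..t + (y - t)} k / (y - t) - k t\<bar> < e"
        using y by (intro d1(2)) (auto simp: d_def)
      then show ?thesis using Gk[of t y] True y t by (simp add: d_def k_def)
    next
      case False
      then have lt: "y < t" using y by simp
      then have "\<bar>integral {- t..- t + (t - y)} (\<lambda>s. k (- s)) / (t - y) - k t\<bar> < e"
        using y by (intro d2(2)) (auto simp: d_def)
      also have "integral {- t..- t + (t - y)} (\<lambda>s. k (- s)) = G t - G y"
        using Gk[of y t] lt y t by (simp add: d_def)
      also have "(G t - G y) / (t - y) = (G y - G t) / (y - t)"
        using lt by (simp add: field_simps)
      finally show ?thesis using t by (simp add: k_def)
    qed
    ultimately show "\<exists>s>0. \<forall>x. x \<noteq> t \<and> norm (x - t) < s \<longrightarrow> norm ((G x - G t) / (x - t) - g t) < e"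
      by blast
  qed
  then show ?thesis
    using N by (subst AE_restrict_space_iff) (auto intro!: AE_I'[OF N])
qed

text \<open>
  The product \<open>a * G\<close> is absolutely continuous and has the expected derivative almost everywhere, so
  the fundamental theorem applies to it.
\<close>
lemma integration_by_parts_indefinite_integral:
  assumes T: "0 \<le> T"
    and a: "\<And>s. 0 \<le> s \<Longrightarrow> s \<le> T \<Longrightarrow> (a has_real_derivative a' s) (at s)"
    and a': "continuous_on {0..T} a'"
  shows "set_integrable lborel {0..T} (\<lambda>s. a' s * G s + a s * g s)"
    and "a T * G T = a 0 * G0 + (LBINT s:{0..T}. a' s * G s + a s * g s)"
proof -
  have ca: "continuous_on {0..T} a"
    using a by (intro continuous_at_imp_continuous_on) (meson DERIV_isCont atLeastAtMost_iff)
  have bdd: "\<exists>C. \<forall>s. 0 \<le> s \<and> s \<le> T \<longrightarrow> \<bar>f s\<bar> \<le> C" if "continuous_on {0..T} f" for f :: "real \<Rightarrow> real"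
    using compact_imp_bounded[OF compact_continuous_image[OF that]] unfolding bounded_iff
    by (metis atLeastAtMost_iff compact_Icc imageI real_norm_def)
  obtain A where A: "\<And>s. 0 \<le> s \<Longrightarrow> s \<le> T \<Longrightarrow> \<bar>a s\<bar> \<le> A" using bdd[OF ca] by blast
  obtain A' where A': "\<And>s. 0 \<le> s \<Longrightarrow> s \<le> T \<Longrightarrow> \<bar>a' s\<bar> \<le> A'" using bdd[OF a'] by blast
  obtain M where M: "\<And>s. 0 \<le> s \<Longrightarrow> s \<le> T \<Longrightarrow> \<bar>G s\<bar> \<le> M" 
    using bdd[OF indefinite_integral_continuous_on] by blast
  have "absolutely_continuous_fun 0 T a"
    by (rule bounded_deriv_imp_absolutely_continuous_fun[OF a A'])
  then have ac: "absolutely_continuous_fun 0 T (\<lambda>s. a s * G s)"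
    by (rule absolutely_continuous_fun_mult[OF _ indefinite_integral_absolutely_continuous A M])
  have ae: "AE s in lebesgue_on {0<..<T}. s \<in> {0<..<T}"
    by (rule AE_I2) simp
  have der: "AE s in lebesgue_on {0<..<T}.
      ((\<lambda>s. a s * G s) has_real_derivative (a' s * G s + a s * g s)) (at s)"
    using AE_indefinite_integral_has_derivative ae
    by eventually_elim (auto intro!: derivative_eq_intros a)
  have hi: "((\<lambda>s. a' s * G s + a s * g s) has_integral (a T * G T - a 0 * G 0)) {0..T}"
    by (rule absolutely_continuous_fun_has_integral_deriv[OF T ac der])
  have meas: "(\<lambda>s. indicator {0..T} s *\<^sub>R (a' s * G s + a s * g s)) \<in> borel_measurable lborel"
  proof -
    have "(\<lambda>s. indicator {0..T} s *\<^sub>R (a' s * G s)) \<in> borel_measurable borel"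
      "(\<lambda>s. indicator {0..T} s *\<^sub>R a s) \<in> borel_measurable borel"
      by (intro borel_measurable_continuous_on_indicator continuous_intros a' ca
          indefinite_integral_continuous_on; simp)+
    then have "(\<lambda>s. indicator {0..T} s *\<^sub>R (a' s * G s) + (indicator {0..T} s *\<^sub>R a s) * g s)
      \<in> borel_measurable borel"
      using g_meas by measurable
    then show ?thesis by (simp add: algebra_simps)
  qed
  show int: "set_integrable lborel {0..T} (\<lambda>s. a' s * G s + a s * g s)"
    unfolding set_integrable_def
  proof (rule Bochner_Integration.integrable_bound[OF _ meas])
    show "integrable lborel (\<lambda>s. (A' * M + A * B) * indicator {0..T} s)"
      using T by auto
    show "AE s in lborel. norm (indicator {0..T} s *\<^sub>R (a' s * G s + a s * g s))
        \<le> norm ((A' * M + A * B) * indicator {0..T} s)"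
    proof (rule AE_I2)
      fix s
      have "\<bar>a' s * G s + a s * g s\<bar> \<le> A' * M + A * B" if "0 \<le> s" "s \<le> T"
      proof -
        have "\<bar>a' s\<bar> * \<bar>G s\<bar> \<le> A' * M" "\<bar>a s\<bar> * \<bar>g s\<bar> \<le> A * B"
          using A[OF that] A'[OF that] M[OF that] g_bound[OF that] by (auto intro!: mult_mono)
        moreover have "\<bar>a' s * G s + a s * g s\<bar> \<le> \<bar>a' s\<bar> * \<bar>G s\<bar> + \<bar>a s\<bar> * \<bar>g s\<bar>"
          by (metis abs_mult abs_triangle_ineq)
        ultimately show ?thesis by linarith
      qed
      then show "norm (indicator {0..T} s *\<^sub>R (a' s * G s + a s * g s))
        \<le> norm ((A' * M + A * B) * indicator {0..T} s)"
        by (force simp: indicator_def)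
    qed
  qed
  have "G 0 = G0" using G_eq[of 0] T by (simp add: LBINT_singleton)
  then show "a T * G T = a 0 * G0 + (LBINT s:{0..T}. a' s * G s + a s * g s)"
    using set_borel_integral_eq_integral(2)[OF int] integral_unique[OF hi] by simp
qed

end

text \<open>
  With the integrating factor \<open>exp (t c)\<close> the derivative of \<open>exp (t c) * h t\<close> is known almost
  everywhere, and absolute continuity of the product recovers it from this derivative.
\<close>
lemma linear_ode_unique:
  assumes ac: "absolutely_continuous_fun 0 T h"
    and g [measurable]: "g \<in> borel_measurable borel" and gB: "\<And>s. \<bar>g s\<bar> \<le> B"
    and ode: "AE t in lebesgue_on {0<..<T}. \<exists>D. (h has_real_derivative D) (at t) \<and> D + c * h t = g t"
    and t: "0 \<le> t" "t \<le> T"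
  shows "h t = exp (- t * c) * (h 0 + (LBINT s:{0..t}. exp (s * c) * g s))"
proof -
  have act: "absolutely_continuous_fun 0 t h"
    by (rule absolutely_continuous_fun_subinterval[OF ac]) (use t in auto)
  have eB: "exp (s * c) \<le> exp (t * \<bar>c\<bar>)" if "0 \<le> s" "s \<le> t" for s
  proof -
    have "s * c \<le> s * \<bar>c\<bar>" using that by (intro mult_left_mono) auto
    also have "\<dots> \<le> t * \<bar>c\<bar>" using that by (intro mult_right_mono) auto
    finally show ?thesis by simp
  qed
  have ace: "absolutely_continuous_fun 0 t (\<lambda>s. exp (s * c))"
  proof (rule bounded_deriv_imp_absolutely_continuous_fun)
    show "((\<lambda>s. exp (s * c)) has_real_derivative exp (s * c) * c) (at s)" for s
      by (auto intro!: derivative_eq_intros)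
    show "\<bar>exp (s * c) * c\<bar> \<le> exp (t * \<bar>c\<bar>) * \<bar>c\<bar>" if "0 \<le> s" "s \<le> t" for s
      using eB[OF that] by (simp add: abs_mult mult_right_mono)
  qed
  obtain K where K: "\<And>s. 0 \<le> s \<Longrightarrow> s \<le> t \<Longrightarrow> \<bar>h s\<bar> \<le> K"
    using absolutely_continuous_fun_imp_bounded[OF act] by blast
  have acp: "absolutely_continuous_fun 0 t (\<lambda>s. exp (s * c) * h s)"
    by (rule absolutely_continuous_fun_mult[OF ace act, of "exp (t * \<bar>c\<bar>)" K]) (use eB K in auto)
  have "AE s in lebesgue_on {0<..<t}. \<exists>D. (h has_real_derivative D) (at s) \<and> D + c * h s = g s"
    using ode t by (subst (asm) AE_restrict_space_iff, simp, subst AE_restrict_space_iff, simp)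
      (auto elim!: eventually_mono)
  then have "AE s in lebesgue_on {0<..<t}. ((\<lambda>s. exp (s * c) * h s) has_real_derivative exp (s * c) * g s) (at s)"
  proof eventually_elim
    case (elim s)
    then obtain D where D: "(h has_real_derivative D) (at s)" "D + c * h s = g s" by blast
    have "((\<lambda>s. exp (s * c) * h s) has_real_derivative (exp (s * c) * c * h s + D * exp (s * c))) (at s)"
      by (auto intro!: derivative_eq_intros D(1))
    also have "exp (s * c) * c * h s + D * exp (s * c) = exp (s * c) * g s"
      unfolding D(2)[symmetric] by (simp add: algebra_simps)
    finally show ?case .
  qed
  from absolutely_continuous_fun_has_integral_deriv[OF t(1) acp this]
  have 1: "((\<lambda>s. exp (s * c) * g s) has_integral (exp (t * c) * h t - h 0)) {0..t}" by simp
  have 2: "((\<lambda>s. exp (s * c) * g s) has_integral (LBINT s:{0..t}. exp (s * c) * g s)) {0..t}"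
  proof (rule set_lebesgue_integral_eq_HK)
    show "\<bar>exp (s * c) * g s\<bar> \<le> exp (t * \<bar>c\<bar>) * B" if "0 \<le> s" "s \<le> t" for s
      using eB[OF that] gB[of s] by (auto simp: abs_mult intro!: mult_mono)
  qed measurable
  have "exp (t * c) * h t = h 0 + (LBINT s:{0..t}. exp (s * c) * g s)"
    using has_integral_unique[OF 1 2] by simp
  then have "exp (- t * c) * (exp (t * c) * h t) = exp (- t * c) * (h 0 + (LBINT s:{0..t}. exp (s * c) * g s))"
    by simp
  then show ?thesis by (simp add: mult.assoc[symmetric] exp_add[symmetric])
qed

section \<open>Averages over the cell\<close>

abbreviation cell :: "(real ^ 'n) measure" where
  "cell \<equiv> lebesgue_on unit_cell"

interpretation cell: finite_measure "cell :: (real ^ 'n) measure"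
  by (rule finite_measure_unit_cell)

interpretation lborel_cell: pair_sigma_finite "lborel :: 'a::euclidean_space measure" "cell :: (real ^ 'n) measure"
  by standard

lemma borel_measurable_cell:
  "f \<in> borel_measurable borel \<Longrightarrow> f \<in> borel_measurable (cell :: (real ^ 'n) measure)"
  by (intro measurable_restrict_space1 measurable_completion) simp

lemma borel_measurable_pair_cell:
  fixes f :: "'a::euclidean_space \<times> (real ^ 'n) \<Rightarrow> real"
  assumes "f \<in> borel_measurable borel"
  shows "f \<in> borel_measurable (borel \<Otimes>\<^sub>M cell)"
proof -
  have "(\<lambda>y. y) \<in> cell \<rightarrow>\<^sub>M (borel :: (real ^ 'n) measure)"
    by (intro measurable_restrict_space1 measurable_completion) simp
  then have "(\<lambda>z. (fst z, snd z)) \<in> borel \<Otimes>\<^sub>M (cell :: (real ^ 'n) measure) \<rightarrow>\<^sub>M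
      (borel :: 'a measure) \<Otimes>\<^sub>M (borel :: (real ^ 'n) measure)"
    by measurable
  then show ?thesis
    using assms measurable_compose[of "\<lambda>z. (fst z, snd z)"
      "borel \<Otimes>\<^sub>M (cell :: (real ^ 'n) measure)" borel f borel]
    by (simp add: borel_prod)
qed

lemma borel_measurable_avg:
  fixes f :: "'a::euclidean_space \<Rightarrow> real ^ 'n \<Rightarrow> real"
  assumes "(\<lambda>(s, y). f s y) \<in> borel_measurable borel"
  shows "(\<lambda>s. avg (f s)) \<in> borel_measurable borel"
  unfolding avg_def
  using borel_measurable_pair_cell[OF assms] by (rule cell.borel_measurable_lebesgue_integral)

lemma integrable_cell_bounded:
  fixes f :: "real ^ 'n \<Rightarrow> real"
  assumes "f \<in> borel_measurable borel" "\<And>y. \<bar>f y\<bar> \<le> B"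
  shows "integrable cell f"
  by (rule cell.integrable_const_bound[of _ B]) (use assms in \<open>auto intro: borel_measurable_cell\<close>)

lemma abs_avg_le_bound:
  fixes f :: "real ^ 'n \<Rightarrow> real"
  assumes "\<And>y. \<bar>f y\<bar> \<le> B"
  shows "\<bar>avg f\<bar> \<le> B"
proof (cases "integrable cell f")
  case True
  have "f y \<le> B" "- B \<le> f y" for y using assms[of y] by linarith+
  then have "avg f \<le> avg (\<lambda>y::real ^ 'n. B)" "avg (\<lambda>y::real ^ 'n. - B) \<le> avg f"
    unfolding avg_def using True by (intro integral_mono; simp)+
  then show ?thesis by (simp add: avg_def abs_le_iff)
next
  case False
  then show ?thesis using assms[of 0] by (simp add: avg_def not_integrable_integral_eq)
qed

lemma avg_LBINT:
  fixes f :: "real \<Rightarrow> real ^ 'n \<Rightarrow> real"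
  assumes m: "(\<lambda>(s, y). f s y) \<in> borel_measurable borel"
    and B: "\<And>s y. 0 \<le> s \<Longrightarrow> s \<le> t \<Longrightarrow> \<bar>f s y\<bar> \<le> B"
  shows "avg (\<lambda>y. LBINT s:{0..t}. f s y) = (LBINT s:{0..t}. avg (f s))"
proof -
  let ?k = "\<lambda>s y. indicator {0..t} s * f s y"
  have [measurable]: "(\<lambda>(s, y). f s y) \<in> borel_measurable (lborel \<Otimes>\<^sub>M cell)"
    using borel_measurable_pair_cell[OF m] by (simp cong: measurable_cong_sets)
  have "integrable (lborel \<Otimes>\<^sub>M cell) (\<lambda>(s, y). ?k s y)"
  proof (rule Bochner_Integration.integrable_bound)
    have "emeasure (lborel \<Otimes>\<^sub>M (cell :: (real ^ 'n) measure)) ({0..t} \<times> space cell) < \<infinity>"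
      by (subst cell.emeasure_pair_measure_Times) (auto simp: emeasure_unit_cell emeasure_lborel_Icc_eq)
    then show "integrable (lborel \<Otimes>\<^sub>M (cell :: (real ^ 'n) measure))
        (\<lambda>z. B * indicator ({0..t} \<times> space cell) z)"
      by (intro integrable_mult_right integrable_real_indicator) auto
    show "AE z in lborel \<Otimes>\<^sub>M (cell :: (real ^ 'n) measure).
        norm (case z of (s, y) \<Rightarrow> ?k s y) \<le> norm (B * indicator ({0..t} \<times> space cell) z)"
    proof (rule AE_I2, clarify)
      fix s :: real and y :: "real ^ 'n" assume "(s, y) \<in> space (lborel \<Otimes>\<^sub>M (cell :: (real ^ 'n) measure))"
      then show "norm (?k s y) \<le> norm (B * indicator ({0..t} \<times> space cell) (s, y))"
        using B[of s y] by (cases "s \<in> {0..t}") (auto simp: space_pair_measure)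
    qed
  qed measurable
  from lborel_cell.Fubini_integral[OF this]
  have "(LINT y|cell. LINT s|lborel. ?k s y) = (LINT s|lborel. LINT y|cell. ?k s y)" .
  then show ?thesis
    by (simp add: avg_def set_lebesgue_integral_def)
qed

section \<open>The transposed cell operator\<close>

text \<open>
  The transpose of \<open>L_op g\<close> for the pairing \<open>avg (\<lambda>y. p y * w y)\<close>.
\<close>
definition adj_op :: "(real ^ 'n \<Rightarrow> real) \<Rightarrow> (real ^ 'n \<Rightarrow> real) \<Rightarrow> real ^ 'n \<Rightarrow> real" where
  "adj_op g w = (\<lambda>y. g y * w y - g y * avg w)"

text \<open>
  The image of \<open>g\<close> itself under the exponential of \<open>- \<tau>\<close> times the transposed operator.
\<close>
definition adj_orbit :: "(real ^ 'n \<Rightarrow> real) \<Rightarrow> real \<Rightarrow> real ^ 'n \<Rightarrow> real" where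
  "adj_orbit g \<tau> = (\<lambda>y. \<Sum>n. (- \<tau>) ^ n / fact n * (adj_op g ^^ n) g y)"

text \<open>
  If \<open>c n\<close> is the value of a functional on the \<open>n\<close>-th iterate of a bounded operator, the series is the
  value of the functional on the exponential of that operator. Differentiation in \<open>\<tau>\<close> applies the
  operator once more, that is, it shifts \<open>c\<close>.
\<close>
lemma exp_series_bounded:
  fixes c :: "nat \<Rightarrow> real"
  assumes c: "\<And>n. \<bar>c n\<bar> \<le> K * q ^ n" and q: "0 \<le> q"
  shows "summable (\<lambda>n. \<bar>(- \<tau>) ^ n / fact n * c n\<bar>)"
    and "summable (\<lambda>n. (- \<tau>) ^ n / fact n * c n)"
    and "\<bar>\<Sum>n. (- \<tau>) ^ n / fact n * c n\<bar> \<le> K * exp (q * \<bar>\<tau>\<bar>)"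
    and "((\<lambda>\<tau>. \<Sum>n. (- \<tau>) ^ n / fact n * c n) has_real_derivative
           - (\<Sum>n. (- \<tau>) ^ n / fact n * c (Suc n))) (at \<tau>)"
proof -
  have E: "(\<lambda>n. K * ((q * \<bar>t\<bar>) ^ n / fact n)) sums (K * exp (q * \<bar>t\<bar>))" for t
    using exp_converges[of "q * \<bar>t\<bar>"] by (intro sums_mult) (simp add: field_simps)
  have le: "\<bar>(- t) ^ n / fact n * c n\<bar> \<le> K * ((q * \<bar>t\<bar>) ^ n / fact n)" for t n
  proof -
    have "\<bar>(- t) ^ n / fact n * c n\<bar> = \<bar>t\<bar> ^ n / fact n * \<bar>c n\<bar>"
      by (simp add: abs_mult power_abs)
    also have "\<dots> \<le> \<bar>t\<bar> ^ n / fact n * (K * q ^ n)"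
      by (intro mult_left_mono c) auto
    finally show ?thesis by (simp add: power_mult_distrib mult_ac)
  qed
  show sa: "summable (\<lambda>n. \<bar>(- \<tau>) ^ n / fact n * c n\<bar>)" for \<tau>
    using le by (intro summable_comparison_test'[OF sums_summable[OF E[of \<tau>]]]) auto
  show s: "summable (\<lambda>n. (- \<tau>) ^ n / fact n * c n)" for \<tau>
    using sa by (rule summable_rabs_cancel)
  show "\<bar>\<Sum>n. (- \<tau>) ^ n / fact n * c n\<bar> \<le> K * exp (q * \<bar>\<tau>\<bar>)"
  proof -
    have "\<bar>\<Sum>n. (- \<tau>) ^ n / fact n * c n\<bar> \<le> (\<Sum>n. \<bar>(- \<tau>) ^ n / fact n * c n\<bar>)"
      using sa by (rule summable_rabs)
    also have "\<dots> \<le> (\<Sum>n. K * ((q * \<bar>\<tau>\<bar>) ^ n / fact n))"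
      using le sa E by (intro suminf_le) (auto simp: sums_iff)
    also have "\<dots> = K * exp (q * \<bar>\<tau>\<bar>)" using E by (rule sums_unique[symmetric])
    finally show ?thesis .
  qed
  define k where "k n = (- 1) ^ n * c n / fact n" for n
  have k: "k n * t ^ n = (- t) ^ n / fact n * c n" for n t
    by (simp add: k_def power_minus[of t])
  have "DERIV (\<lambda>x. \<Sum>n. k n * x ^ n) \<tau> :> (\<Sum>n. diffs k n * \<tau> ^ n)"
    by (rule termdiffs_strong_converges_everywhere) (simp only: k s)
  moreover have "(\<Sum>n. diffs k n * \<tau> ^ n) = (\<Sum>n. - ((- \<tau>) ^ n / fact n * c (Suc n)))"
    by (rule suminf_cong) (simp add: diffs_def k_def power_minus[of \<tau>] field_simps del: of_nat_Suc)
  moreover have "\<dots> = - (\<Sum>n. (- \<tau>) ^ n / fact n * c (Suc n))"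
  proof (rule suminf_minus)
    have "summable (\<lambda>n. - (diffs k n * \<tau> ^ n))"
      by (intro summable_minus termdiff_converges_all) (simp only: k s)
    moreover have "(\<lambda>n. - (diffs k n * \<tau> ^ n)) = (\<lambda>n. (- \<tau>) ^ n / fact n * c (Suc n))"
      by (rule ext) (simp add: diffs_def k_def power_minus[of \<tau>] field_simps del: of_nat_Suc)
    ultimately show "summable (\<lambda>n. (- \<tau>) ^ n / fact n * c (Suc n))" by simp
  qed
  ultimately show "((\<lambda>\<tau>. \<Sum>n. (- \<tau>) ^ n / fact n * c n) has_real_derivative
           - (\<Sum>n. (- \<tau>) ^ n / fact n * c (Suc n))) (at \<tau>)"
    by (simp add: k)
qed

lemma avg_exp_series:
  fixes c :: "nat \<Rightarrow> real ^ 'n \<Rightarrow> real"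
  assumes int: "\<And>n. integrable cell (c n)" and b: "\<And>n y. \<bar>c n y\<bar> \<le> K * q ^ n" and q: "0 \<le> q"
  shows "avg (\<lambda>y. \<Sum>n. (- \<tau>) ^ n / fact n * c n y) = (\<Sum>n. (- \<tau>) ^ n / fact n * avg (c n))"
proof -
  let ?a = "\<lambda>n y. (- \<tau>) ^ n / fact n * c n y"
  have K: "0 \<le> K" using b[of 0 0] by simp
  have "(\<integral>y. (\<Sum>n. ?a n y) \<partial>cell) = (\<Sum>n. \<integral>y. ?a n y \<partial>cell)"
  proof (rule integral_suminf)
    show "integrable cell (?a n)" for n using int by simp
    show "AE y in cell. summable (\<lambda>n. norm (?a n y))"
      using exp_series_bounded(1)[OF b q] by auto
    have nn: "norm (\<integral>y. norm (?a n y) \<partial>cell) \<le> \<bar>\<tau>\<bar> ^ n / fact n * (K * q ^ n)" for n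
    proof -
      have "\<bar>avg (\<lambda>y. norm (?a n y))\<bar> \<le> \<bar>\<tau>\<bar> ^ n / fact n * (K * q ^ n)"
      proof (rule abs_avg_le_bound)
        fix y
        have "norm (?a n y) = \<bar>\<tau>\<bar> ^ n / fact n * \<bar>c n y\<bar>"
          by (simp add: abs_mult power_abs)
        also have "\<dots> \<le> \<bar>\<tau>\<bar> ^ n / fact n * (K * q ^ n)"
          by (intro mult_left_mono b) auto
        finally show "\<bar>norm (?a n y)\<bar> \<le> \<bar>\<tau>\<bar> ^ n / fact n * (K * q ^ n)" by simp
      qed
      then show ?thesis by (simp add: avg_def)
    qed
    have "summable (\<lambda>n. \<bar>\<tau>\<bar> ^ n / fact n * (K * q ^ n))"
      using exp_series_bounded(2)[of "\<lambda>n. K * q ^ n" K q "- \<bar>\<tau>\<bar>"] K q by simp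
    then show "summable (\<lambda>n. \<integral>y. norm (?a n y) \<partial>cell)"
      by (rule summable_comparison_test'[OF _ nn])
  qed
  then show ?thesis using int by (simp add: avg_def)
qed

lemma adj_op_power_measurable [measurable]:
  "g \<in> borel_measurable borel \<Longrightarrow> (adj_op g ^^ n) g \<in> borel_measurable borel"
  by (induction n) (auto simp: adj_op_def)

context
  fixes g :: "real ^ 'n \<Rightarrow> real" and G :: real
  assumes g_meas [measurable]: "g \<in> borel_measurable borel" and g_bound: "\<And>y. \<bar>g y\<bar> \<le> G"
begin

private lemma G0: "0 \<le> G" using g_bound[of 0] by linarith

lemma adj_op_power_bound: "\<bar>(adj_op g ^^ n) g y\<bar> \<le> G * (2 * G) ^ n"
proof (induction n arbitrary: y)
  case 0
  then show ?case by (simp add: g_bound)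
next
  case (Suc n)
  let ?w = "(adj_op g ^^ n) g"
  have "\<bar>(adj_op g ^^ Suc n) g y\<bar> \<le> \<bar>g y\<bar> * \<bar>?w y\<bar> + \<bar>g y\<bar> * \<bar>avg ?w\<bar>"
    by (simp add: adj_op_def abs_mult[symmetric])
  also have "\<dots> \<le> G * (G * (2 * G) ^ n) + G * (G * (2 * G) ^ n)"
    using abs_avg_le_bound[OF Suc] Suc g_bound G0 by (intro add_mono mult_mono) auto
  also have "\<dots> = G * (2 * G) ^ Suc n" by simp
  finally show ?case .
qed

text \<open>
  Both sides equal \<open>\<langle>g p w\<rangle> - \<langle>p\<rangle> \<langle>g w\<rangle>\<close> for \<open>p = (adj_op g ^^ m) g\<close>.
\<close>
lemma avg_mult_adj_op_power_L_op:
  assumes w: "integrable cell w"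
  shows "avg (\<lambda>y. (adj_op g ^^ m) g y * L_op g w y) = avg (\<lambda>y. (adj_op g ^^ Suc m) g y * w y)"
proof -
  let ?p = "(adj_op g ^^ m) g"
  have [measurable]: "w \<in> borel_measurable cell" "g \<in> borel_measurable cell" "?p \<in> borel_measurable cell"
    using w by (auto intro: borel_measurable_cell)
  have bm: "integrable cell (\<lambda>y. k y * w y)" if "k \<in> borel_measurable cell" "\<And>y. \<bar>k y\<bar> \<le> K" for k K
  proof (rule Bochner_Integration.integrable_bound)
    show "integrable cell (\<lambda>y. K * w y)" using w by simp
    show "AE y in cell. norm (k y * w y) \<le> norm (K * w y)"
      using that(2) order_trans[OF abs_ge_zero that(2)]
      by (auto simp: abs_mult intro!: mult_right_mono)
  qed (use that in measurable)
  have 1: "integrable cell ?p"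
    by (rule integrable_cell_bounded) (auto intro: adj_op_power_bound)
  have 2: "integrable cell (\<lambda>y. g y * w y)" by (rule bm) (auto intro: g_bound)
  have 3: "integrable cell (\<lambda>y. (g y * ?p y) * w y)"
  proof (rule bm)
    show "\<bar>g y * ?p y\<bar> \<le> G * (G * (2 * G) ^ m)" for y
      using g_bound[of y] adj_op_power_bound[of m y] G0 by (auto simp: abs_mult intro!: mult_mono)
  qed measurable
  have "avg (\<lambda>y. ?p y * L_op g w y)
      = avg (\<lambda>y. (g y * ?p y) * w y - ?p y * avg (\<lambda>z. g z * w z))"
    by (simp add: L_op_def algebra_simps)
  also have "\<dots> = avg (\<lambda>y. (g y * ?p y) * w y) - avg ?p * avg (\<lambda>z. g z * w z)"
    unfolding avg_def using 1 3 by (subst Bochner_Integration.integral_diff) auto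
  also have "\<dots> = avg (\<lambda>y. (g y * ?p y) * w y - avg ?p * (g y * w y))"
    unfolding avg_def using 2 3 by (subst Bochner_Integration.integral_diff) auto
  also have "\<dots> = avg (\<lambda>y. (adj_op g ^^ Suc m) g y * w y)"
    by (simp add: adj_op_def algebra_simps)
  finally show ?thesis .
qed

lemma adj_orbit_summable:
  "summable (\<lambda>n. \<bar>(- \<tau>) ^ n / fact n * (adj_op g ^^ n) g y\<bar>)"
  "summable (\<lambda>n. (- \<tau>) ^ n / fact n * (adj_op g ^^ n) g y)"
  and adj_orbit_bound: "\<bar>adj_orbit g \<tau> y\<bar> \<le> G * exp (2 * G * \<bar>\<tau>\<bar>)"
  using exp_series_bounded(1-3)[of "\<lambda>n. (adj_op g ^^ n) g y" G "2 * G" \<tau>] adj_op_power_bound G0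
  by (auto simp: adj_orbit_def)

lemma adj_orbit_0: "adj_orbit g 0 = g"
proof
  fix y
  have "adj_orbit g 0 y = (\<Sum>n. ((adj_op g ^^ n) g y / fact n) * 0 ^ n)"
    unfolding adj_orbit_def by (simp add: mult_ac)
  then show "adj_orbit g 0 y = g y" by (simp only: powser_zero) simp
qed

lemma adj_orbit_measurable: "(\<lambda>(\<tau>, y). adj_orbit g \<tau> y) \<in> borel_measurable borel"
  unfolding adj_orbit_def borel_prod[symmetric] by measurable

lemma avg_adj_orbit_mult:
  assumes [measurable]: "w \<in> borel_measurable borel" and wB: "\<And>y. \<bar>w y\<bar> \<le> B"
  shows "avg (\<lambda>y. adj_orbit g \<tau> y * w y)
         = (\<Sum>n. (- \<tau>) ^ n / fact n * avg (\<lambda>y. (adj_op g ^^ n) g y * w y))"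
proof -
  have b: "\<bar>(adj_op g ^^ n) g y * w y\<bar> \<le> G * B * (2 * G) ^ n" for n y
    using mult_mono[OF adj_op_power_bound[of n y] wB[of y]] G0 by (simp add: abs_mult mult_ac)
  have int: "integrable cell (\<lambda>y. (adj_op g ^^ n) g y * w y)" for n
    by (rule integrable_cell_bounded[OF _ b]) measurable
  have "0 \<le> 2 * G" using G0 by simp
  from avg_exp_series[OF int b this, of \<tau>]
  have "avg (\<lambda>y. \<Sum>n. (- \<tau>) ^ n / fact n * ((adj_op g ^^ n) g y * w y))
      = (\<Sum>n. (- \<tau>) ^ n / fact n * avg (\<lambda>y. (adj_op g ^^ n) g y * w y))" .
  moreover have "adj_orbit g \<tau> y * w y = (\<Sum>n. (- \<tau>) ^ n / fact n * ((adj_op g ^^ n) g y * w y))" for y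
    unfolding adj_orbit_def using adj_orbit_summable(2)[of \<tau> y]
    by (simp add: suminf_mult2 mult.assoc)
  ultimately show ?thesis by simp
qed

text \<open>
  The exponential is moved from \<open>w\<close> to the weight \<open>g\<close> term by term in the series. The memory kernel and
  both integrals in the source term are of the form on the left with different \<open>w\<close>.
\<close>
lemma avg_mult_semigroup_L:
  assumes [measurable]: "w \<in> borel_measurable borel" and wB: "\<And>y. \<bar>w y\<bar> \<le> B"
  shows "avg (\<lambda>y. g y * semigroup_L g (- \<tau>) w y) = avg (\<lambda>y. adj_orbit g \<tau> y * w y)"
proof -
  have gc: "g \<in> borel_measurable cell" and wc: "w \<in> borel_measurable cell"
    by (auto intro: borel_measurable_cell)
  have wL2: "w \<in> L2 cell"
  proof -
    have "integrable cell (\<lambda>y. (w y)\<^sup>2)"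
    proof (rule integrable_cell_bounded)
      show "\<bar>(w y)\<^sup>2\<bar> \<le> B\<^sup>2" for y using power_mono[OF wB[of y], of 2] by simp
    qed measurable
    then show ?thesis using wc by (simp add: L2_def)
  qed
  note pw = L_op_power_bound[OF gc g_bound wL2]
  note sm = semigroup_L_summable[OF gc g_bound wL2, of "- \<tau>"]
  have int: "integrable cell ((L_op g ^^ n) w)" for n using pw by blast
  have b: "\<bar>g y * (L_op g ^^ n) w y\<bar> \<le> (G * (2 * B)) * (2 * G) ^ n" for n y
  proof -
    have "avg (\<lambda>z. \<bar>w z\<bar>) \<le> B" using abs_avg_le_bound[of "\<lambda>z. \<bar>w z\<bar>" B] wB by auto
    then have "(2 * G) ^ n * (\<bar>w y\<bar> + avg (\<lambda>z. \<bar>w z\<bar>)) \<le> (2 * G) ^ n * (B + B)"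
      using wB[of y] G0 by (intro mult_left_mono add_mono) auto
    then have "\<bar>(L_op g ^^ n) w y\<bar> \<le> (2 * G) ^ n * (B + B)" using pw order_trans by blast
    then have "\<bar>g y\<bar> * \<bar>(L_op g ^^ n) w y\<bar> \<le> G * ((2 * G) ^ n * (B + B))"
      using g_bound[of y] G0 by (intro mult_mono) auto
    then show ?thesis by (simp add: abs_mult mult_ac)
  qed
  have intg: "integrable cell (\<lambda>y. g y * (L_op g ^^ n) w y)" for n
  proof (rule Bochner_Integration.integrable_bound)
    show "integrable cell (\<lambda>y. G * (L_op g ^^ n) w y)" using int by simp
    show "(\<lambda>y. g y * (L_op g ^^ n) w y) \<in> borel_measurable cell"
      using gc int[of n] by (intro borel_measurable_times) auto
    show "AE y in cell. norm (g y * (L_op g ^^ n) w y) \<le> norm (G * (L_op g ^^ n) w y)"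
      using g_bound G0 by (auto simp: abs_mult intro!: mult_right_mono)
  qed
  have "0 \<le> 2 * G" using G0 by simp
  from avg_exp_series[OF intg b this, of \<tau>]
  have "avg (\<lambda>y. \<Sum>n. (- \<tau>) ^ n / fact n * (g y * (L_op g ^^ n) w y))
      = (\<Sum>n. (- \<tau>) ^ n / fact n * avg (\<lambda>y. g y * (L_op g ^^ n) w y))" .
  moreover have "g y * semigroup_L g (- \<tau>) w y = (\<Sum>n. (- \<tau>) ^ n / fact n * (g y * (L_op g ^^ n) w y))" for y
    unfolding semigroup_L_def using suminf_mult[OF sm, of "g y" y] by (simp add: mult_ac)
  ultimately have "avg (\<lambda>y. g y * semigroup_L g (- \<tau>) w y)
      = (\<Sum>n. (- \<tau>) ^ n / fact n * avg (\<lambda>y. g y * (L_op g ^^ n) w y))"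
    by simp
  moreover have "avg (\<lambda>y. (adj_op g ^^ m) g y * (L_op g ^^ n) w y)
      = avg (\<lambda>y. (adj_op g ^^ (m + n)) g y * w y)" for m n
  proof (induction n arbitrary: m)
    case (Suc n)
    show ?case
      using avg_mult_adj_op_power_L_op[OF int[of n], of m] Suc[of "Suc m"] by simp
  qed simp
  from this[of 0] have "avg (\<lambda>y. g y * (L_op g ^^ n) w y) = avg (\<lambda>y. (adj_op g ^^ n) g y * w y)" for n
    by simp
  ultimately show ?thesis
    using avg_adj_orbit_mult[OF assms] by simp
qed

lemma adj_orbit_has_derivative:
  "((\<lambda>\<tau>. adj_orbit g \<tau> y) has_real_derivative
     - (g y * adj_orbit g \<tau> y - g y * avg (adj_orbit g \<tau>))) (at \<tau>)"
proof -
  let ?p = "\<lambda>n. (adj_op g ^^ n) g"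
  have av: "avg (adj_orbit g \<tau>) = (\<Sum>n. (- \<tau>) ^ n / fact n * avg (?p n))"
    using avg_adj_orbit_mult[of "\<lambda>_. 1" 1] by simp
  have sav: "summable (\<lambda>n. (- \<tau>) ^ n / fact n * avg (?p n))"
    using abs_avg_le_bound[OF adj_op_power_bound] G0
    by (intro exp_series_bounded(2)[of _ G "2 * G"]) auto
  have "(\<Sum>n. (- \<tau>) ^ n / fact n * ?p (Suc n) y)
     = (\<Sum>n. g y * ((- \<tau>) ^ n / fact n * ?p n y) - g y * ((- \<tau>) ^ n / fact n * avg (?p n)))"
    by (rule suminf_cong) (simp add: adj_op_def algebra_simps)
  also have "\<dots> = g y * (\<Sum>n. (- \<tau>) ^ n / fact n * ?p n y) - g y * (\<Sum>n. (- \<tau>) ^ n / fact n * avg (?p n))"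
    by (simp only: suminf_mult[OF sav, symmetric] suminf_mult[OF adj_orbit_summable(2)[of \<tau> y], symmetric]
        suminf_diff[OF summable_mult[OF adj_orbit_summable(2)[of \<tau> y]] summable_mult[OF sav]])
  also have "\<dots> = g y * adj_orbit g \<tau> y - g y * avg (adj_orbit g \<tau>)"
    by (simp only: av) (simp only: adj_orbit_def)
  finally have eq: "(\<Sum>n. (- \<tau>) ^ n / fact n * ?p (Suc n) y)
      = g y * adj_orbit g \<tau> y - g y * avg (adj_orbit g \<tau>)" .
  show ?thesis
    using exp_series_bounded(4)[OF adj_op_power_bound[of _ y], of \<tau>] G0
    unfolding eq unfolding adj_orbit_def[of g, abs_def] by simp
qed

text \<open>
  The average of \<open>adj_op g p\<close> is the covariance \<open>\<langle>p g\<rangle> - \<langle>p\<rangle> \<langle>g\<rangle>\<close>; for \<open>p = adj_orbit g \<tau>\<close> this is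
  the memory kernel at \<open>\<tau>\<close>.
\<close>
lemma avg_adj_orbit_has_derivative:
  "((\<lambda>\<tau>. avg (adj_orbit g \<tau>)) has_real_derivative
     - (avg (\<lambda>y. adj_orbit g \<tau> y * g y) - avg (adj_orbit g \<tau>) * avg g)) (at \<tau>)"
proof -
  let ?p = "\<lambda>n. (adj_op g ^^ n) g"
  have av: "avg (adj_orbit g \<tau>) = (\<Sum>n. (- \<tau>) ^ n / fact n * avg (?p n))" for \<tau>
    using avg_adj_orbit_mult[of "\<lambda>_. 1" 1] by simp
  have avg_g: "avg (\<lambda>y. adj_orbit g \<tau> y * g y) = (\<Sum>n. (- \<tau>) ^ n / fact n * avg (\<lambda>y. ?p n y * g y))"
    by (rule avg_adj_orbit_mult[OF g_meas g_bound])
  have b: "\<bar>?p n y * g y\<bar> \<le> G * G * (2 * G) ^ n" for n y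
    using mult_mono[OF adj_op_power_bound[of n y] g_bound[of y]] G0 by (simp add: abs_mult mult_ac)
  have sav: "summable (\<lambda>n. (- \<tau>) ^ n / fact n * avg (?p n))"
    using abs_avg_le_bound[OF adj_op_power_bound] G0
    by (intro exp_series_bounded(2)[of _ G "2 * G"]) auto
  have savg: "summable (\<lambda>n. (- \<tau>) ^ n / fact n * avg (\<lambda>y. ?p n y * g y))"
    using abs_avg_le_bound[OF b] G0
    by (intro exp_series_bounded(2)[of _ "G * G" "2 * G"]) auto
  have st: "avg (?p (Suc n)) = avg (\<lambda>y. ?p n y * g y) - avg (?p n) * avg g" for n
  proof -
    have "integrable cell (\<lambda>y. ?p n y * g y)" "integrable cell g"
      by (rule integrable_cell_bounded[OF _ b] integrable_cell_bounded[OF _ g_bound]; measurable)+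
    then show ?thesis
      by (simp add: adj_op_def avg_def mult.commute)
  qed
  have "(\<Sum>n. (- \<tau>) ^ n / fact n * avg (?p (Suc n)))
     = (\<Sum>n. (- \<tau>) ^ n / fact n * avg (\<lambda>y. ?p n y * g y) - (- \<tau>) ^ n / fact n * avg (?p n) * avg g)"
    unfolding st by (rule suminf_cong) (simp add: algebra_simps)
  also have "\<dots> = avg (\<lambda>y. adj_orbit g \<tau> y * g y) - avg (adj_orbit g \<tau>) * avg g"
    by (simp only: av avg_g suminf_mult2[OF sav] suminf_diff[OF savg summable_mult2[OF sav]])
  finally have eq: "(\<Sum>n. (- \<tau>) ^ n / fact n * avg (?p (Suc n)))
      = avg (\<lambda>y. adj_orbit g \<tau> y * g y) - avg (adj_orbit g \<tau>) * avg g" .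
  have b1: "\<bar>avg (?p n)\<bar> \<le> G * (2 * G) ^ n" for n
    by (rule abs_avg_le_bound[OF adj_op_power_bound])
  have "0 \<le> 2 * G" using G0 by simp
  from exp_series_bounded(4)[OF b1 this, of \<tau>] show ?thesis
    unfolding eq av .
qed

end

section \<open>The cell problem and its averaged equation\<close>

lemma lebesgue_on_Ioo_integral_eq:
  fixes k :: "real \<Rightarrow> real"
  assumes [measurable]: "k \<in> borel_measurable borel"
  shows "(LINT s|lebesgue_on {a<..<b}. k s) = (LBINT s:{a..b}. k s)"
proof -
  have "(LINT s|lebesgue_on {a<..<b}. k s) = (LINT s|lebesgue. indicator {a<..<b} s *\<^sub>R k s)"
    by (rule integral_restrict_space) simp
  also have "\<dots> = (LINT s|lborel. indicator {a<..<b} s *\<^sub>R k s)"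
    by (rule integral_completion) measurable
  also have "\<dots> = (LINT s|lborel. indicator {a..b} s *\<^sub>R k s)"
  proof (rule Bochner_Integration.integral_cong_AE)
    show "AE s in lborel. indicator {a<..<b} s *\<^sub>R k s = indicator {a..b} s *\<^sub>R k s"
      using AE_lborel_singleton[of a] AE_lborel_singleton[of b]
      by eventually_elim (auto simp: indicator_def)
  qed measurable
  finally show ?thesis by (simp add: set_lebesgue_integral_def)
qed

lemma borel_measurable_LBINT_Icc:
  fixes k :: "'a \<Rightarrow> real \<Rightarrow> real"
  assumes [measurable]: "a \<in> borel_measurable N" "(\<lambda>(z, s). k z s) \<in> borel_measurable (N \<Otimes>\<^sub>M borel)"
  shows "(\<lambda>z. LBINT s:{0..a z}. k z s) \<in> borel_measurable N"
proof -
  have "(\<lambda>(z, s). (if 0 \<le> s \<and> s \<le> a z then 1 else 0) *\<^sub>R k z s) \<in> borel_measurable (N \<Otimes>\<^sub>M borel)"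
    by measurable
  then have "(\<lambda>(z, s). (if 0 \<le> s \<and> s \<le> a z then 1 else 0) *\<^sub>R k z s) \<in> borel_measurable (N \<Otimes>\<^sub>M lborel)"
    by (simp cong: measurable_cong_sets)
  then show ?thesis
    unfolding set_lebesgue_integral_def indicator_def atLeastAtMost_iff
    by (intro lborel.borel_measurable_lebesgue_integral) simp
qed

text \<open>
  The solution of \<open>\<partial>\<^sub>t w + g y * w = \<phi> t y\<close>, \<open>w = v y\<close> at \<open>t = 0\<close>, by variation of
  constants, with \<open>y\<close> as a parameter.
\<close>
definition cell_solution ::
    "(real ^ 'n \<Rightarrow> real) \<Rightarrow> (real ^ 'n \<Rightarrow> real) \<Rightarrow> (real \<Rightarrow> real ^ 'n \<Rightarrow> real) \<Rightarrow> real \<Rightarrow> real ^ 'n \<Rightarrow> real" where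
  "cell_solution g v \<phi> t y =
     exp (- t * g y) * (v y + (LBINT s:{0..t}. exp (s * g y) * \<phi> s y))"

context
  fixes g v :: "real ^ 'n \<Rightarrow> real" and \<phi> :: "real \<Rightarrow> real ^ 'n \<Rightarrow> real" and G V F T :: real
  assumes g_meas [measurable]: "g \<in> borel_measurable borel" and g_bound: "\<And>y. \<bar>g y\<bar> \<le> G"
    and v_meas [measurable]: "v \<in> borel_measurable borel" and v_bound: "\<And>y. \<bar>v y\<bar> \<le> V"
    and \<phi>_meas: "(\<lambda>(s, y). \<phi> s y) \<in> borel_measurable borel" and \<phi>_bound: "\<And>s y. \<bar>\<phi> s y\<bar> \<le> F"
    and T0: "0 \<le> T"
begin

private lemma G_ge0: "0 \<le> G" and F0: "0 \<le> F"
  using g_bound[of 0] \<phi>_bound[of 0 0] by linarith+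

private lemma \<phi>_meas_pair: "(\<lambda>(s, y). \<phi> s y) \<in> borel_measurable (borel \<Otimes>\<^sub>M borel)"
  using \<phi>_meas by (simp add: borel_prod)

private abbreviation "U \<equiv> cell_solution g v \<phi>"

lemma cell_solution_measurable: "(\<lambda>(t, y). U t y) \<in> borel_measurable borel"
proof -
  note [measurable] = \<phi>_meas_pair
  have "(\<lambda>z. LBINT s:{0..fst z}. exp (s * g (snd z)) * \<phi> s (snd z)) \<in> borel_measurable (borel \<Otimes>\<^sub>M borel)"
    by (rule borel_measurable_LBINT_Icc) measurable
  then have "(\<lambda>z. exp (- fst z * g (snd z)) * (v (snd z) + (LBINT s:{0..fst z}. exp (s * g (snd z)) * \<phi> s (snd z))))
      \<in> borel_measurable (borel \<Otimes>\<^sub>M borel)"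
    by measurable
  then show ?thesis
    by (simp add: borel_prod cell_solution_def split_beta')
qed

private lemma exp_bound: "0 \<le> s \<Longrightarrow> s \<le> T \<Longrightarrow> exp (s * g y) \<le> exp (T * G)" "0 \<le> s \<Longrightarrow> s \<le> T \<Longrightarrow> exp (- s * g y) \<le> exp (T * G)"
proof -
  assume s: "0 \<le> s" "s \<le> T"
  have "\<bar>s * g y\<bar> \<le> T * G"
    unfolding abs_mult using s g_bound[of y] by (intro mult_mono) auto
  then show "exp (s * g y) \<le> exp (T * G)" "exp (- s * g y) \<le> exp (T * G)" by auto
qed

private lemma inner_int:
  shows "(\<lambda>s. exp (s * g y) * \<phi> s y) \<in> borel_measurable borel"
    and "0 \<le> s \<Longrightarrow> s \<le> T \<Longrightarrow> \<bar>exp (s * g y) * \<phi> s y\<bar> \<le> exp (T * G) * F"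
proof -
  note [measurable] = \<phi>_meas_pair
  show "(\<lambda>s. exp (s * g y) * \<phi> s y) \<in> borel_measurable borel" by measurable
  assume "0 \<le> s" "s \<le> T"
  then show "\<bar>exp (s * g y) * \<phi> s y\<bar> \<le> exp (T * G) * F"
    using exp_bound(1)[of s y] \<phi>_bound[of s y] by (auto simp: abs_mult intro!: mult_mono)
qed

lemma cell_solution_bound:
  assumes "0 \<le> t" "t \<le> T"
  shows "\<bar>U t y\<bar> \<le> exp (T * G) * (\<bar>v y\<bar> + T * (exp (T * G) * F))"
proof -
  let ?E = "\<lambda>t. 0 + (LBINT s:{0..t}. exp (s * g y) * \<phi> s y)"
  have "\<bar>?E t - ?E 0\<bar> \<le> (exp (T * G) * F) * (t - 0)"
    by (rule indefinite_integral_lipschitz[OF inner_int(1)[of y] inner_int(2)[of _ y], where G = ?E])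
      (use assms in auto)
  then have "\<bar>LBINT s:{0..t}. exp (s * g y) * \<phi> s y\<bar> \<le> (exp (T * G) * F) * (t - 0)"
    by (simp add: LBINT_singleton)
  then have "\<bar>LBINT s:{0..t}. exp (s * g y) * \<phi> s y\<bar> \<le> T * (exp (T * G) * F)"
    using mult_left_mono[of t T "exp (T * G) * F"] assms F0 by (simp add: mult_ac)
  then show ?thesis
    unfolding cell_solution_def abs_mult using exp_bound(2)[OF assms, of y]
    by (intro mult_mono) auto
qed

private definition "M = exp (T * G) * (V + T * (exp (T * G) * F))"

private lemma U_bound:
  assumes "0 \<le> t" "t \<le> T"
  shows "\<bar>U t y\<bar> \<le> M"
proof -
  have "exp (T * G) * (\<bar>v y\<bar> + T * (exp (T * G) * F)) \<le> M"
    unfolding M_def using v_bound by (intro mult_left_mono) auto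
  then show ?thesis using cell_solution_bound[OF assms, of y] by linarith
qed

private lemma rhs_bound: "0 \<le> s \<Longrightarrow> s \<le> T \<Longrightarrow> \<bar>\<phi> s y - g y * U s y\<bar> \<le> F + G * M"
proof -
  assume s: "0 \<le> s" "s \<le> T"
  have "\<bar>g y * U s y\<bar> \<le> G * M"
    unfolding abs_mult using U_bound[OF s, of y] g_bound[of y] G_ge0 by (intro mult_mono) auto
  then show ?thesis using \<phi>_bound[of s y] by linarith
qed

private lemma U_meas: "(\<lambda>(t, y). U t y) \<in> borel_measurable (borel \<Otimes>\<^sub>M borel)"
  using cell_solution_measurable by (simp add: borel_prod)

private lemma rhs_meas: "(\<lambda>s. \<phi> s y - g y * U s y) \<in> borel_measurable borel"
  using \<phi>_meas_pair U_meas by measurable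

text \<open>
  Integration by parts in time for the product of \<open>exp (- t * g y)\<close> with the bracket in the
  definition of \<open>cell_solution\<close>.
\<close>
lemma cell_solution_integral_equation:
  assumes t: "0 \<le> t" "t \<le> T"
  shows "U t y = v y + (LBINT s:{0..t}. \<phi> s y - g y * U s y)"
proof -
  have "exp (- t * g y) * (v y + (LBINT s:{0..t}. exp (s * g y) * \<phi> s y))
     = exp (- 0 * g y) * v y + (LBINT s:{0..t}. (- g y * exp (- s * g y)) * (v y + (LBINT r:{0..s}. exp (r * g y) * \<phi> r y))
          + exp (- s * g y) * (exp (s * g y) * \<phi> s y))"
  proof (rule integration_by_parts_indefinite_integral(2))
    show "\<bar>exp (s * g y) * \<phi> s y\<bar> \<le> exp (T * G) * F" if "0 \<le> s" "s \<le> t" for s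
      using inner_int(2)[of s y] that t by simp
    show "((\<lambda>s. exp (- s * g y)) has_real_derivative - g y * exp (- s * g y)) (at s)" for s
      by (auto intro!: derivative_eq_intros)
    show "continuous_on {0..t} (\<lambda>s. - g y * exp (- s * g y))"
      by (intro continuous_intros)
  qed (use t inner_int(1) in auto)
  moreover have "(- g y * exp (- s * g y)) * (v y + (LBINT r:{0..s}. exp (r * g y) * \<phi> r y))
      + exp (- s * g y) * (exp (s * g y) * \<phi> s y) = \<phi> s y - g y * U s y" for s
  proof -
    have "exp (- s * g y) * (exp (s * g y) * \<phi> s y) = \<phi> s y"
      by (simp add: mult.assoc[symmetric] exp_add[symmetric])
    then show ?thesis unfolding cell_solution_def by simp
  qed
  ultimately show ?thesis
    by (simp add: cell_solution_def[of g v \<phi> t y])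
qed

lemma avg_cell_solution_integral_equation:
  assumes t: "0 \<le> t" "t \<le> T"
  shows "avg (U t) = avg v + (LBINT s:{0..t}. avg (\<phi> s) - avg (\<lambda>y. g y * U s y))"
proof -
  note [measurable] = \<phi>_meas_pair U_meas
  have b: "\<bar>\<phi> s y - g y * U s y\<bar> \<le> F + G * M" if "0 \<le> s" "s \<le> t" for s y
    using rhs_bound[of s y] that t by simp
  have bt: "\<bar>LBINT s:{0..t}. \<phi> s y - g y * U s y\<bar> \<le> M + V" for y
    using cell_solution_integral_equation[OF t, of y] U_bound[OF t, of y] v_bound[of y] by linarith
  have "integrable cell (\<lambda>y. LBINT s:{0..t}. \<phi> s y - g y * U s y)"
  proof (rule integrable_cell_bounded[OF _ bt])
    show "(\<lambda>y. LBINT s:{0..t}. \<phi> s y - g y * U s y) \<in> borel_measurable borel"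
      unfolding set_lebesgue_integral_def by measurable
  qed
  moreover have "integrable cell v" by (rule integrable_cell_bounded[OF v_meas v_bound])
  ultimately have "avg (U t) = avg v + avg (\<lambda>y. LBINT s:{0..t}. \<phi> s y - g y * U s y)"
    unfolding cell_solution_integral_equation[OF t, abs_def] avg_def by simp
  also have "avg (\<lambda>y. LBINT s:{0..t}. \<phi> s y - g y * U s y)
      = (LBINT s:{0..t}. avg (\<lambda>y. \<phi> s y - g y * U s y))"
  proof (rule avg_LBINT[OF _ b])
    show "(\<lambda>(s, y). \<phi> s y - g y * U s y) \<in> borel_measurable borel"
      unfolding borel_prod[symmetric] by measurable
  qed
  also have "\<dots> = (LBINT s:{0..t}. avg (\<phi> s) - avg (\<lambda>y. g y * U s y))"
  proof (rule set_lebesgue_integral_cong)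
    show "\<forall>s. s \<in> {0..t} \<longrightarrow> avg (\<lambda>y. \<phi> s y - g y * U s y) = avg (\<phi> s) - avg (\<lambda>y. g y * U s y)"
    proof (intro allI impI)
      fix s assume s: "s \<in> {0..t}"
      have "integrable cell (\<phi> s)"
        by (rule integrable_cell_bounded[OF _ \<phi>_bound]) measurable
      moreover have "integrable cell (\<lambda>y. g y * U s y)"
      proof (rule integrable_cell_bounded)
        show "\<bar>g y * U s y\<bar> \<le> G * M" for y
          unfolding abs_mult using U_bound[of s y] g_bound[of y] G_ge0 s t by (intro mult_mono) auto
      qed measurable
      ultimately show "avg (\<lambda>y. \<phi> s y - g y * U s y) = avg (\<phi> s) - avg (\<lambda>y. g y * U s y)"
        by (simp add: avg_def)
    qed
  qed simp
  finally show ?thesis .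
qed

private abbreviation "H t \<equiv> avg (U t)"
text \<open>
  In the notation below, \<open>cov \<tau> g\<close> is the memory kernel, and the two integrals in the source term
  have the integrands \<open>cov (t - s) (\<phi> s)\<close> and \<open>cov t v\<close>.
\<close>
private abbreviation "\<psi> \<equiv> adj_orbit g"
private abbreviation "cov \<tau> w \<equiv> avg (\<lambda>y. \<psi> \<tau> y * w y) - avg (\<psi> \<tau>) * avg w"

private lemma \<psi>_meas: "(\<lambda>(t, y). \<psi> t y) \<in> borel_measurable (borel \<Otimes>\<^sub>M borel)"
  using adj_orbit_measurable[OF g_meas g_bound] by (simp add: borel_prod)

private lemma avg_measurable:
  "(\<lambda>s. avg (\<lambda>y. g y * U s y)) \<in> borel_measurable borel"
  "(\<lambda>s. avg (\<phi> s)) \<in> borel_measurable borel"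
  "(\<lambda>s. H s) \<in> borel_measurable borel"
  "(\<lambda>\<tau>. avg (\<psi> \<tau>)) \<in> borel_measurable borel"
  "(\<lambda>s. avg (\<lambda>y. \<psi> (t - s) y * \<phi> s y)) \<in> borel_measurable borel"
  "(\<lambda>s. avg (\<lambda>y. \<psi> (t - s) y * g y)) \<in> borel_measurable borel"
proof -
  note [measurable] = \<phi>_meas_pair U_meas \<psi>_meas
  show "(\<lambda>s. avg (\<lambda>y. g y * U s y)) \<in> borel_measurable borel"
    "(\<lambda>s. avg (\<lambda>y. \<psi> (t - s) y * \<phi> s y)) \<in> borel_measurable borel"
    "(\<lambda>s. avg (\<lambda>y. \<psi> (t - s) y * g y)) \<in> borel_measurable borel"
    by (rule borel_measurable_avg, unfold borel_prod[symmetric], measurable)+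
qed (rule borel_measurable_avg[OF \<phi>_meas] borel_measurable_avg[OF cell_solution_measurable]
    borel_measurable_avg[OF adj_orbit_measurable[OF g_meas g_bound]])+

private lemma \<psi>_bound: "\<bar>\<tau>\<bar> \<le> T \<Longrightarrow> \<bar>\<psi> \<tau> y\<bar> \<le> G * exp (2 * G * T)"
proof -
  assume "\<bar>\<tau>\<bar> \<le> T"
  then have "G * exp (2 * G * \<bar>\<tau>\<bar>) \<le> G * exp (2 * G * T)"
    using G_ge0 by (intro mult_left_mono) (auto intro: mult_left_mono)
  then show ?thesis using adj_orbit_bound[OF g_meas g_bound, of \<tau> y] by linarith
qed

private lemma \<psi>_deriv:
  "((\<lambda>s. \<psi> (t - s) y) has_real_derivative g y * \<psi> (t - s) y - g y * avg (\<psi> (t - s))) (at s)"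
proof -
  have "((\<lambda>s. t - s) has_real_derivative - 1) (at s)" by (auto intro!: derivative_eq_intros)
  from DERIV_chain2[OF adj_orbit_has_derivative[OF g_meas g_bound] this] show ?thesis
    by (rule DERIV_cong) simp
qed

private lemma avg_\<psi>_deriv:
  "((\<lambda>s. avg (\<psi> (t - s))) has_real_derivative
      cov (t - s) g) (at s)"
proof -
  have "((\<lambda>s. t - s) has_real_derivative - 1) (at s)" by (auto intro!: derivative_eq_intros)
  from DERIV_chain2[OF avg_adj_orbit_has_derivative[OF g_meas g_bound] this] show ?thesis
    by (rule DERIV_cong) simp
qed

private lemma isCont_avg_\<psi>_mult: "isCont (\<lambda>\<tau>. avg (\<lambda>y. \<psi> \<tau> y * g y)) \<tau>"
proof -
  have "\<bar>avg (\<lambda>y. (adj_op g ^^ n) g y * g y)\<bar> \<le> G * G * (2 * G) ^ n" for n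
  proof (rule abs_avg_le_bound)
    show "\<bar>(adj_op g ^^ n) g y * g y\<bar> \<le> G * G * (2 * G) ^ n" for y
      using mult_mono[OF adj_op_power_bound[OF g_meas g_bound, of n y] g_bound[of y]] G_ge0
      by (simp add: abs_mult mult_ac)
  qed
  from exp_series_bounded(4)[OF this] G_ge0 show ?thesis
    unfolding avg_adj_orbit_mult[OF g_meas g_bound g_meas g_bound] by (intro DERIV_isCont) simp
qed

lemma L_op_one: "L_op (\<lambda>_. 1) w = (\<lambda>y. w y - avg w)"
  by (simp add: L_op_def)

text \<open>
  Subtracting the mean from \<open>w\<close> turns the pairing with \<open>\<psi> \<tau>\<close> into a covariance.
\<close>
private lemma kernel_eq:
  assumes [measurable]: "w \<in> borel_measurable borel" and wB: "\<And>y. \<bar>w y\<bar> \<le> B"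
  shows "avg (\<lambda>y. g y * semigroup_L g (- \<tau>) (L_op (\<lambda>_. 1) w) y)
       = cov \<tau> w"
proof -
  note [measurable] = \<psi>_meas
  have psb: "\<bar>\<psi> \<tau> y\<bar> \<le> G * exp (2 * G * \<bar>\<tau>\<bar>)" for y by (rule adj_orbit_bound[OF g_meas g_bound])
  have "avg (\<lambda>y. g y * semigroup_L g (- \<tau>) (\<lambda>y. w y - avg w) y) = avg (\<lambda>y. \<psi> \<tau> y * (w y - avg w))"
  proof (rule avg_mult_semigroup_L[OF g_meas g_bound])
    show "\<bar>w y - avg w\<bar> \<le> 2 * B" for y
      using wB[of y] abs_avg_le_bound[of w B, OF wB] by linarith
  qed measurable
  also have "\<dots> = avg (\<lambda>y. \<psi> \<tau> y * w y) - avg (\<psi> \<tau>) * avg w"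
  proof -
    have "integrable cell (\<psi> \<tau>)" by (rule integrable_cell_bounded[OF _ psb]) measurable
    moreover have "integrable cell (\<lambda>y. \<psi> \<tau> y * w y)"
    proof (rule integrable_cell_bounded)
      show "\<bar>\<psi> \<tau> y * w y\<bar> \<le> G * exp (2 * G * \<bar>\<tau>\<bar>) * B" for y
        unfolding abs_mult using psb[of y] wB[of y] G_ge0 by (intro mult_mono) auto
    qed measurable
    ultimately show ?thesis by (simp add: avg_def right_diff_distrib)
  qed
  finally show ?thesis by (simp add: L_op_one)
qed

text \<open>
  The moment \<open>\<langle>g U\<rangle>\<close> is expressed through the history of \<open>H = \<langle>U\<rangle>\<close>. Integration by parts of
  \<open>\<psi> (t - s) y * U s y\<close> cancels the terms \<open>g \<psi> U\<close> and leaves \<open>\<langle>\<psi> (t - s)\<rangle> g U\<close>; integration by parts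
  of \<open>\<langle>\<psi> (t - s)\<rangle> * H s\<close> produces the same integral of \<open>\<langle>\<psi> (t - s)\<rangle> \<langle>g U\<rangle>\<close>, which drops out of the
  difference.
\<close>
lemma avg_mult_cell_solution_memory:
  assumes t: "0 \<le> t" "t \<le> T"
  shows "avg (\<lambda>y. g y * U t y) = avg g * H t
     - (LBINT s:{0..t}. cov (t - s) g * H s)
     + (LBINT s:{0..t}. cov (t - s) (\<phi> s))
     + cov t v"
proof -
  note [measurable] = \<phi>_meas_pair U_meas \<psi>_meas avg_measurable
  let ?m = "\<lambda>\<tau>. avg (\<psi> \<tau>)"
  let ?h = "\<lambda>s. avg (\<lambda>y. g y * U s y)"
  define P where "P = G * exp (2 * G * T)"
  have P: "\<bar>\<psi> (t - s) y\<bar> \<le> P" if "0 \<le> s" "s \<le> t" for s y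
    unfolding P_def using that t by (intro \<psi>_bound) auto
  then have P0: "0 \<le> P" using t by (meson abs_ge_zero order_refl order_trans)
  have mb: "\<bar>?m (t - s)\<bar> \<le> P" if "0 \<le> s" "s \<le> t" for s
    by (rule abs_avg_le_bound[OF P[OF that]])
  have gU: "\<bar>g y * U s y\<bar> \<le> G * M" if "0 \<le> s" "s \<le> t" for s y
    unfolding abs_mult using U_bound[of s y] g_bound[of y] G_ge0 that t by (intro mult_mono) auto
  have \<psi>\<phi>: "\<bar>\<psi> (t - s) y * \<phi> s y\<bar> \<le> P * F" if "0 \<le> s" "s \<le> t" for s y
    unfolding abs_mult using P[OF that, of y] \<phi>_bound[of s y] P0 by (intro mult_mono) auto
  have \<psi>g: "\<bar>\<psi> (t - s) y * g y\<bar> \<le> P * G" if "0 \<le> s" "s \<le> t" for s y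
    unfolding abs_mult using P[OF that, of y] g_bound[of y] P0 by (intro mult_mono) auto
  have hb: "\<bar>?h s\<bar> \<le> G * M" if "0 \<le> s" "s \<le> t" for s
    by (rule abs_avg_le_bound[OF gU[OF that]])
  have Hb: "\<bar>H s\<bar> \<le> M" if "0 \<le> s" "s \<le> t" for s
    by (rule abs_avg_le_bound) (use U_bound[of s] that t in auto)
  have \<psi>\<phi>b: "\<bar>avg (\<lambda>y. \<psi> (t - s) y * \<phi> s y)\<bar> \<le> P * F" if "0 \<le> s" "s \<le> t" for s
    by (rule abs_avg_le_bound[OF \<psi>\<phi>[OF that]])
  have \<psi>gb: "\<bar>avg (\<lambda>y. \<psi> (t - s) y * g y)\<bar> \<le> P * G" if "0 \<le> s" "s \<le> t" for s
    by (rule abs_avg_le_bound[OF \<psi>g[OF that]])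
  \<comment> \<open>integration by parts for each \<open>y\<close>, then averaging over \<open>y\<close>\<close>
  have pt: "g y * U t y = \<psi> t y * v y + (LBINT s:{0..t}. \<psi> (t - s) y * \<phi> s y - ?m (t - s) * (g y * U s y))" for y
  proof -
    have "\<psi> (t - t) y * U t y = \<psi> (t - 0) y * v y
       + (LBINT s:{0..t}. (g y * \<psi> (t - s) y - g y * ?m (t - s)) * U s y + \<psi> (t - s) y * (\<phi> s y - g y * U s y))"
    proof (rule integration_by_parts_indefinite_integral(2))
      show "continuous_on {0..t} (\<lambda>s. g y * \<psi> (t - s) y - g y * ?m (t - s))"
        by (intro continuous_intros continuous_at_imp_continuous_on ballI
              DERIV_isCont[OF \<psi>_deriv] DERIV_isCont[OF avg_\<psi>_deriv])
      show "\<bar>\<phi> s y - g y * U s y\<bar> \<le> F + G * M" if "0 \<le> s" "s \<le> t" for s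
        using rhs_bound[of s y] that t by simp
      show "U s y = v y + (LBINT r:{0..s}. \<phi> r y - g y * U r y)" if "0 \<le> s" "s \<le> t" for s
        using cell_solution_integral_equation[of s y] that t by simp
    qed (use t rhs_meas \<psi>_deriv in auto)
    then show ?thesis
      by (simp add: adj_orbit_0[OF g_meas g_bound] algebra_simps)
  qed
  have int\<psi>v: "integrable cell (\<lambda>y. \<psi> t y * v y)"
  proof (rule integrable_cell_bounded)
    show "\<bar>\<psi> t y * v y\<bar> \<le> P * V" for y
      unfolding abs_mult using P[of 0 y] v_bound[of y] P0 t by (intro mult_mono) auto
  qed measurable
  have bd1: "\<bar>\<psi> (t - s) y * \<phi> s y - ?m (t - s) * (g y * U s y)\<bar> \<le> P * F + P * (G * M)" if "0 \<le> s" "s \<le> t" for s y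
  proof -
    have "\<bar>?m (t - s) * (g y * U s y)\<bar> \<le> P * (G * M)"
      unfolding abs_mult[of "?m (t - s)"] using mb[OF that] gU[OF that, of y] P0 by (intro mult_mono) auto
    then show ?thesis using \<psi>\<phi>[OF that, of y] by linarith
  qed
  have "?h t = avg (\<lambda>y. \<psi> t y * v y) + avg (\<lambda>y. LBINT s:{0..t}. \<psi> (t - s) y * \<phi> s y - ?m (t - s) * (g y * U s y))"
  proof -
    have "integrable cell (\<lambda>y. g y * U t y)"
      by (rule integrable_cell_bounded[OF _ gU[of t]]) (use t in auto)
    then have "integrable cell (\<lambda>y. g y * U t y - \<psi> t y * v y)" using int\<psi>v by simp
    then have "integrable cell (\<lambda>y. LBINT s:{0..t}. \<psi> (t - s) y * \<phi> s y - ?m (t - s) * (g y * U s y))"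
      unfolding pt by simp
    then show ?thesis unfolding pt[abs_def] avg_def using int\<psi>v by simp
  qed
  also have "avg (\<lambda>y. LBINT s:{0..t}. \<psi> (t - s) y * \<phi> s y - ?m (t - s) * (g y * U s y))
     = (LBINT s:{0..t}. avg (\<lambda>y. \<psi> (t - s) y * \<phi> s y - ?m (t - s) * (g y * U s y)))"
    by (rule avg_LBINT[OF _ bd1]) (unfold borel_prod[symmetric], measurable)
  also have "\<dots> = (LBINT s:{0..t}. avg (\<lambda>y. \<psi> (t - s) y * \<phi> s y) - ?m (t - s) * ?h s)"
  proof (rule set_lebesgue_integral_cong)
    show "\<forall>s. s \<in> {0..t} \<longrightarrow> avg (\<lambda>y. \<psi> (t - s) y * \<phi> s y - ?m (t - s) * (g y * U s y))
        = avg (\<lambda>y. \<psi> (t - s) y * \<phi> s y) - ?m (t - s) * ?h s"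
    proof (intro allI impI)
      fix s assume "s \<in> {0..t}"
      then have s: "0 \<le> s" "s \<le> t" by auto
      have "integrable cell (\<lambda>y. \<psi> (t - s) y * \<phi> s y)" "integrable cell (\<lambda>y. g y * U s y)"
        by (rule integrable_cell_bounded[OF _ \<psi>\<phi>[OF s]] integrable_cell_bounded[OF _ gU[OF s]]; measurable)+
      then show "avg (\<lambda>y. \<psi> (t - s) y * \<phi> s y - ?m (t - s) * (g y * U s y))
        = avg (\<lambda>y. \<psi> (t - s) y * \<phi> s y) - ?m (t - s) * ?h s"
        by (simp add: avg_def)
    qed
  qed simp
  finally have one: "?h t = avg (\<lambda>y. \<psi> t y * v y) + (LBINT s:{0..t}. avg (\<lambda>y. \<psi> (t - s) y * \<phi> s y) - ?m (t - s) * ?h s)" .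
  \<comment> \<open>the same with averages taken first; \<open>\<langle>\<psi>\<rangle>\<close> and \<open>H\<close> depend on time only\<close>
  have "?m (t - t) * H t = ?m (t - 0) * avg v
     + (LBINT s:{0..t}. cov (t - s) g * H s + ?m (t - s) * (avg (\<phi> s) - ?h s))"
  proof (rule integration_by_parts_indefinite_integral(2))
    show "continuous_on {0..t} (\<lambda>s. avg (\<lambda>y. \<psi> (t - s) y * g y) - ?m (t - s) * avg g)"
      by (intro continuous_intros continuous_at_imp_continuous_on ballI DERIV_isCont[OF avg_\<psi>_deriv]
            isCont_o2[OF _ isCont_avg_\<psi>_mult])
    show "\<bar>avg (\<phi> s) - ?h s\<bar> \<le> F + G * M" if "0 \<le> s" "s \<le> t" for s
      using hb[OF that] abs_avg_le_bound[of "\<phi> s" F, OF \<phi>_bound] by linarith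
    show "H s = avg v + (LBINT r:{0..s}. avg (\<phi> r) - ?h r)" if "0 \<le> s" "s \<le> t" for s
      using avg_cell_solution_integral_equation[of s] that t by simp
  qed (use t avg_\<psi>_deriv in auto)
  then have two: "avg g * H t = ?m t * avg v
     + (LBINT s:{0..t}. cov (t - s) g * H s + ?m (t - s) * (avg (\<phi> s) - ?h s))"
    by (simp add: adj_orbit_0[OF g_meas g_bound])
  have mm: "\<bar>?m (t - s) * x\<bar> \<le> P * B" if "0 \<le> s" "s \<le> t" "\<bar>x\<bar> \<le> B" for s x B
    unfolding abs_mult using mb[of s] that P0 by (intro mult_mono) auto
  have i1: "set_integrable lborel {0..t} (\<lambda>s. cov (t - s) g * H s)"
  proof (rule set_integrable_bounded_Icc)
    show "\<bar>cov (t - s) g * H s\<bar> \<le> (P * G + P * G) * M" if "0 \<le> s" "s \<le> t" for s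
    proof -
      have "\<bar>avg (\<lambda>y. \<psi> (t - s) y * g y) - ?m (t - s) * avg g\<bar> \<le> P * G + P * G"
        using \<psi>gb[OF that] mm[OF that abs_avg_le_bound[of g G, OF g_bound]] by linarith
      then show ?thesis unfolding abs_mult using Hb[OF that] P0 G_ge0 by (intro mult_mono) auto
    qed
  qed measurable
  have i2: "set_integrable lborel {0..t} (\<lambda>s. ?m (t - s) * avg (\<phi> s))"
    by (rule set_integrable_bounded_Icc[OF _ mm]) (auto intro: abs_avg_le_bound[OF \<phi>_bound])
  have i3: "set_integrable lborel {0..t} (\<lambda>s. ?m (t - s) * ?h s)"
    by (rule set_integrable_bounded_Icc[OF _ mm]) (auto intro: hb)
  have i4: "set_integrable lborel {0..t} (\<lambda>s. avg (\<lambda>y. \<psi> (t - s) y * \<phi> s y))"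
    by (rule set_integrable_bounded_Icc[OF _ \<psi>\<phi>b]) auto
  have two': "avg g * H t = ?m t * avg v
     + (LBINT s:{0..t}. cov (t - s) g * H s)
     + ((LBINT s:{0..t}. ?m (t - s) * avg (\<phi> s)) - (LBINT s:{0..t}. ?m (t - s) * ?h s))"
    unfolding two right_diff_distrib using i1 i2 i3
    by (simp add: set_integral_add set_integral_diff)
  have one': "?h t = avg (\<lambda>y. \<psi> t y * v y) + ((LBINT s:{0..t}. avg (\<lambda>y. \<psi> (t - s) y * \<phi> s y)) - (LBINT s:{0..t}. ?m (t - s) * ?h s))"
    using one i3 i4 by (simp add: set_integral_diff)
  have "(LBINT s:{0..t}. avg (\<lambda>y. \<psi> (t - s) y * \<phi> s y) - ?m (t - s) * avg (\<phi> s))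
     = (LBINT s:{0..t}. avg (\<lambda>y. \<psi> (t - s) y * \<phi> s y)) - (LBINT s:{0..t}. ?m (t - s) * avg (\<phi> s))"
    using i2 i4 by (simp add: set_integral_diff)
  then show ?thesis using one' two' by linarith
qed

text \<open>
  The average \<open>H\<close> is the indefinite integral of \<open>\<langle>\<phi>\<rangle> - \<langle>g U\<rangle>\<close>, hence absolutely continuous and
  differentiable almost everywhere with this derivative; the memory identity rewrites \<open>\<langle>g U\<rangle>\<close>.
\<close>
lemma avg_cell_solution_solves:
  "absolutely_continuous_fun 0 T (\<lambda>t. avg (cell_solution g v \<phi> t))" (is ?ac)
  "avg (cell_solution g v \<phi> 0) = avg v" (is ?init)
  "AE t in lebesgue_on {0<..<T}. \<exists>D.
     ((\<lambda>s. avg (cell_solution g v \<phi> s)) has_real_derivative D) (at t) \<and>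
     D + avg g * avg (cell_solution g v \<phi> t)
       - (LINT s|lebesgue_on {0<..<t}.
            avg (\<lambda>y. g y * semigroup_L g (- (t - s)) (L_op (\<lambda>_. 1) g) y) * avg (cell_solution g v \<phi> s))
     = avg (\<phi> t)
       - (LINT s|lebesgue_on {0<..<t}.
            avg (\<lambda>y. g y * semigroup_L g (- (t - s)) (L_op (\<lambda>_. 1) (\<phi> s)) y))
       - avg (\<lambda>y. g y * semigroup_L g (- t) (L_op (\<lambda>_. 1) v) y)" (is ?eq)
proof -
  note [measurable] = \<phi>_meas_pair U_meas \<psi>_meas avg_measurable
  let ?r = "\<lambda>s. avg (\<phi> s) - avg (\<lambda>y. g y * U s y)"
  have r_meas: "?r \<in> borel_measurable borel" by measurable
  have r_bound: "\<bar>?r s\<bar> \<le> F + G * M" if s: "0 \<le> s" "s \<le> T" for s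
  proof -
    have "\<bar>avg (\<lambda>y. g y * U s y)\<bar> \<le> G * M"
    proof (rule abs_avg_le_bound)
      show "\<bar>g y * U s y\<bar> \<le> G * M" for y
        unfolding abs_mult using U_bound[OF s, of y] g_bound[of y] G_ge0 by (intro mult_mono) auto
    qed
    then show ?thesis using abs_avg_le_bound[of "\<phi> s" F, OF \<phi>_bound] by linarith
  qed
  note ii = r_meas r_bound avg_cell_solution_integral_equation
  show ?ac by (rule indefinite_integral_absolutely_continuous[OF ii])
  have "U 0 = v" by (rule ext) (simp add: cell_solution_def LBINT_singleton)
  then show ?init by simp
  have ae: "AE s in lebesgue_on {0<..<T}. s \<in> {0<..<T}"
    by (rule AE_I2) simp
  have "AE t in lebesgue_on {0<..<T}. ((\<lambda>s. H s) has_real_derivative ?r t) (at t)"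
    by (rule AE_indefinite_integral_has_derivative[OF ii])
  with ae show ?eq
  proof eventually_elim
    case (elim t)
    then have t: "0 \<le> t" "t \<le> T" by auto
    show ?case
    proof (intro exI conjI)
      show "((\<lambda>s. H s) has_real_derivative ?r t) (at t)" by (rule elim)
      have k1: "avg (\<lambda>y. g y * semigroup_L g (- (t - s)) (L_op (\<lambda>_. 1) g) y)
          = cov (t - s) g" for s
        by (rule kernel_eq[OF g_meas g_bound])
      have k2: "avg (\<lambda>y. g y * semigroup_L g (- (t - s)) (L_op (\<lambda>_. 1) (\<phi> s)) y)
          = cov (t - s) (\<phi> s)" for s
        by (rule kernel_eq[OF _ \<phi>_bound]) measurable
      have k3: "avg (\<lambda>y. g y * semigroup_L g (- t) (L_op (\<lambda>_. 1) v) y)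
          = cov t v"
        by (rule kernel_eq[OF v_meas v_bound])
      have c1: "(LINT s|lebesgue_on {0<..<t}. cov (t - s) g * H s)
          = (LBINT s:{0..t}. cov (t - s) g * H s)"
        by (rule lebesgue_on_Ioo_integral_eq) measurable
      have c2: "(LINT s|lebesgue_on {0<..<t}. cov (t - s) (\<phi> s))
          = (LBINT s:{0..t}. cov (t - s) (\<phi> s))"
        by (rule lebesgue_on_Ioo_integral_eq) measurable
      show "?r t + avg g * H t
       - (LINT s|lebesgue_on {0<..<t}. avg (\<lambda>y. g y * semigroup_L g (- (t - s)) (L_op (\<lambda>_. 1) g) y) * H s)
       = avg (\<phi> t)
       - (LINT s|lebesgue_on {0<..<t}. avg (\<lambda>y. g y * semigroup_L g (- (t - s)) (L_op (\<lambda>_. 1) (\<phi> s)) y))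
       - avg (\<lambda>y. g y * semigroup_L g (- t) (L_op (\<lambda>_. 1) v) y)"
        unfolding k1 k2 k3 c1 c2 avg_mult_cell_solution_memory[OF t] by simp
    qed
  qed
qed

lemma borel_measurable_avg_semigroup_L_source:
  "(\<lambda>s. avg (\<lambda>y. g y * semigroup_L g (- (t - s)) (L_op (\<lambda>_. 1) (\<phi> s)) y)) \<in> borel_measurable borel"
proof -
  note [measurable] = \<phi>_meas_pair \<psi>_meas avg_measurable
  have "avg (\<lambda>y. g y * semigroup_L g (- (t - s)) (L_op (\<lambda>_. 1) (\<phi> s)) y)
      = cov (t - s) (\<phi> s)" for s
    by (rule kernel_eq[OF _ \<phi>_bound]) measurable
  then show ?thesis by simp
qed

end

section \<open>Borel representatives of Bochner classes\<close>

lemma AE_lebesgue_on_iff: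
  "S \<in> sets lebesgue \<Longrightarrow> (AE x in lebesgue_on S. P x) \<longleftrightarrow> (AE x in lborel. x \<in> S \<longrightarrow> P x)"
  by (simp add: AE_restrict_space_iff AE_completion_iff)

text \<open>
  The space of bounded continuous functions is not separable, so joint measurability in \<open>(z, y)\<close> is not
  a formal consequence of measurability in \<open>z\<close>. For a simple function the evaluation is a finite sum of
  products.
\<close>
lemma borel_measurable_apply_simple_bcontfun:
  fixes r :: "'a::euclidean_space \<Rightarrow> ((real ^ 'n) \<Rightarrow>\<^sub>C real)"
  assumes r: "simple_function borel r"
  shows "(\<lambda>(z, y). r z y) \<in> borel_measurable borel"
proof -
  have fin: "finite (range r)" and pre: "\<And>c. r -` {c} \<in> sets borel"
    using r simple_functionD[OF r] by auto
  have "(\<lambda>(z, y). r z y) = (\<lambda>w. \<Sum>c\<in>range r. indicator (r -` {c}) (fst w) * c (snd w))"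
  proof
    fix w :: "'a \<times> (real ^ 'n)"
    have "(\<Sum>c\<in>range r. indicator (r -` {c}) (fst w) * c (snd w))
        = (\<Sum>c\<in>range r. if c = r (fst w) then r (fst w) (snd w) else 0)"
      by (rule sum.cong) (auto simp: indicator_def)
    then show "(case w of (z, y) \<Rightarrow> r z y) = (\<Sum>c\<in>range r. indicator (r -` {c}) (fst w) * c (snd w))"
      using fin by (simp add: split_beta)
  qed
  moreover have "(\<lambda>w. indicator B (fst w) * c (snd w)) \<in> borel_measurable borel"
    if B: "B \<in> sets borel" for B :: "'a set" and c :: "(real ^ 'n) \<Rightarrow>\<^sub>C real"
  proof -
    have c: "apply_bcontfun c \<in> borel_measurable borel"
      by (rule borel_measurable_continuous_onI) (rule continuous_on_apply_bcontfun)
    have "(\<lambda>w::'a \<times> (real ^ 'n). c (snd w)) \<in> borel_measurable (borel \<Otimes>\<^sub>M borel)"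
      by (rule measurable_compose[OF measurable_snd c])
    moreover have "(\<lambda>w::'a \<times> (real ^ 'n). indicator B (fst w) :: real) \<in> borel_measurable (borel \<Otimes>\<^sub>M borel)"
      by (rule measurable_compose[OF measurable_fst borel_measurable_indicator[OF B]])
    ultimately show ?thesis
      unfolding borel_prod by (rule borel_measurable_times[rotated])
  qed
  ultimately show ?thesis
    by (simp only:) (intro borel_measurable_sum, blast intro: pre)
qed

text \<open>
  Each approximating simple function agrees with a Borel one outside a null set. Outside a Borel null set
  containing these countably many exceptions and the points without convergence, the Borel functions
  converge to \<open>F\<close>; on that set the representative is \<open>0\<close>.
\<close>
lemma strongly_measurable_borel_representative:
  fixes F :: "'a::euclidean_space \<Rightarrow> ((real ^ 'n) \<Rightarrow>\<^sub>C real)"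
  assumes S: "S \<in> sets borel" and V: "F \<in> S \<rightarrow> V" "0 \<in> V"
    and sm: "strongly_measurable (lebesgue_on S) V F"
  obtains F' where "\<And>z. F' z \<in> V" "\<And>z. z \<notin> S \<Longrightarrow> F' z = 0"
    "(\<lambda>(z, y). F' z y) \<in> borel_measurable borel" "(\<lambda>z. norm (F' z)) \<in> borel_measurable borel"
    "AE z in lborel. z \<in> S \<longrightarrow> F z = F' z"
proof -
  have SL: "S \<in> sets lebesgue" using S by simp
  obtain s where s: "\<And>i. simple_function (lebesgue_on S) (s i)"
      "AE z in lebesgue_on S. (\<lambda>i. s i z) \<longlonglongrightarrow> F z"
    using sm by (auto simp: strongly_measurable_def)
  have "simple_function lebesgue (\<lambda>z. indicator S z *\<^sub>R s i z)" for i
    using s(1)[of i] SL by (simp add: simple_function_restrict_space)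
  then have "\<exists>t. simple_function lborel t \<and> (AE z in lborel. indicator S z *\<^sub>R s i z = t z)" for i
    by (rule completion_ex_simple_function)
  then obtain t where t: "\<And>i. simple_function lborel (t i)"
      "\<And>i. AE z in lborel. indicator S z *\<^sub>R s i z = t i z"
    by metis
  have "AE z in lborel. \<forall>i. indicator S z *\<^sub>R s i z = t i z"
    using t(2) by (simp add: AE_all_countable)
  moreover have "AE z in lborel. z \<in> S \<longrightarrow> (\<lambda>i. s i z) \<longlonglongrightarrow> F z"
    using s(2) SL by (simp add: AE_lebesgue_on_iff)
  ultimately have "AE z in lborel. z \<in> S \<longrightarrow> (\<lambda>i. t i z) \<longlonglongrightarrow> F z"
  proof eventually_elim
    case (elim z)
    show ?case
    proof
      assume z: "z \<in> S"
      then have "t i z = s i z" for i using elim(1) by (metis indicator_simps(1) scaleR_one)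
      then show "(\<lambda>i. t i z) \<longlonglongrightarrow> F z" using elim(2) z by simp
    qed
  qed
  then obtain N where N: "\<And>z. z \<notin> N \<Longrightarrow> z \<in> S \<Longrightarrow> (\<lambda>i. t i z) \<longlonglongrightarrow> F z" "N \<in> null_sets lborel"
    by (rule AE_E3) auto
  define F' where "F' z = (if z \<in> S - N then F z else 0)" for z
  define r where "r i z = (indicator (S - N) z :: real) *\<^sub>R t i z" for i z
  have SN: "S - N \<in> sets borel" using S N(2) by auto
  have tb: "simple_function borel (t i)" for i
    using t(1)[of i] by (simp add: simple_function_def)
  have r: "simple_function borel (r i)" for i
    unfolding r_def using SN tb[of i] by (intro simple_function_compose2[where h = "(*\<^sub>R)"] simple_function_indicator) auto
  have lim: "(\<lambda>i. r i z) \<longlonglongrightarrow> F' z" for z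
    using N(1)[of z] by (cases "z \<in> S - N") (auto simp: r_def F'_def)
  show ?thesis
  proof (rule that[of F'])
    show "F' z \<in> V" for z using V by (auto simp: F'_def)
    show "z \<notin> S \<Longrightarrow> F' z = 0" for z by (simp add: F'_def)
    have "(\<lambda>i. r i z y) \<longlonglongrightarrow> F' z y" for z y
    proof (rule metric_LIMSEQ_I)
      fix e :: real assume "0 < e"
      then obtain n where "\<forall>i\<ge>n. dist (r i z) (F' z) < e" using metric_LIMSEQ_D[OF lim[of z]] by blast
      then show "\<exists>n. \<forall>i\<ge>n. dist (r i z y) (F' z y) < e" using dist_bounded order_le_less_trans by blast
    qed
    then have "\<And>w. (\<lambda>i. (\<lambda>(z, y). r i z y) w) \<longlonglongrightarrow> (\<lambda>(z, y). F' z y) w" by auto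
    then show "(\<lambda>(z, y). F' z y) \<in> borel_measurable borel"
      by (rule borel_measurable_LIMSEQ_real[OF _ borel_measurable_apply_simple_bcontfun[OF r]])
    have "(\<lambda>z. norm (r i z)) \<in> borel_measurable borel" for i
      by (rule borel_measurable_simple_function) (rule simple_function_compose1[OF r])
    then show "(\<lambda>z. norm (F' z)) \<in> borel_measurable borel"
      using tendsto_norm[OF lim] by (rule borel_measurable_LIMSEQ_real[rotated])
    have "AE z in lborel. z \<notin> N" using N(2) by (rule AE_not_in)
    then show "AE z in lborel. z \<in> S \<longrightarrow> F z = F' z" by eventually_elim (simp add: F'_def)
  qed
qed

lemma zero_in_C_per: "0 \<in> C_per"
  by (simp add: C_per_def)

lemma C_per_properties:
  assumes "w \<in> C_per"
  shows "continuous_on UNIV (apply_bcontfun w)"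
    and "apply_bcontfun w (y + axis i 1) = apply_bcontfun w y"
    and "\<bar>apply_bcontfun w y\<bar> \<le> norm w"
  using assms norm_bounded[of w y] by (auto simp: C_per_def)

lemma Bochner_Linf_borel_representative:
  fixes F :: "'a::euclidean_space \<Rightarrow> ((real ^ 'n) \<Rightarrow>\<^sub>C real)"
  assumes S: "S \<in> sets borel" and F: "F \<in> Bochner_Linf (lebesgue_on S) C_per"
  obtains k C where "\<And>z y. \<bar>k z y\<bar> \<le> C" "(\<lambda>(z, y). k z y) \<in> borel_measurable borel"
    "\<And>z. continuous_on UNIV (k z)" "\<And>z y i. k z (y + axis i 1) = k z y"
    "AE z in lborel. z \<in> S \<longrightarrow> apply_bcontfun (F z) = k z"
proof -
  have FV: "F \<in> S \<rightarrow> C_per" and sm: "strongly_measurable (lebesgue_on S) C_per F"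
    using F by (simp_all add: Bochner_Linf_def)
  obtain F' where F': "\<And>z. F' z \<in> C_per" "\<And>z. z \<notin> S \<Longrightarrow> F' z = 0"
    "(\<lambda>(z, y). F' z y) \<in> borel_measurable borel" "(\<lambda>z. norm (F' z)) \<in> borel_measurable borel"
    "AE z in lborel. z \<in> S \<longrightarrow> F z = F' z"
    by (rule strongly_measurable_borel_representative[OF S FV zero_in_C_per sm]) blast
  obtain C where "AE z in lebesgue_on S. norm (F z) \<le> C"
    using F unfolding Bochner_Linf_def by blast
  then have C: "AE z in lborel. z \<in> S \<longrightarrow> norm (F z) \<le> C"
    using S by (simp add: AE_lebesgue_on_iff)
  define b where "b z = norm (F' z)" for z
  define k' where "k' z = apply_bcontfun (F' z)" for z
  define k where "k z y = (if b z \<le> \<bar>C\<bar> then k' z y else 0)" for z y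
  have b [measurable]: "b \<in> borel_measurable borel" using F'(4) unfolding b_def .
  have "(\<lambda>(z, y). k' z y) \<in> borel_measurable borel"
    using F'(3) unfolding k'_def .
  then have k' [measurable]: "(\<lambda>(z, y). k' z y) \<in> borel_measurable (borel \<Otimes>\<^sub>M borel)"
    by (simp only: borel_prod)
  have "(\<lambda>(z, y). k z y) \<in> borel_measurable (borel \<Otimes>\<^sub>M borel)"
    unfolding k_def by measurable
  then have 1: "(\<lambda>(z, y). k z y) \<in> borel_measurable borel" by (simp only: borel_prod)
  have 2: "AE z in lborel. z \<in> S \<longrightarrow> apply_bcontfun (F z) = k z"
    using F'(5) C by eventually_elim (auto simp: k_def k'_def b_def)
  have kb: "\<bar>k z y\<bar> \<le> \<bar>C\<bar>" for z y
    using C_per_properties(3)[OF F'(1), of z y] by (auto simp: k_def k'_def b_def)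
  have kc: "continuous_on UNIV (k z)" for z
    using C_per_properties(1)[OF F'(1), of z]
    by (cases "b z \<le> \<bar>C\<bar>") (simp_all add: k_def[abs_def] k'_def)
  have kp: "k z (y + axis i 1) = k z y" for z y i
    using C_per_properties(2)[OF F'(1), of z y i] by (simp add: k_def k'_def)
  show ?thesis by (rule that[OF kb 1 kc kp 2])
qed

lemma Bochner_L2_borel_representative:
  fixes F :: "'a::euclidean_space \<Rightarrow> ((real ^ 'n) \<Rightarrow>\<^sub>C real)"
  assumes S: "S \<in> sets borel" and F: "F \<in> Bochner_L2 (lebesgue_on S) C_per"
  obtains k b where "\<And>z y. \<bar>k z y\<bar> \<le> b z" "(\<lambda>(z, y). k z y) \<in> borel_measurable borel"
    "\<And>z. continuous_on UNIV (k z)" "\<And>z y i. k z (y + axis i 1) = k z y"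
    "b \<in> borel_measurable borel" "integrable lborel (\<lambda>z. (b z)\<^sup>2)"
    "AE z in lborel. z \<in> S \<longrightarrow> apply_bcontfun (F z) = k z"
proof -
  have FV: "F \<in> S \<rightarrow> C_per" and sm: "strongly_measurable (lebesgue_on S) C_per F"
    using F by (simp_all add: Bochner_L2_def)
  obtain F' where F': "\<And>z. F' z \<in> C_per" "\<And>z. z \<notin> S \<Longrightarrow> F' z = 0"
    "(\<lambda>(z, y). F' z y) \<in> borel_measurable borel" "(\<lambda>z. norm (F' z)) \<in> borel_measurable borel"
    "AE z in lborel. z \<in> S \<longrightarrow> F z = F' z"
    by (rule strongly_measurable_borel_representative[OF S FV zero_in_C_per sm]) blast
  define b where "b z = norm (F' z)" for z
  have b [measurable]: "b \<in> borel_measurable borel" using F'(4) unfolding b_def .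
  have SL: "S \<in> sets lebesgue" using S by simp
  have "(\<integral>\<^sup>+ z. ennreal ((b z)\<^sup>2) \<partial>lborel) = (\<integral>\<^sup>+ z. ennreal ((b z)\<^sup>2) \<partial>lebesgue)"
    by (simp add: nn_integral_completion)
  also have "\<dots> = (\<integral>\<^sup>+ z. ennreal ((norm (F z))\<^sup>2) * indicator S z \<partial>lebesgue)"
  proof (rule nn_integral_cong_AE)
    show "AE z in lebesgue. ennreal ((b z)\<^sup>2) = ennreal ((norm (F z))\<^sup>2) * indicator S z"
      using AE_completion[OF F'(5)] by eventually_elim (auto simp: b_def indicator_def F'(2))
  qed
  also have "\<dots> = (\<integral>\<^sup>+ z. ennreal ((norm (F z))\<^sup>2) \<partial>lebesgue_on S)"
    using SL by (simp add: nn_integral_restrict_space)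
  also have "\<dots> < \<infinity>" using F by (simp add: Bochner_L2_def)
  finally have int: "integrable lborel (\<lambda>z. (b z)\<^sup>2)"
    by (intro integrableI_bounded) auto
  define k where "k z = apply_bcontfun (F' z)" for z
  have kb: "\<bar>k z y\<bar> \<le> b z" for z y
    using C_per_properties(3)[OF F'(1), of z y] by (simp add: k_def b_def)
  have 1: "(\<lambda>(z, y). k z y) \<in> borel_measurable borel"
    using F'(3) unfolding k_def .
  have 2: "AE z in lborel. z \<in> S \<longrightarrow> apply_bcontfun (F z) = k z"
    using F'(5) by eventually_elim (simp add: k_def)
  have kc: "continuous_on UNIV (k z)" for z
    using C_per_properties(1)[OF F'(1), of z] by (simp only: k_def)
  have kp: "k z (y + axis i 1) = k z y" for z y i
    using C_per_properties(2)[OF F'(1), of z y i] by (simp only: k_def)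
  show ?thesis by (rule that[OF kb 1 kc kp b int 2])
qed

section \<open>Continuity of translations in the mean\<close>

lemma integral_lborel_translate:
  fixes f :: "'a::euclidean_space \<Rightarrow> real"
  assumes "f \<in> borel_measurable borel"
  shows "(LINT x|lborel. f (x + h)) = (LINT x|lborel. f x)"
  using integral_distr[of "(+) h" lborel borel f] assms by (simp add: lborel_distr_plus add.commute)

lemma integrable_lborel_translate:
  fixes f :: "'a::euclidean_space \<Rightarrow> real"
  assumes "integrable lborel f"
  shows "integrable lborel (\<lambda>x. f (x + h))"
proof -
  have "integrable (distr lborel borel ((+) h)) f" using assms by (simp add: lborel_distr_plus)
  then have "integrable lborel (\<lambda>x. f (h + x))"
    using assms by (subst (asm) integrable_distr_eq) auto
  then show ?thesis by (simp add: add.commute)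
qed

text \<open>
  Cutting off \<open>A\<close> in size and in space changes it little in the mean. The truncated function is an almost
  everywhere limit of continuous functions, and applying the same cut-offs to these gives a dominated
  sequence.
\<close>
lemma integrable_approx_continuous_bounded_support:
  fixes A :: "'a::euclidean_space \<Rightarrow> real"
  assumes A: "integrable lborel A" and e: "0 < e"
  obtains B R where "continuous_on UNIV B" "\<And>x. \<bar>B x\<bar> \<le> R" "\<And>x. R < norm x \<Longrightarrow> B x = 0"
    "(LINT x|lborel. \<bar>A x - B x\<bar>) < e"
proof -
  have Am [measurable]: "A \<in> borel_measurable borel" using A by simp
  have "A measurable_on UNIV"
    using sets.top[of lebesgue] by (intro lebesgue_measurable_imp_measurable_on) (auto simp: measurable_completion)
  then obtain N g where N: "negligible N" and g: "\<And>n. continuous_on UNIV (g n)"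
      "\<And>x. x \<notin> N \<Longrightarrow> (\<lambda>n. g n x) \<longlonglongrightarrow> A x"
    unfolding measurable_on_def by auto
  \<comment> \<open>truncation of the values at height \<open>m\<close> and a cut-off to the ball of radius \<open>m + 1\<close>\<close>
  define c where "c m x = max (- real m) (min (real m) x)" for m :: nat and x :: real
  define k where "k m x = max 0 (min 1 (real m + 1 - norm x))" for m :: nat and x :: 'a
  have c_meas [measurable]: "c m \<in> borel_measurable borel" for m unfolding c_def by measurable
  have k_meas [measurable]: "k m \<in> borel_measurable borel" for m unfolding k_def by measurable
  have g_meas [measurable]: "g n \<in> borel_measurable borel" for n
    using g(1) by (rule borel_measurable_continuous_onI)
  have k01: "0 \<le> k m x" "k m x \<le> 1" for m x by (auto simp: k_def)
  have ck: "\<bar>c m a * k m x\<bar> \<le> \<bar>a\<bar>" "\<bar>c m a * k m x\<bar> \<le> real m" "real m + 1 < norm x \<Longrightarrow> c m a * k m x = 0" for m a x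
  proof -
    have "\<bar>c m a * k m x\<bar> \<le> \<bar>c m a\<bar>"
      using k01[of m x] by (simp add: abs_mult mult_left_le)
    moreover have "\<bar>c m a\<bar> \<le> \<bar>a\<bar>" "\<bar>c m a\<bar> \<le> real m" by (auto simp: c_def)
    ultimately show "\<bar>c m a * k m x\<bar> \<le> \<bar>a\<bar>" "\<bar>c m a * k m x\<bar> \<le> real m" by auto
    show "real m + 1 < norm x \<Longrightarrow> c m a * k m x = 0" by (simp add: k_def)
  qed
  have "(\<lambda>m. LINT x|lborel. \<bar>A x - c m (A x) * k m x\<bar>) \<longlonglongrightarrow> (LINT x::'a|lborel. 0)"
  proof (rule integral_dominated_convergence[where w = "\<lambda>x. 2 * \<bar>A x\<bar>"])
    show "AE x in lborel. (\<lambda>m. \<bar>A x - c m (A x) * k m x\<bar>) \<longlonglongrightarrow> 0"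
    proof (rule AE_I2, rule tendsto_eventually)
      fix x
      obtain m0 where m0: "\<bar>A x\<bar> + norm x \<le> real m0" using real_arch_simple by blast
      show "\<forall>\<^sub>F m in sequentially. \<bar>A x - c m (A x) * k m x\<bar> = 0"
        using eventually_ge_at_top[of m0]
      proof eventually_elim
        case (elim m)
        then have "\<bar>A x\<bar> + norm x \<le> real m" using m0 by linarith
        then have "\<bar>A x\<bar> \<le> real m" "norm x \<le> real m" using norm_ge_zero[of x] abs_ge_zero[of "A x"] by linarith+
        then have "c m (A x) = A x" "k m x = 1" by (auto simp: c_def k_def)
        then show ?case by simp
      qed
    qed
    show "AE x in lborel. norm \<bar>A x - c m (A x) * k m x\<bar> \<le> 2 * \<bar>A x\<bar>" for m
    proof (rule AE_I2)
      fix x show "norm \<bar>A x - c m (A x) * k m x\<bar> \<le> 2 * \<bar>A x\<bar>" using ck(1)[of m "A x" x] by simp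
    qed
  qed (use A in auto)
  then have "\<forall>\<^sub>F m in sequentially. (LINT x|lborel. \<bar>A x - c m (A x) * k m x\<bar>) < e / 2"
    using e by (intro order_tendstoD) auto
  then obtain m where m: "(LINT x|lborel. \<bar>A x - c m (A x) * k m x\<bar>) < e / 2"
    by (auto simp: eventually_sequentially)
  have mball: "integrable lborel (\<lambda>x::'a. real m * indicator (cball 0 (real m + 1)) x)"
    by (intro integrable_mult_right integrable_real_indicator) (use emeasure_bounded_finite[OF bounded_cball] in \<open>auto simp: less_top\<close>)
  have ckball: "\<bar>c m a * k m x\<bar> \<le> real m * indicator (cball 0 (real m + 1)) x" for a :: real and x :: 'a
    using ck(2)[of m a x] ck(3)[of m x a] by (cases "norm x \<le> real m + 1") (auto simp: indicator_def)
  have int_ck: "integrable lborel (\<lambda>x. c m (f x) * k m x)" if "f \<in> borel_measurable borel" for f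
  proof (rule Bochner_Integration.integrable_bound[OF mball])
    show "AE x in lborel. norm (c m (f x) * k m x) \<le> norm (real m * indicator (cball 0 (real m + 1)) x)"
      using ckball by (intro AE_I2) (simp add: abs_mult)
  qed (use that in measurable)
  have "(\<lambda>n. LINT x|lborel. \<bar>c m (A x) * k m x - c m (g n x) * k m x\<bar>) \<longlonglongrightarrow> (LINT x::'a|lborel. 0)"
  proof (rule integral_dominated_convergence[where w = "\<lambda>x. 2 * (real m * indicator (cball 0 (real m + 1)) x)"])
    have "AE x in lborel. x \<notin> N"
      using N by (metis AE_completion_iff AE_not_in negligible_iff_null_sets)
    then show "AE x in lborel. (\<lambda>n. \<bar>c m (A x) * k m x - c m (g n x) * k m x\<bar>) \<longlonglongrightarrow> 0"
    proof eventually_elim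
      case (elim x)
      have "(\<lambda>n. c m (g n x)) \<longlonglongrightarrow> c m (A x)"
        unfolding c_def by (intro tendsto_intros g(2) elim)
      then have "(\<lambda>n. \<bar>c m (A x) * k m x - c m (g n x) * k m x\<bar>) \<longlonglongrightarrow> \<bar>c m (A x) * k m x - c m (A x) * k m x\<bar>"
        by (intro tendsto_intros)
      then show ?case by simp
    qed
    show "AE x in lborel. norm \<bar>c m (A x) * k m x - c m (g n x) * k m x\<bar>
        \<le> 2 * (real m * indicator (cball 0 (real m + 1)) x)" for n
    proof (rule AE_I2)
      fix x
      show "norm \<bar>c m (A x) * k m x - c m (g n x) * k m x\<bar>
        \<le> 2 * (real m * indicator (cball 0 (real m + 1)) x)"
        using ckball[of "A x" x] ckball[of "g n x" x] unfolding real_norm_def by linarith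
    qed
    show "integrable lborel (\<lambda>x::'a. 2 * (real m * indicator (cball 0 (real m + 1)) x))"
      using mball by (rule integrable_mult_right)
  qed (auto intro!: borel_measurable_abs)
  then have "\<forall>\<^sub>F n in sequentially. (LINT x|lborel. \<bar>c m (A x) * k m x - c m (g n x) * k m x\<bar>) < e / 2"
    using e by (intro order_tendstoD) auto
  then obtain n where n: "(LINT x|lborel. \<bar>c m (A x) * k m x - c m (g n x) * k m x\<bar>) < e / 2"
    by (auto simp: eventually_sequentially)
  show ?thesis
  proof (rule that[of "\<lambda>x. c m (g n x) * k m x" "real m + 1"])
    show "continuous_on UNIV (\<lambda>x. c m (g n x) * k m x)"
      unfolding c_def k_def by (intro continuous_intros g)
    show "\<bar>c m (g n x) * k m x\<bar> \<le> real m + 1" for x using ck(2)[of m "g n x" x] by simp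
    show "c m (g n x) * k m x = 0" if "real m + 1 < norm x" for x using ck(3)[OF that, of "g n x"] .
    have i: "integrable lborel (\<lambda>x. \<bar>A x - c m (A x) * k m x\<bar>)"
        "integrable lborel (\<lambda>x. \<bar>c m (A x) * k m x - c m (g n x) * k m x\<bar>)"
      using A int_ck[of A] int_ck[of "g n"] by auto
    have "(LINT x|lborel. \<bar>A x - c m (g n x) * k m x\<bar>)
        \<le> (LINT x|lborel. \<bar>A x - c m (A x) * k m x\<bar> + \<bar>c m (A x) * k m x - c m (g n x) * k m x\<bar>)"
      using A int_ck[of A] int_ck[of "g n"] i by (intro integral_mono integrable_abs Bochner_Integration.integrable_diff
          Bochner_Integration.integrable_add) auto
    also have "\<dots> = (LINT x|lborel. \<bar>A x - c m (A x) * k m x\<bar>)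
        + (LINT x|lborel. \<bar>c m (A x) * k m x - c m (g n x) * k m x\<bar>)"
      using i by (rule Bochner_Integration.integral_add)
    also have "\<dots> < e" using m n by simp
    finally show "(LINT x|lborel. \<bar>A x - c m (g n x) * k m x\<bar>) < e" .
  qed
qed

text \<open>
  For a continuous function with bounded support this is dominated convergence. The error of the
  approximation enters twice, because translation preserves the integral.
\<close>
lemma L1_translation_continuous:
  fixes A :: "'a::euclidean_space \<Rightarrow> real"
  assumes A: "integrable lborel A" and h: "h \<longlonglongrightarrow> 0"
  shows "(\<lambda>j. LINT x|lborel. \<bar>A (x + h j) - A x\<bar>) \<longlonglongrightarrow> 0"
proof (rule metric_LIMSEQ_I)
  fix e :: real assume e: "0 < e"
  obtain B R where B: "continuous_on UNIV B" "\<And>x. \<bar>B x\<bar> \<le> R" "\<And>x. R < norm x \<Longrightarrow> B x = 0"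
    "(LINT x|lborel. \<bar>A x - B x\<bar>) < e / 4"
    using integrable_approx_continuous_bounded_support[OF A, of "e / 4"] e by auto
  have [measurable]: "A \<in> borel_measurable borel" "B \<in> borel_measurable borel"
    using A B(1) by (auto intro: borel_measurable_continuous_onI)
  have R0: "0 \<le> R" using B(2)[of 0] by linarith
  have ball: "integrable lborel (\<lambda>x::'a. K * indicator (cball 0 r) x)" for K r :: real
    by (intro integrable_mult_right integrable_real_indicator) (use emeasure_bounded_finite[OF bounded_cball] in \<open>auto simp: less_top\<close>)
  have Bi: "integrable lborel B"
  proof (rule Bochner_Integration.integrable_bound[OF ball[of R R]])
    show "AE x in lborel. norm (B x) \<le> norm (R * indicator (cball 0 R) x)"
      using B(2,3) R0 by (intro AE_I2) (force simp: indicator_def)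
  qed measurable
  obtain j0 where j0: "\<And>j. j \<ge> j0 \<Longrightarrow> norm (h j) < 1"
    using LIMSEQ_D[OF h, of 1] by auto
  have "(\<lambda>j. LINT x|lborel. \<bar>B (x + h (j + j0)) - B x\<bar>) \<longlonglongrightarrow> (LINT x::'a|lborel. 0)"
  proof (rule integral_dominated_convergence[where w = "\<lambda>x. 2 * R * indicator (cball 0 (R + 1)) x"])
    show "AE x in lborel. (\<lambda>j. \<bar>B (x + h (j + j0)) - B x\<bar>) \<longlonglongrightarrow> 0"
    proof (rule AE_I2)
      fix x
      have "(\<lambda>j. x + h (j + j0)) \<longlonglongrightarrow> x + 0"
        using LIMSEQ_ignore_initial_segment[OF h] by (intro tendsto_intros) auto
      moreover have "isCont B x" using B(1) by (simp add: continuous_on_eq_continuous_at)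
      ultimately have "(\<lambda>j. B (x + h (j + j0))) \<longlonglongrightarrow> B x"
        by (auto intro: isCont_tendsto_compose)
      then have "(\<lambda>j. \<bar>B (x + h (j + j0)) - B x\<bar>) \<longlonglongrightarrow> \<bar>B x - B x\<bar>" by (intro tendsto_intros)
      then show "(\<lambda>j. \<bar>B (x + h (j + j0)) - B x\<bar>) \<longlonglongrightarrow> 0" by simp
    qed
    show "AE x in lborel. norm \<bar>B (x + h (j + j0)) - B x\<bar> \<le> 2 * R * indicator (cball 0 (R + 1)) x" for j
    proof (rule AE_I2)
      fix x
      show "norm \<bar>B (x + h (j + j0)) - B x\<bar> \<le> 2 * R * indicator (cball 0 (R + 1)) x"
      proof (cases "norm x \<le> R + 1")
        case True
        then show ?thesis using B(2)[of x] B(2)[of "x + h (j + j0)"] by (simp add: indicator_def)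
      next
        case False
        have "norm x \<le> norm (x + h (j + j0)) + norm (h (j + j0))"
          by (metis add_diff_cancel_right' norm_triangle_ineq4)
        then have "R < norm (x + h (j + j0))" using False j0[of "j + j0"] by simp
        then show ?thesis using False B(3) by simp
      qed
    qed
    show "integrable lborel (\<lambda>x::'a. 2 * R * indicator (cball 0 (R + 1)) x)" by (rule ball)
  qed auto
  then have "(\<lambda>j. LINT x|lborel. \<bar>B (x + h j) - B x\<bar>) \<longlonglongrightarrow> 0"
    by (simp add: LIMSEQ_offset)
  then obtain n where n: "\<And>j. j \<ge> n \<Longrightarrow> (LINT x|lborel. \<bar>B (x + h j) - B x\<bar>) < e / 4"
    using order_tendstoD(2)[of _ 0 sequentially "e / 4"] e by (auto simp: eventually_sequentially)
  have "(LINT x|lborel. \<bar>A (x + h j) - A x\<bar>) < e" if j: "j \<ge> n" for j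
  proof -
    have i: "integrable lborel (\<lambda>x. \<bar>A x - B x\<bar>)" "integrable lborel (\<lambda>x. \<bar>A (x + h j) - B (x + h j)\<bar>)"
      "integrable lborel (\<lambda>x. \<bar>B (x + h j) - B x\<bar>)" "integrable lborel (\<lambda>x. \<bar>A (x + h j) - A x\<bar>)"
      using A Bi integrable_lborel_translate[OF A, of "h j"] integrable_lborel_translate[OF Bi, of "h j"] by auto
    have "(LINT x|lborel. \<bar>A (x + h j) - A x\<bar>)
        \<le> (LINT x|lborel. \<bar>A (x + h j) - B (x + h j)\<bar> + (\<bar>B (x + h j) - B x\<bar> + \<bar>A x - B x\<bar>))"
      using i by (intro integral_mono Bochner_Integration.integrable_add) auto
    also have "\<dots> = (LINT x|lborel. \<bar>A (x + h j) - B (x + h j)\<bar>)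
        + ((LINT x|lborel. \<bar>B (x + h j) - B x\<bar>) + (LINT x|lborel. \<bar>A x - B x\<bar>))"
      using i by (simp add: Bochner_Integration.integral_add)
    also have "(LINT x|lborel. \<bar>A (x + h j) - B (x + h j)\<bar>) = (LINT x|lborel. \<bar>A x - B x\<bar>)"
      using integral_lborel_translate[of "\<lambda>x. \<bar>A x - B x\<bar>" "h j"] by simp
    finally show ?thesis using B(4) n[OF j] e by linarith
  qed
  then show "\<exists>n. \<forall>j\<ge>n. dist (LINT x|lborel. \<bar>A (x + h j) - A x\<bar>) 0 < e"
    by (intro exI[of _ n]) (simp add: dist_real_def abs_of_nonneg)
qed

section \<open>Oscillation of a periodic factor\<close>

lemma periodic_add_integer_vector:
  fixes c :: "real ^ 'n \<Rightarrow> 'b"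
  assumes per: "\<And>y i. c (y + axis i 1) = c y" and m: "\<And>i. m $ i \<in> \<int>"
  shows "c (y + m) = c y"
proof -
  have nat: "c (y + real k *\<^sub>R axis i 1) = c y" for k i y
  proof (induction k)
    case (Suc k)
    have eq: "y + real (Suc k) *\<^sub>R axis i 1 = (y + real k *\<^sub>R axis i 1) + axis i 1"
      by (simp add: algebra_simps)
    show ?case unfolding eq per by (rule Suc)
  qed simp
  have int: "c (y + r *\<^sub>R axis i 1) = c y" if r: "r \<in> \<int>" for r i y
  proof (cases "0 \<le> r")
    case True
    with r obtain k where "r = real k" by (metis Ints_cases of_int_0_le_iff of_int_of_nat_eq zero_le_imp_eq_int)
    then show ?thesis using nat by simp
  next
    case False
    with r obtain k where k: "r = - real k"
      by (metis Ints_cases Ints_minus linorder_not_le minus_minus neg_0_le_iff_le of_int_0_le_iff of_int_of_nat_eq order_less_imp_le zero_le_imp_eq_int)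
    have "c y = c ((y + r *\<^sub>R axis i 1) + real k *\<^sub>R axis i 1)" using k by simp
    then show ?thesis using nat by simp
  qed
  have fin: "c (y + (\<Sum>i\<in>I. m $ i *\<^sub>R axis i 1)) = c y" if "finite I" for I
    using that
  proof (induction I)
    case (insert i I)
    have eq: "y + (\<Sum>i\<in>insert i I. m $ i *\<^sub>R axis i 1) = (y + (\<Sum>i\<in>I. m $ i *\<^sub>R axis i 1)) + m $ i *\<^sub>R axis i 1"
      using insert by (simp add: algebra_simps)
    show ?case unfolding eq int[OF m] by (rule insert)
  qed simp
  have "(\<Sum>i\<in>UNIV. m $ i *\<^sub>R axis i 1) = m"
    using basis_expansion[of m] by (simp add: scalar_mult_eq_scaleR)
  then show ?thesis using fin[of UNIV] by simp
qed

text \<open>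
  Unlike \<open>unit_cell\<close>, whose translates by integer vectors miss the faces, this cell tiles the space exactly.
\<close>
definition half_open_cell :: "(real ^ 'n) set" where
  "half_open_cell = {y. \<forall>i. 0 \<le> y $ i \<and> y $ i < 1}"

definition integer_vectors :: "(real ^ 'n) set" where
  "integer_vectors = {m. \<forall>i. m $ i \<in> \<int>}"

lemma countable_integer_vectors: "countable (integer_vectors :: (real ^ 'n) set)"
proof (rule countable_subset)
  show "integer_vectors \<subseteq> range (\<lambda>m :: int ^ 'n. \<chi> i. real_of_int (m $ i))"
  proof
    fix m :: "real ^ 'n" assume "m \<in> integer_vectors"
    then have "m = (\<chi> i. real_of_int ((\<chi> i. \<lfloor>m $ i\<rfloor>) $ i))"
      by (auto simp: integer_vectors_def vec_eq_iff of_int_floor)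
    then show "m \<in> range (\<lambda>m :: int ^ 'n. \<chi> i. real_of_int (m $ i))" by blast
  qed
qed simp

lemma half_open_cell_borel [measurable]: "(half_open_cell :: (real ^ 'n) set) \<in> sets borel"
proof -
  have "Measurable.pred borel (\<lambda>y::real ^ 'n. \<forall>i\<in>UNIV. 0 \<le> y $ i \<and> y $ i < 1)"
    by measurable
  then show ?thesis by (simp add: half_open_cell_def pred_def)
qed

lemma AE_half_open_cell_eq:
  "AE y in lborel. indicator (unit_cell :: (real ^ 'n) set) y = (indicator half_open_cell y :: 'b::zero_neq_one)"
proof -
  have "negligible (cbox 0 1 - box 0 (1 :: real ^ 'n))" by (rule negligible_frontier_interval)
  then have "AE y in lborel. y \<notin> cbox 0 1 - box 0 (1 :: real ^ 'n)"
    by (metis AE_completion_iff AE_not_in negligible_iff_null_sets)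
  then show ?thesis
  proof eventually_elim
    case (elim y)
    have "y \<in> box 0 1 \<longleftrightarrow> y \<in> half_open_cell"
      using elim by (force simp: half_open_cell_def mem_box_cart less_imp_le)
    then show ?case by (simp add: unit_cell_def indicator_def)
  qed
qed

lemma avg_eq_integral_half_open_cell:
  fixes f :: "real ^ 'n \<Rightarrow> real"
  assumes [measurable]: "f \<in> borel_measurable borel"
  shows "avg f = (LINT y|lborel. indicator half_open_cell y * f y)"
proof -
  have [measurable]: "(unit_cell :: (real ^ 'n) set) \<in> sets borel" by (simp add: unit_cell_def)
  have "avg f = (LINT y|lebesgue. indicator unit_cell y *\<^sub>R f y)"
    unfolding avg_def by (rule integral_restrict_space) (simp add: unit_cell_def)
  also have "\<dots> = (LINT y|lborel. indicator unit_cell y *\<^sub>R f y)"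
    by (rule integral_completion) measurable
  also have "\<dots> = (LINT y|lborel. indicator half_open_cell y * f y)"
    using AE_half_open_cell_eq[where 'b = real]
    by (intro Bochner_Integration.integral_cong_AE) (auto elim!: eventually_mono)
  finally show ?thesis .
qed

lemma nn_integral_lborel_translate:
  fixes f :: "'a::euclidean_space \<Rightarrow> ennreal"
  assumes "f \<in> borel_measurable borel"
  shows "(\<integral>\<^sup>+x. f (x + h) \<partial>lborel) = (\<integral>\<^sup>+x. f x \<partial>lborel)"
  using nn_integral_distr[of "(+) h" lborel borel f] assms by (simp add: lborel_distr_plus add.commute)

text \<open>
  Exactly one integer vector, the componentwise floor of \<open>u\<close>, carries \<open>u\<close> into the cell. The sum over all
  integer vectors is written as an integral for the counting measure so that Tonelli applies to it.
\<close>
lemma half_open_cell_tiles: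
  fixes u :: "real ^ 'n"
  shows "(\<integral>\<^sup>+m. indicator half_open_cell (u - m) \<partial>count_space integer_vectors) = 1"
    and "(\<integral>\<^sup>+m. indicator half_open_cell (u + m) \<partial>count_space integer_vectors) = 1"
proof -
  define p :: "real ^ 'n" where "p = (\<chi> i. of_int \<lfloor>u $ i\<rfloor>)"
  have p: "p \<in> integer_vectors" "- p \<in> integer_vectors" by (auto simp: p_def integer_vectors_def)
  have iff: "u - m \<in> half_open_cell \<longleftrightarrow> m = p" if m: "m \<in> integer_vectors" for m
  proof -
    have "0 \<le> u $ i - m $ i \<and> u $ i - m $ i < 1 \<longleftrightarrow> m $ i = of_int \<lfloor>u $ i\<rfloor>" for i
    proof -
      obtain j where "m $ i = of_int j" using m by (auto simp: integer_vectors_def elim: Ints_cases)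
      then show ?thesis by (simp add: algebra_simps) linarith
    qed
    then show ?thesis by (auto simp: half_open_cell_def p_def vec_eq_iff)
  qed
  have "(\<integral>\<^sup>+m. indicator half_open_cell (u - m) \<partial>count_space integer_vectors)
      = (\<integral>\<^sup>+m. indicator {p} m \<partial>count_space integer_vectors)"
    by (rule nn_integral_cong) (auto simp: iff indicator_def)
  then show "(\<integral>\<^sup>+m. indicator half_open_cell (u - m) \<partial>count_space integer_vectors) = 1"
    using p by (simp add: emeasure_count_space_finite)
  have "u + m \<in> half_open_cell \<longleftrightarrow> m = - p" if m: "m \<in> integer_vectors" for m
  proof -
    have "- m \<in> integer_vectors" using m by (simp add: integer_vectors_def)
    from iff[OF this] show ?thesis by (metis diff_minus_eq_add minus_minus)
  qed
  then have "(\<integral>\<^sup>+m. indicator half_open_cell (u + m) \<partial>count_space integer_vectors)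
      = (\<integral>\<^sup>+m. indicator {- p} m \<partial>count_space integer_vectors)"
    by (intro nn_integral_cong) (auto simp: indicator_def)
  then show "(\<integral>\<^sup>+m. indicator half_open_cell (u + m) \<partial>count_space integer_vectors) = 1"
    using p by (simp add: emeasure_count_space_finite)
qed

text \<open>
  The shifted cell is cut along the tiling, and each piece is moved back by its integer vector, which
  leaves \<open>c\<close> unchanged; the pieces tile the original cell.
\<close>
lemma nn_integral_half_open_cell_shift:
  fixes c :: "real ^ 'n \<Rightarrow> ennreal"
  assumes [measurable]: "c \<in> borel_measurable borel" and per: "\<And>y i. c (y + axis i 1) = c y"
  shows "(\<integral>\<^sup>+y. c (y + a) * indicator half_open_cell y \<partial>lborel)
       = (\<integral>\<^sup>+y. c y * indicator half_open_cell y \<partial>lborel)"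
proof -
  let ?Q = "indicator half_open_cell :: real ^ 'n \<Rightarrow> ennreal"
  have "(\<integral>\<^sup>+y. c (y + a) * ?Q y \<partial>lborel) = (\<integral>\<^sup>+z. c z * ?Q (z - a) \<partial>lborel)"
    using nn_integral_lborel_translate[of "\<lambda>z. c z * ?Q (z - a)" a] by simp
  also have "\<dots> = (\<integral>\<^sup>+z. (\<integral>\<^sup>+m. c z * ?Q (z - a) * ?Q (z - m) \<partial>count_space integer_vectors) \<partial>lborel)"
    by (simp add: nn_integral_cmult half_open_cell_tiles)
  also have "\<dots> = (\<integral>\<^sup>+m. (\<integral>\<^sup>+z. c z * ?Q (z - a) * ?Q (z - m) \<partial>lborel) \<partial>count_space integer_vectors)"
    by (rule nn_integral_count_space_nn_integral[OF countable_integer_vectors]) measurable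
  also have "\<dots> = (\<integral>\<^sup>+m. (\<integral>\<^sup>+w. c w * ?Q w * ?Q (w - a + m) \<partial>lborel) \<partial>count_space integer_vectors)"
  proof (rule nn_integral_cong)
    fix m :: "real ^ 'n" assume "m \<in> space (count_space integer_vectors)"
    then have m: "\<And>i. m $ i \<in> \<int>" by (simp add: integer_vectors_def)
    have "(\<integral>\<^sup>+z. c z * ?Q (z - a) * ?Q (z - m) \<partial>lborel)
        = (\<integral>\<^sup>+w. c (w + m) * ?Q (w + m - a) * ?Q (w + m - m) \<partial>lborel)"
      by (rule nn_integral_lborel_translate[symmetric]) measurable
    also have "\<dots> = (\<integral>\<^sup>+w. c w * ?Q w * ?Q (w - a + m) \<partial>lborel)"
      by (intro nn_integral_cong) (simp add: periodic_add_integer_vector[OF per m] algebra_simps)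
    finally show "(\<integral>\<^sup>+z. c z * ?Q (z - a) * ?Q (z - m) \<partial>lborel)
        = (\<integral>\<^sup>+w. c w * ?Q w * ?Q (w - a + m) \<partial>lborel)" .
  qed
  also have "\<dots> = (\<integral>\<^sup>+w. (\<integral>\<^sup>+m. c w * ?Q w * ?Q (w - a + m) \<partial>count_space integer_vectors) \<partial>lborel)"
    by (rule nn_integral_count_space_nn_integral[OF countable_integer_vectors, symmetric]) measurable
  also have "\<dots> = (\<integral>\<^sup>+w. c w * ?Q w \<partial>lborel)"
    by (simp add: nn_integral_cmult half_open_cell_tiles)
  finally show ?thesis .
qed

lemma avg_periodic_shift:
  fixes c :: "real ^ 'n \<Rightarrow> real"
  assumes [measurable]: "c \<in> borel_measurable borel" and B: "\<And>y. \<bar>c y\<bar> \<le> B"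
    and per: "\<And>y i. c (y + axis i 1) = c y"
  shows "avg (\<lambda>y. c (a + y)) = avg c"
proof -
  have int: "integrable cell (\<lambda>y. c (a + y))" "integrable cell c"
    using B by (auto intro!: integrable_cell_bounded[of _ B])
  \<comment> \<open>adding \<open>B\<close> makes the integrand nonnegative\<close>
  have nn: "avg (\<lambda>y. c (a + y) + B) = enn2real (\<integral>\<^sup>+y. ennreal (c (y + a) + B) * indicator half_open_cell y \<partial>lborel)" for a
  proof -
    have "avg (\<lambda>y. c (a + y) + B) = (LINT y|lborel. indicator half_open_cell y * (c (a + y) + B))"
      by (rule avg_eq_integral_half_open_cell) measurable
    also have "\<dots> = enn2real (\<integral>\<^sup>+y. ennreal (indicator half_open_cell y * (c (a + y) + B)) \<partial>lborel)"
    proof (rule integral_eq_nn_integral)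
      show "AE y in lborel. 0 \<le> indicator half_open_cell y * (c (a + y) + B)"
      proof (rule AE_I2)
        fix y show "0 \<le> indicator half_open_cell y * (c (a + y) + B)"
          using B[of "a + y"] by (simp add: indicator_def)
      qed
    qed measurable
    also have "(\<integral>\<^sup>+y. ennreal (indicator half_open_cell y * (c (a + y) + B)) \<partial>lborel)
        = (\<integral>\<^sup>+y. ennreal (c (y + a) + B) * indicator half_open_cell y \<partial>lborel)"
      by (intro nn_integral_cong) (auto simp: indicator_def add.commute)
    finally show ?thesis .
  qed
  have "avg (\<lambda>y. c (a + y) + B) = avg (\<lambda>y. c (0 + y) + B)"
    unfolding nn by (simp add: nn_integral_half_open_cell_shift[of "\<lambda>y. ennreal (c y + B)"] per)
  then show ?thesis
    using int by (simp add: avg_def)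
qed

text \<open>
  Translating \<open>z\<close> by \<open>(0, \<epsilon> y)\<close> leaves the integral unchanged for every \<open>y\<close>, shifts the argument of
  \<open>c\<close> by \<open>y\<close>, and changes \<open>A\<close> by an error that tends to \<open>0\<close> in the mean. Averaged over \<open>y\<close> in the
  cell, the shifted factor \<open>c\<close> becomes the constant \<open>avg c\<close>.
\<close>
lemma oscillating_tensor_limit:
  fixes A :: "real \<times> (real ^ 'n) \<Rightarrow> real" and c :: "real ^ 'n \<Rightarrow> real"
  assumes A: "integrable lborel A"
    and c [measurable]: "c \<in> borel_measurable borel" and B: "\<And>y. \<bar>c y\<bar> \<le> B"
    and per: "\<And>y i. c (y + axis i 1) = c y"
    and \<epsilon>: "\<And>j. 0 < \<epsilon> j" "\<epsilon> \<longlonglongrightarrow> 0"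
  shows "(\<lambda>j. LINT z|lborel. A z * c (snd z /\<^sub>R \<epsilon> j)) \<longlonglongrightarrow> (LINT z|lborel. A z) * avg c"
proof -
  have [measurable]: "A \<in> borel_measurable borel" using A by simp
  have [measurable]: "(\<lambda>z. snd z :: real ^ 'n) \<in> borel_measurable (borel :: (real \<times> (real ^ 'n)) measure)"
    by (intro borel_measurable_continuous_onI continuous_intros)
  have [measurable]: "(\<lambda>y. (0, y)) \<in> borel_measurable (borel :: (real ^ 'n) measure)"
    by (intro borel_measurable_continuous_onI continuous_intros)
  have B0: "0 \<le> B" using B[of 0] by linarith
  \<comment> \<open>the error in the mean caused by the translation\<close>
  define D where "D j y = (LINT z|lborel. \<bar>A (z + (0, \<epsilon> j *\<^sub>R y)) - A z\<bar>)" for j y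
  have D_int: "integrable lborel (\<lambda>z. A (z + (0, \<epsilon> j *\<^sub>R y)) - A z)" for j y
    using integrable_lborel_translate[OF A] A by simp
  have D0: "0 \<le> D j y" for j y unfolding D_def by (rule integral_nonneg_AE) simp
  have D_bound: "\<bar>D j y\<bar> \<le> 2 * (LINT z|lborel. \<bar>A z\<bar>)" for j y
  proof -
    have "D j y \<le> (LINT z|lborel. \<bar>A (z + (0, \<epsilon> j *\<^sub>R y))\<bar> + \<bar>A z\<bar>)"
      unfolding D_def using D_int[of j y] integrable_lborel_translate[OF A] A
      by (intro integral_mono integrable_abs Bochner_Integration.integrable_add) auto
    also have "\<dots> = (LINT z|lborel. \<bar>A (z + (0, \<epsilon> j *\<^sub>R y))\<bar>) + (LINT z|lborel. \<bar>A z\<bar>)"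
      using integrable_lborel_translate[OF A] A by (intro Bochner_Integration.integral_add) auto
    also have "(LINT z|lborel. \<bar>A (z + (0, \<epsilon> j *\<^sub>R y))\<bar>) = (LINT z|lborel. \<bar>A z\<bar>)"
      by (rule integral_lborel_translate[of "\<lambda>z. \<bar>A z\<bar>"]) measurable
    finally show ?thesis using D0[of j y] by simp
  qed
  have D_meas: "D j \<in> borel_measurable borel" for j
  proof -
    have "(\<lambda>(y, z). \<bar>A (z + (0, \<epsilon> j *\<^sub>R y)) - A z\<bar>) \<in> borel_measurable (borel \<Otimes>\<^sub>M lborel)"
      by measurable
    then show ?thesis unfolding D_def by (rule lborel.borel_measurable_lebesgue_integral)
  qed
  have D_cell: "integrable cell (D j)" for j
    by (rule integrable_cell_bounded[OF D_meas D_bound])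
  have "(\<lambda>j. LINT y|cell. D j y) \<longlonglongrightarrow> (LINT y::real ^ 'n|cell. 0)"
  proof (rule integral_dominated_convergence[where w = "\<lambda>y. 2 * (LINT z|lborel. \<bar>A z\<bar>)"])
    show "AE y in cell. (\<lambda>j. D j y) \<longlonglongrightarrow> 0"
    proof (rule AE_I2)
      fix y :: "real ^ 'n"
      have "(\<lambda>j. (0 :: real, \<epsilon> j *\<^sub>R y)) \<longlonglongrightarrow> (0, 0 *\<^sub>R y)"
        by (intro tendsto_intros \<epsilon>)
      then have "(\<lambda>j. (0 :: real, \<epsilon> j *\<^sub>R y)) \<longlonglongrightarrow> 0" by (simp add: zero_prod_def)
      then show "(\<lambda>j. D j y) \<longlonglongrightarrow> 0" unfolding D_def by (rule L1_translation_continuous[OF A])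
    qed
    show "AE y in cell. norm (D j y) \<le> 2 * (LINT z|lborel. \<bar>A z\<bar>)" for j
      using D_bound by (intro AE_I2) simp
    show "D j \<in> borel_measurable cell" for j using D_meas by (rule borel_measurable_cell)
  qed auto
  then have avgD: "(\<lambda>j. avg (D j)) \<longlonglongrightarrow> 0" by (simp add: avg_def)
  have main: "\<bar>(LINT z|lborel. A z * c (snd z /\<^sub>R \<epsilon> j)) - (LINT z|lborel. A z) * avg c\<bar> \<le> B * avg (D j)" for j
  proof -
    let ?I = "LINT z|lborel. A z * c (snd z /\<^sub>R \<epsilon> j)"
    define J where "J y = (LINT z|lborel. A z * c (snd z /\<^sub>R \<epsilon> j + y))" for y
    have bm: "integrable lborel (\<lambda>z. f z * c (g z))" if "integrable lborel f" "g \<in> borel_measurable borel"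
      for f :: "real \<times> (real ^ 'n) \<Rightarrow> real" and g
    proof (rule Bochner_Integration.integrable_bound)
      show "integrable lborel (\<lambda>z. B * f z)" using that by simp
      show "(\<lambda>z. f z * c (g z)) \<in> borel_measurable lborel" using that by measurable
      show "AE z in lborel. norm (f z * c (g z)) \<le> norm (B * f z)"
        using B B0 by (auto simp: abs_mult mult.commute[of _ "\<bar>c _\<bar>"] intro!: mult_right_mono)
    qed
    have I: "?I = (LINT z|lborel. A (z + (0, \<epsilon> j *\<^sub>R y)) * c (snd z /\<^sub>R \<epsilon> j + y))" for y
    proof -
      have "?I = (LINT z|lborel. A (z + (0, \<epsilon> j *\<^sub>R y)) * c (snd (z + (0, \<epsilon> j *\<^sub>R y)) /\<^sub>R \<epsilon> j))"
        by (rule integral_lborel_translate[symmetric]) measurable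
      moreover have "snd (z + (0, \<epsilon> j *\<^sub>R y)) /\<^sub>R \<epsilon> j = snd z /\<^sub>R \<epsilon> j + y" for z :: "real \<times> (real ^ 'n)"
        using \<epsilon>(1)[of j] by (simp add: scaleR_add_right)
      ultimately show ?thesis by simp
    qed
    have IJ: "\<bar>?I - J y\<bar> \<le> B * D j y" for y
    proof -
      have i1: "integrable lborel (\<lambda>z. A (z + (0, \<epsilon> j *\<^sub>R y)) * c (snd z /\<^sub>R \<epsilon> j + y))"
        by (rule bm[OF integrable_lborel_translate[OF A]]) measurable
      have i2: "integrable lborel (\<lambda>z. A z * c (snd z /\<^sub>R \<epsilon> j + y))"
        by (rule bm[OF A]) measurable
      have "?I - J y = (LINT z|lborel. (A (z + (0, \<epsilon> j *\<^sub>R y)) - A z) * c (snd z /\<^sub>R \<epsilon> j + y))"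
        unfolding I[of y] J_def using i1 i2 by (simp add: left_diff_distrib)
      also have "\<bar>\<dots>\<bar> \<le> (LINT z|lborel. \<bar>(A (z + (0, \<epsilon> j *\<^sub>R y)) - A z) * c (snd z /\<^sub>R \<epsilon> j + y)\<bar>)"
        by (rule integral_abs_bound)
      also have "\<dots> \<le> (LINT z|lborel. B * \<bar>A (z + (0, \<epsilon> j *\<^sub>R y)) - A z\<bar>)"
      proof (rule integral_mono)
        show "integrable lborel (\<lambda>z. \<bar>(A (z + (0, \<epsilon> j *\<^sub>R y)) - A z) * c (snd z /\<^sub>R \<epsilon> j + y)\<bar>)"
          by (rule integrable_abs, rule bm[OF D_int]) measurable
        show "integrable lborel (\<lambda>z. B * \<bar>A (z + (0, \<epsilon> j *\<^sub>R y)) - A z\<bar>)"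
          using D_int[of j y] by simp
        show "\<bar>(A (z + (0, \<epsilon> j *\<^sub>R y)) - A z) * c (snd z /\<^sub>R \<epsilon> j + y)\<bar> \<le> B * \<bar>A (z + (0, \<epsilon> j *\<^sub>R y)) - A z\<bar>" for z
          unfolding abs_mult using B by (subst mult.commute) (intro mult_right_mono, auto)
      qed
      finally show ?thesis by (simp add: D_def)
    qed
    have J_bound: "\<bar>J y\<bar> \<le> \<bar>?I\<bar> + B * (2 * (LINT z|lborel. \<bar>A z\<bar>))" for y
    proof -
      have "B * D j y \<le> B * (2 * (LINT z|lborel. \<bar>A z\<bar>))"
        using D_bound[of j y] B0 by (intro mult_left_mono) auto
      then show ?thesis using IJ[of y] by linarith
    qed
    have J_meas: "J \<in> borel_measurable borel"
    proof -
      have "(\<lambda>(y, z). A z * c (snd z /\<^sub>R \<epsilon> j + y)) \<in> borel_measurable (borel \<Otimes>\<^sub>M lborel)"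
        by measurable
      then show ?thesis unfolding J_def by (rule lborel.borel_measurable_lebesgue_integral)
    qed
    have J_cell: "integrable cell J" by (rule integrable_cell_bounded[OF J_meas J_bound])
    have "avg J = (LINT z|lborel. A z) * avg c"
    proof -
      let ?f = "\<lambda>z y. A z * c (snd z /\<^sub>R \<epsilon> j + y)"
      have "(\<lambda>(z, y). ?f z y) \<in> borel_measurable (borel \<Otimes>\<^sub>M borel)" by measurable
      then have "(\<lambda>(z, y). ?f z y) \<in> borel_measurable (borel \<Otimes>\<^sub>M cell)"
        unfolding borel_prod by (rule borel_measurable_pair_cell)
      then have fm: "(\<lambda>(z, y). ?f z y) \<in> borel_measurable (lborel \<Otimes>\<^sub>M cell)"
        by (simp cong: measurable_cong_sets)
      have fb: "\<bar>?f z y\<bar> \<le> \<bar>A z\<bar> * B" for z y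
        unfolding abs_mult using B by (intro mult_left_mono) auto
      have fi: "integrable cell (?f z)" for z
        by (rule integrable_cell_bounded[OF _ fb]) measurable
      have "integrable (lborel \<Otimes>\<^sub>M cell) (\<lambda>(z, y). ?f z y)"
      proof (rule lborel_cell.Fubini_integrable[OF fm])
        have m1: "(\<lambda>z. LINT y|cell. norm (?f z y)) \<in> borel_measurable lborel"
          using fm by (intro cell.borel_measurable_lebesgue_integral) (simp add: split_beta')
        have b1: "\<bar>LINT y|cell. norm (?f z y)\<bar> \<le> \<bar>A z\<bar> * B" for z
          using abs_avg_le_bound[of "\<lambda>y. norm (?f z y)" "\<bar>A z\<bar> * B"] fb[of z] by (simp add: avg_def)
        show "integrable lborel (\<lambda>z. LINT y|cell. norm (case (z, y) of (z, y) \<Rightarrow> ?f z y))"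
          unfolding prod.case
        proof (rule Bochner_Integration.integrable_bound[OF _ m1])
          show "integrable lborel (\<lambda>z. \<bar>A z\<bar> * B)" using A by simp
          show "AE z in lborel. norm (LINT y|cell. norm (?f z y)) \<le> norm (\<bar>A z\<bar> * B)"
            using b1 abs_ge_self order_trans unfolding real_norm_def by (intro AE_I2) blast
        qed
        show "AE z in lborel. integrable cell (\<lambda>y. case (z, y) of (z, y) \<Rightarrow> ?f z y)"
          unfolding prod.case using fi by (rule AE_I2)
      qed
      from lborel_cell.Fubini_integral[OF this]
      have "avg J = (LINT z|lborel. LINT y|cell. ?f z y)" by (simp add: avg_def J_def)
      also have "\<dots> = (LINT z|lborel. A z * avg c)"
        using avg_periodic_shift[OF c B per] by (simp add: avg_def)
      finally show ?thesis by simp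
    qed
    then have "?I - (LINT z|lborel. A z) * avg c = avg (\<lambda>y. ?I - J y)"
      using J_cell by (simp add: avg_def)
    also have "\<bar>\<dots>\<bar> \<le> avg (\<lambda>y. \<bar>?I - J y\<bar>)"
      unfolding avg_def by (rule integral_abs_bound)
    also have "\<dots> \<le> avg (\<lambda>y. B * D j y)"
      unfolding avg_def using J_cell D_cell IJ by (intro integral_mono) auto
    also have "\<dots> = B * avg (D j)" by (simp add: avg_def)
    finally show ?thesis .
  qed
  have "(\<lambda>j. B * avg (D j)) \<longlonglongrightarrow> B * 0" by (intro tendsto_intros avgD)
  then have "(\<lambda>j. B * avg (D j)) \<longlonglongrightarrow> 0" by simp
  then have "(\<lambda>j. (LINT z|lborel. A z * c (snd z /\<^sub>R \<epsilon> j)) - (LINT z|lborel. A z) * avg c) \<longlonglongrightarrow> 0"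
    by (rule Lim_null_comparison[rotated]) (use main in \<open>auto intro: always_eventually\<close>)
  then show ?thesis by (simp add: LIM_zero_iff)
qed

section \<open>Two-scale limits\<close>

text \<open>
  Any two points at distance less than 1 can be moved by a common integer vector into a fixed cube, where
  compactness applies.
\<close>
lemma periodic_continuous_imp_uniformly_continuous:
  fixes c :: "real ^ 'n \<Rightarrow> real"
  assumes cont: "continuous_on UNIV c" and per: "\<And>y i. c (y + axis i 1) = c y" and e: "0 < e"
  shows "\<exists>d>0. \<forall>y y'. dist y y' < d \<longrightarrow> \<bar>c y - c y'\<bar> < e"
proof -
  let ?K = "cbox (\<chi> i. - 1) (\<chi> i. 2) :: (real ^ 'n) set"
  have "uniformly_continuous_on ?K c"
    by (intro compact_uniformly_continuous continuous_on_subset[OF cont]) auto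
  then obtain d where d: "0 < d" "\<And>y y'. y \<in> ?K \<Longrightarrow> y' \<in> ?K \<Longrightarrow> dist y' y < d \<Longrightarrow> dist (c y') (c y) < e"
    using e unfolding uniformly_continuous_on_def by metis
  have "\<bar>c y - c y'\<bar> < e" if yy: "dist y y' < min d 1" for y y'
  proof -
    define m :: "real ^ 'n" where "m = (\<chi> i. of_int \<lfloor>y $ i\<rfloor>)"
    have m: "m $ i \<in> \<int>" for i by (simp add: m_def)
    have "0 \<le> (y - m) $ i" "(y - m) $ i < 1" for i by (simp_all add: m_def) linarith+
    moreover have "\<bar>(y' - m) $ i - (y - m) $ i\<bar> < 1" for i
      using component_le_norm_cart[of "y - y'" i] yy by (simp add: dist_norm abs_minus_commute)
    ultimately have "0 \<le> (y - m) $ i \<and> (y - m) $ i < 1 \<and> - 1 \<le> (y' - m) $ i \<and> (y' - m) $ i \<le> 2" for i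
      by (smt (verit))
    then have "y - m \<in> ?K" "y' - m \<in> ?K"
      unfolding mem_box_cart vec_lambda_beta by (smt (verit))+
    then have "dist (c (y - m)) (c (y' - m)) < e"
      using yy by (intro d(2)) (auto simp: dist_norm)
    then show ?thesis
      using periodic_add_integer_vector[OF per m, of "y - m"] periodic_add_integer_vector[OF per m, of "y' - m"]
      by (simp add: dist_real_def)
  qed
  then show ?thesis using d(1) by (intro exI[of _ "min d 1"]) auto
qed

definition grid_point :: "nat \<Rightarrow> real ^ 'n \<Rightarrow> real ^ 'n" where
  "grid_point N y = (\<chi> i. of_int \<lfloor>real N * y $ i\<rfloor> / real N)"

text \<open>
  The grid points with spacing \<open>1 / N\<close> modulo integer vectors.
\<close>
definition grid_cells :: "nat \<Rightarrow> (int ^ 'n) set" where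
  "grid_cells N = {q. \<forall>i. 0 \<le> q $ i \<and> q $ i < int N}"

text \<open>
  The indicator of the union of all integer translates of one grid cell; it is periodic by the reduction
  modulo \<open>N\<close>.
\<close>
definition in_grid_cell :: "nat \<Rightarrow> int ^ 'n \<Rightarrow> real ^ 'n \<Rightarrow> real" where
  "in_grid_cell N q y = (if \<forall>i. \<lfloor>real N * y $ i\<rfloor> mod int N = q $ i then 1 else 0)"

lemma finite_grid_cells: "finite (grid_cells N :: (int ^ 'n) set)"
proof (rule finite_subset)
  show "(grid_cells N :: (int ^ 'n) set) \<subseteq> vec_lambda ` (PiE UNIV (\<lambda>_. {0..<int N}))"
  proof
    fix q :: "int ^ 'n" assume "q \<in> grid_cells N"
    then have "vec_nth q \<in> PiE UNIV (\<lambda>_. {0..<int N})" by (auto simp: grid_cells_def)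
    then show "q \<in> vec_lambda ` (PiE UNIV (\<lambda>_. {0..<int N}))"
      by (intro image_eqI[of _ _ "vec_nth q"]) auto
  qed
qed (intro finite_imageI finite_PiE; simp)

lemma in_grid_cell_measurable:
  fixes q :: "int ^ 'n"
  shows "in_grid_cell N q \<in> borel_measurable borel"
proof -
  have "Measurable.pred borel (\<lambda>y::real ^ 'n. \<forall>i\<in>UNIV. \<lfloor>real N * y $ i\<rfloor> mod int N = q $ i)"
    by measurable
  then show ?thesis unfolding in_grid_cell_def by simp
qed

lemma in_grid_cell_periodic: "in_grid_cell N q (y + axis i 1) = in_grid_cell N q y"
proof -
  have "\<lfloor>real N * (y + axis i 1) $ k\<rfloor> mod int N = \<lfloor>real N * y $ k\<rfloor> mod int N" for k
  proof (cases "k = i")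
    case True
    have "real N * (y + axis i 1) $ k = real N * y $ k + of_int (int N)"
      using True by (simp add: axis_def algebra_simps)
    then have "\<lfloor>real N * (y + axis i 1) $ k\<rfloor> = \<lfloor>real N * y $ k\<rfloor> + int N" by (simp only: floor_add_int)
    then show ?thesis by simp
  qed (simp add: axis_def)
  then show ?thesis by (simp add: in_grid_cell_def)
qed

lemma dist_grid_point:
  fixes y :: "real ^ 'n"
  assumes N: "0 < N"
  shows "dist y (grid_point N y) \<le> real CARD('n) / real N"
proof -
  have "\<bar>(y - grid_point N y) $ i\<bar> \<le> 1 / real N" for i
  proof -
    have "of_int \<lfloor>real N * y $ i\<rfloor> \<le> real N * y $ i" "real N * y $ i < of_int \<lfloor>real N * y $ i\<rfloor> + 1"
      by linarith+
    then have "\<bar>real N * y $ i - of_int \<lfloor>real N * y $ i\<rfloor>\<bar> \<le> 1" by linarith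
    moreover have "(y - grid_point N y) $ i = (real N * y $ i - of_int \<lfloor>real N * y $ i\<rfloor>) / real N"
      using N by (simp add: grid_point_def field_simps)
    ultimately show ?thesis using N by (simp add: abs_divide divide_right_mono)
  qed
  then have "(\<Sum>i\<in>UNIV. \<bar>(y - grid_point N y) $ i\<bar>) \<le> (\<Sum>i\<in>(UNIV :: 'n set). 1 / real N)"
    by (intro sum_mono)
  also have "\<dots> = real CARD('n) / real N" by simp
  finally show ?thesis
    using norm_le_l1_cart[of "y - grid_point N y"] by (simp add: dist_norm)
qed

lemma periodic_grid_point_eq_sum:
  fixes c :: "real ^ 'n \<Rightarrow> real"
  assumes N: "0 < N" and per: "\<And>y i. c (y + axis i 1) = c y"
  shows "c (grid_point N y) = (\<Sum>q\<in>grid_cells N. c (\<chi> i. of_int (q $ i) / real N) * in_grid_cell N q y)"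
proof -
  define q0 :: "int ^ 'n" where "q0 = (\<chi> i. \<lfloor>real N * y $ i\<rfloor> mod int N)"
  define m :: "real ^ 'n" where "m = (\<chi> i. of_int (\<lfloor>real N * y $ i\<rfloor> div int N))"
  have q0: "q0 \<in> grid_cells N" using N by (simp add: q0_def grid_cells_def)
  have "in_grid_cell N q y = (if q = q0 then 1 else 0)" for q
    by (auto simp: in_grid_cell_def q0_def vec_eq_iff)
  then have "(\<Sum>q\<in>grid_cells N. c (\<chi> i. of_int (q $ i) / real N) * in_grid_cell N q y)
      = (\<Sum>q\<in>grid_cells N. if q = q0 then c (\<chi> i. of_int (q $ i) / real N) else 0)"
    by (intro sum.cong) auto
  also have "\<dots> = c (\<chi> i. of_int (q0 $ i) / real N)"
    by (subst sum.delta[OF finite_grid_cells]) (simp add: q0)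
  finally have sum: "(\<Sum>q\<in>grid_cells N. c (\<chi> i. of_int (q $ i) / real N) * in_grid_cell N q y)
      = c (\<chi> i. of_int (q0 $ i) / real N)" .
  have gp: "grid_point N y = (\<chi> i. of_int (q0 $ i) / real N) + m"
  proof -
    have eq: "of_int j / real N = of_int (j mod int N) / real N + of_int (j div int N)" for j
    proof -
      have "real_of_int j = of_int (j mod int N) + of_int (int N) * of_int (j div int N)"
        by (metis add.commute mult_div_mod_eq of_int_add of_int_mult)
      then show ?thesis using N by (simp add: field_simps)
    qed
    show ?thesis
      unfolding grid_point_def q0_def m_def vec_eq_iff vector_add_component vec_lambda_beta
      by (intro allI eq)
  qed
  have "m $ i \<in> \<int>" for i by (simp only: m_def vec_lambda_beta Ints_of_int)
  then have "c ((\<chi> i. of_int (q0 $ i) / real N) + m) = c (\<chi> i. of_int (q0 $ i) / real N)"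
    by (rule periodic_add_integer_vector[OF per])
  then show ?thesis by (simp only: sum gp)
qed

text \<open>
  Freezing \<open>y\<close> at the corner of its grid cell replaces \<open>k\<close> by a finite sum of products, for which the
  limit is known. The error is controlled, uniformly in \<open>\<epsilon>\<close>, by the integral of the modulus of continuity
  of \<open>k z\<close> at the scale of the grid, which tends to \<open>0\<close> by dominated convergence.
\<close>
theorem two_scale_limit:
  fixes k :: "real \<times> (real ^ 'n) \<Rightarrow> real ^ 'n \<Rightarrow> real"
  assumes k_meas: "(\<lambda>(z, y). k z y) \<in> borel_measurable borel"
    and cont: "\<And>z. continuous_on UNIV (k z)" and per: "\<And>z y i. k z (y + axis i 1) = k z y"
    and b: "integrable lborel b" and kb: "\<And>z y. \<bar>k z y\<bar> \<le> b z"
    and \<epsilon>: "\<And>j. 0 < \<epsilon> j" "\<epsilon> \<longlonglongrightarrow> 0"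
  shows "(\<lambda>j. LINT z|lborel. k z (snd z /\<^sub>R \<epsilon> j)) \<longlonglongrightarrow> (LINT z|lborel. avg (k z))"
proof -
  have [measurable]: "(\<lambda>(z, y). k z y) \<in> borel_measurable (borel \<Otimes>\<^sub>M borel)"
    using k_meas by (simp only: borel_prod)
  have snd_meas [measurable]: "(\<lambda>z. snd z :: real ^ 'n) \<in> borel_measurable (borel :: (real \<times> (real ^ 'n)) measure)"
    by (intro borel_measurable_continuous_onI continuous_intros)
  have sec [measurable]: "(\<lambda>z. k z y) \<in> borel_measurable borel" for y by measurable
  have sec' [measurable]: "k z \<in> borel_measurable borel" for z
    using cont by (rule borel_measurable_continuous_onI)
  have bound: "integrable lborel f" if "f \<in> borel_measurable borel" "\<And>z. \<bar>f z\<bar> \<le> C * b z"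
    for f :: "real \<times> (real ^ 'n) \<Rightarrow> real" and C
  proof (rule Bochner_Integration.integrable_bound)
    show "integrable lborel (\<lambda>z. C * b z)" using b by simp
    show "AE z in lborel. norm (f z) \<le> norm (C * b z)"
      using that(2) by (intro AE_I2) (metis abs_ge_self order_trans real_norm_def)
  qed (use that in simp)
  \<comment> \<open>strictly larger than the distance of a point to its grid point, so \<open>P N\<close> contains the pair of the two\<close>
  let ?d = "\<lambda>N. (real CARD('n) + 1) / real N"
  define P where "P N = {p :: (real ^ 'n) \<times> (real ^ 'n). dist (fst p) (snd p) < ?d N}" for N
  have "\<exists>C. countable C \<and> C \<subseteq> P N \<and> P N \<subseteq> closure C" for N using separable[of "P N"] by metis
  then obtain Q where Q: "\<And>N. countable (Q N)" "\<And>N. Q N \<subseteq> P N" "\<And>N. P N \<subseteq> closure (Q N)" by metis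
  have Q_ne: "Q N \<noteq> {}" if "0 < N" for N
  proof -
    have "(0, 0) \<in> P N" using that by (simp add: P_def)
    then show ?thesis using Q(3)[of N] by auto
  qed
  \<comment> \<open>a modulus of continuity at scale \<open>1 / N\<close>; the countable index set makes it measurable in \<open>z\<close>\<close>
  define w where "w N z = (SUP p\<in>Q N. \<bar>k z (fst p) - k z (snd p)\<bar>)" for N z
  have two: "\<bar>k z y - k z y'\<bar> \<le> 2 * b z" for z y y' using kb[of z y] kb[of z y'] by linarith
  have bdd: "bdd_above ((\<lambda>p. \<bar>k z (fst p) - k z (snd p)\<bar>) ` Q N)" for z N
    using two by (intro bdd_aboveI2)
  have w_meas [measurable]: "w N \<in> borel_measurable borel" for N
    unfolding w_def by (rule borel_measurable_cSUP[OF Q(1)]) (use bdd in auto)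
  have w_le: "w N z \<le> 2 * b z" if "0 < N" for N z
    unfolding w_def by (rule cSUP_least[OF Q_ne[OF that] two])
  have w_ge: "\<bar>k z y - k z y'\<bar> \<le> w N z" if "dist y y' < ?d N" for N z y y'
  proof -
    have "(y, y') \<in> closure (Q N)" using that Q(3)[of N] by (auto simp: P_def)
    then obtain p where p: "\<And>n. p n \<in> Q N" "p \<longlonglongrightarrow> (y, y')" by (auto simp: closure_sequential)
    have c: "isCont (k z) y" for y using cont[of z] by (simp add: continuous_on_eq_continuous_at)
    have "(\<lambda>n. k z (fst (p n))) \<longlonglongrightarrow> k z y" "(\<lambda>n. k z (snd (p n))) \<longlonglongrightarrow> k z y'"
      using tendsto_fst[OF p(2)] tendsto_snd[OF p(2)] by (auto intro: isCont_tendsto_compose[OF c])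
    then have "(\<lambda>n. \<bar>k z (fst (p n)) - k z (snd (p n))\<bar>) \<longlonglongrightarrow> \<bar>k z y - k z y'\<bar>"
      by (intro tendsto_intros)
    moreover have "\<bar>k z (fst (p n)) - k z (snd (p n))\<bar> \<le> w N z" for n
      unfolding w_def by (rule cSUP_upper[OF p(1) bdd])
    ultimately show ?thesis by (intro LIMSEQ_le_const2) auto
  qed
  have w0: "0 \<le> w N z" if "0 < N" for N z
    using w_ge[of 0 0 N z] that by simp
  have w_abs: "\<bar>w N z\<bar> \<le> 2 * b z" if "0 < N" for N z
    using w0[OF that, of z] w_le[OF that, of z] by simp
  have w_int: "integrable lborel (w N)" if "0 < N" for N
    by (rule bound[OF w_meas w_abs[OF that]])
  have w_lim: "(\<lambda>N. w (Suc N) z) \<longlonglongrightarrow> 0" for z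
  proof (rule metric_LIMSEQ_I)
    fix e :: real assume "0 < e"
    then have "0 < e / 2" by simp
    from periodic_continuous_imp_uniformly_continuous[OF cont per this]
    obtain d where d: "0 < d" "\<And>y y'. dist y y' < d \<Longrightarrow> \<bar>k z y - k z y'\<bar> < e / 2" by blast
    have "?d \<longlonglongrightarrow> 0" by (rule lim_const_over_n)
    then obtain N0 where N0: "\<And>N. N \<ge> N0 \<Longrightarrow> ?d N < d"
      using order_tendstoD(2)[of ?d 0 sequentially d] d(1) by (auto simp: eventually_sequentially)
    have "w (Suc N) z \<le> e / 2" if "N \<ge> N0" for N
      unfolding w_def
    proof (rule cSUP_least[OF Q_ne])
      fix p assume "p \<in> Q (Suc N)"
      then have "p \<in> P (Suc N)" using Q(2) by blast
      then have "dist (fst p) (snd p) < ?d (Suc N)" by (simp only: P_def mem_Collect_eq)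
      also have "\<dots> < d" by (rule N0) (use that in simp)
      finally show "\<bar>k z (fst p) - k z (snd p)\<bar> \<le> e / 2" using d(2) less_imp_le by blast
    qed simp
    then have "dist (w (Suc N) z) 0 < e" if "N \<ge> N0" for N
      using w0[of "Suc N" z] that \<open>0 < e\<close> by (force simp: dist_real_def)
    then show "\<exists>N0. \<forall>N\<ge>N0. dist (w (Suc N) z) 0 < e" by blast
  qed
  have "(\<lambda>N. LINT z|lborel. w (Suc N) z) \<longlonglongrightarrow> (LINT z::real \<times> (real ^ 'n)|lborel. 0)"
    by (rule integral_dominated_convergence[where w = "\<lambda>z. 2 * b z"])
      (use b w_lim w_abs in auto)
  then have W: "(\<lambda>N. LINT z|lborel. w (Suc N) z) \<longlonglongrightarrow> 0" by simp
  let ?X = "\<lambda>j. LINT z|lborel. k z (snd z /\<^sub>R \<epsilon> j)" and ?L = "LINT z|lborel. avg (k z)"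
  have X_meas [measurable]: "(\<lambda>z. k z (snd z /\<^sub>R \<epsilon> j)) \<in> borel_measurable borel" for j by measurable
  have X_int: "integrable lborel (\<lambda>z. k z (snd z /\<^sub>R \<epsilon> j))" for j
    by (rule bound[OF X_meas, of _ 1]) (simp add: kb)
  have L_meas: "(\<lambda>z. avg (k z)) \<in> borel_measurable borel"
    by (rule borel_measurable_avg[OF k_meas])
  have L_int: "integrable lborel (\<lambda>z. avg (k z))"
    by (rule bound[OF L_meas, of 1]) (use abs_avg_le_bound[OF kb] in simp)
  show ?thesis
  proof (rule metric_LIMSEQ_I)
    fix e :: real assume e: "0 < e"
    then obtain N' where N': "(LINT z|lborel. w (Suc N') z) < e / 3"
      using order_tendstoD(2)[OF W, of "e / 3"] by (auto simp: eventually_sequentially)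
    define N where "N = Suc N'"
    have N: "0 < N" by (simp add: N_def)
    have gp: "\<bar>k z y - k z (grid_point N y)\<bar> \<le> w N z" for z y
    proof (rule w_ge)
      have "real CARD('n) / real N < ?d N" using N by (simp add: divide_strict_right_mono)
      then show "dist y (grid_point N y) < ?d N" using dist_grid_point[OF N, of y] by linarith
    qed
    define a where "a q z = k z (\<chi> i. of_int (q $ i) / real N)" for q :: "int ^ 'n" and z
    have a_meas: "a q \<in> borel_measurable borel" for q unfolding a_def by (rule sec)
    have a_int: "integrable lborel (a q)" for q
      by (rule bound[OF a_meas, of _ 1]) (simp add: kb a_def)
    have grid: "k z (grid_point N y) = (\<Sum>q\<in>grid_cells N. a q z * in_grid_cell N q y)" for z y
      unfolding a_def by (rule periodic_grid_point_eq_sum[OF N per])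
    have c01: "\<bar>in_grid_cell N q y\<bar> \<le> 1" for q :: "int ^ 'n" and y by (simp add: in_grid_cell_def)
    note c_meas [measurable] = in_grid_cell_measurable
    have ac_int: "integrable lborel (\<lambda>z. a q z * in_grid_cell N q (snd z /\<^sub>R \<epsilon> j))" for q j
    proof (rule bound[of _ 1])
      show "(\<lambda>z. a q z * in_grid_cell N q (snd z /\<^sub>R \<epsilon> j)) \<in> borel_measurable borel"
        using a_meas[of q] by measurable
      show "\<bar>a q z * in_grid_cell N q (snd z /\<^sub>R \<epsilon> j)\<bar> \<le> 1 * b z" for z
        using mult_mono[OF kb[of z "\<chi> i. of_int (q $ i) / real N"] c01[of q "snd z /\<^sub>R \<epsilon> j"]
            order_trans[OF abs_ge_zero kb] abs_ge_zero]
        by (simp add: abs_mult a_def)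
    qed
    define XN where "XN j = (LINT z|lborel. k z (grid_point N (snd z /\<^sub>R \<epsilon> j)))" for j
    define LN where "LN = (LINT z|lborel. avg (\<lambda>y. k z (grid_point N y)))"
    have XN: "XN j = (\<Sum>q\<in>grid_cells N. LINT z|lborel. a q z * in_grid_cell N q (snd z /\<^sub>R \<epsilon> j))" for j
      unfolding XN_def grid by (rule Bochner_Integration.integral_sum) (rule ac_int)
    have c_int: "integrable cell (in_grid_cell N q)" for q :: "int ^ 'n"
      by (rule integrable_cell_bounded[OF c_meas c01])
    have avg_grid: "avg (\<lambda>y. k z (grid_point N y)) = (\<Sum>q\<in>grid_cells N. a q z * avg (in_grid_cell N q))" for z
      unfolding grid avg_def using c_int by (subst Bochner_Integration.integral_sum) auto
    have LN: "LN = (\<Sum>q\<in>grid_cells N. (LINT z|lborel. a q z) * avg (in_grid_cell N q))"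
      unfolding LN_def avg_grid using a_int by (subst Bochner_Integration.integral_sum) auto
    have "XN \<longlonglongrightarrow> LN"
      unfolding XN[abs_def] LN
      by (intro tendsto_sum oscillating_tensor_limit[OF a_int c_meas c01 in_grid_cell_periodic \<epsilon>])
    then obtain j0 where j0: "\<And>j. j \<ge> j0 \<Longrightarrow> \<bar>XN j - LN\<bar> < e / 3"
      using metric_LIMSEQ_D[of XN LN "e / 3"] e by (auto simp: dist_real_def)
    have gX_int: "integrable lborel (\<lambda>z. k z (grid_point N (snd z /\<^sub>R \<epsilon> j)))" for j
      unfolding grid using ac_int by (intro Bochner_Integration.integrable_sum)
    have XXN: "\<bar>?X j - XN j\<bar> \<le> (LINT z|lborel. w N z)" for j
    proof -
      have "?X j - XN j = (LINT z|lborel. k z (snd z /\<^sub>R \<epsilon> j) - k z (grid_point N (snd z /\<^sub>R \<epsilon> j)))"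
        unfolding XN_def using X_int gX_int by simp
      also have "\<bar>\<dots>\<bar> \<le> (LINT z|lborel. \<bar>k z (snd z /\<^sub>R \<epsilon> j) - k z (grid_point N (snd z /\<^sub>R \<epsilon> j))\<bar>)"
        by (rule integral_abs_bound)
      also have "\<dots> \<le> (LINT z|lborel. w N z)"
        using X_int gX_int w_int[OF N] gp by (intro integral_mono) auto
      finally show ?thesis .
    qed
    have LLN: "\<bar>?L - LN\<bar> \<le> (LINT z|lborel. w N z)"
    proof -
      have gL_int: "integrable lborel (\<lambda>z. avg (\<lambda>y. k z (grid_point N y)))"
        unfolding avg_grid using a_int by (intro Bochner_Integration.integrable_sum) auto
      have "?L - LN = (LINT z|lborel. avg (k z) - avg (\<lambda>y. k z (grid_point N y)))"
        unfolding LN_def using L_int gL_int by simp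
      also have "\<bar>\<dots>\<bar> \<le> (LINT z|lborel. \<bar>avg (k z) - avg (\<lambda>y. k z (grid_point N y))\<bar>)"
        by (rule integral_abs_bound)
      also have "\<dots> \<le> (LINT z|lborel. w N z)"
      proof (rule integral_mono)
        show "\<bar>avg (k z) - avg (\<lambda>y. k z (grid_point N y))\<bar> \<le> w N z" for z
        proof -
          have "integrable cell (k z)" by (rule integrable_cell_bounded[OF sec' kb])
          moreover have "integrable cell (\<lambda>y. k z (grid_point N y))"
            unfolding grid using c_int by (intro Bochner_Integration.integrable_sum) auto
          ultimately have "avg (k z) - avg (\<lambda>y. k z (grid_point N y)) = avg (\<lambda>y. k z y - k z (grid_point N y))"
            by (simp add: avg_def)
          then show ?thesis using abs_avg_le_bound[of "\<lambda>y. k z y - k z (grid_point N y)", OF gp] by simp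
        qed
      qed (use L_int gL_int w_int[OF N] in auto)
      finally show ?thesis .
    qed
    have "dist (?X j) ?L < e" if "j \<ge> j0" for j
      using XXN[of j] LLN j0[OF that] N'[folded N_def] unfolding dist_real_def by linarith
    then show "\<exists>j0. \<forall>j\<ge>j0. dist (?X j) ?L < e" by blast
  qed
qed

section \<open>Almost everywhere statements on products and restrictions\<close>

text \<open>
  A function that agrees almost everywhere with a Borel function is measurable for the completed measure and
  has the same integral.
\<close>
lemma lebesgue_on_cong_AE:
  fixes f F :: "'a::euclidean_space \<Rightarrow> real"
  assumes Z: "Z \<in> sets borel" and F [measurable]: "F \<in> borel_measurable borel"
    and ae: "AE z in lborel. z \<in> Z \<longrightarrow> f z = F z"
  shows "f \<in> borel_measurable (lebesgue_on Z)"
    and "(LINT z|lebesgue_on Z. f z) = (LINT z|lborel. indicator Z z * F z)"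
    and "integrable lborel (\<lambda>z. indicator Z z * F z) \<Longrightarrow> integrable (lebesgue_on Z) f"
    and "integrable (lebesgue_on Z) f \<Longrightarrow> integrable lborel (\<lambda>z. indicator Z z * F z)"
proof -
  have [measurable]: "Z \<in> sets borel" by (rule Z)
  have ZL: "Z \<inter> space lebesgue \<in> sets lebesgue" using Z by simp
  have Fm: "(\<lambda>z. indicator Z z * F z) \<in> borel_measurable lborel" by measurable
  have ae': "AE z in lebesgue. indicator Z z * F z = indicator Z z *\<^sub>R f z"
    using AE_completion[OF ae] by eventually_elim (auto simp: indicator_def)
  have fm: "(\<lambda>z. indicator Z z *\<^sub>R f z) \<in> borel_measurable lebesgue"
    by (rule borel_measurable_AE[OF measurable_completion[OF Fm] ae'])
  then show "f \<in> borel_measurable (lebesgue_on Z)"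
    using ZL by (subst borel_measurable_restrict_space_iff) auto
  have "(LINT z|lebesgue_on Z. f z) = (LINT z|lebesgue. indicator Z z *\<^sub>R f z)"
    by (rule integral_restrict_space[OF ZL])
  also have "\<dots> = (LINT z|lebesgue. indicator Z z * F z)"
    by (rule Bochner_Integration.integral_cong_AE[OF fm measurable_completion[OF Fm]])
      (use ae' in \<open>auto elim!: eventually_mono\<close>)
  also have "\<dots> = (LINT z|lborel. indicator Z z * F z)"
    by (rule integral_completion[OF Fm])
  finally show "(LINT z|lebesgue_on Z. f z) = (LINT z|lborel. indicator Z z * F z)" .
  have "integrable (lebesgue_on Z) f \<longleftrightarrow> integrable lebesgue (\<lambda>z. indicator Z z *\<^sub>R f z)"
    by (rule integrable_restrict_space[OF ZL])
  also have "\<dots> \<longleftrightarrow> integrable lebesgue (\<lambda>z. indicator Z z * F z)"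
    by (rule Bochner_Integration.integrable_cong_AE[OF fm measurable_completion[OF Fm]])
      (use ae' in \<open>auto elim!: eventually_mono\<close>)
  also have "\<dots> \<longleftrightarrow> integrable lborel (\<lambda>z. indicator Z z * F z)"
    by (rule integrable_completion[OF Fm])
  finally show "integrable lborel (\<lambda>z. indicator Z z * F z) \<Longrightarrow> integrable (lebesgue_on Z) f"
    "integrable (lebesgue_on Z) f \<Longrightarrow> integrable lborel (\<lambda>z. indicator Z z * F z)" by auto
qed

lemma AE_lborel_snd:
  fixes P :: "'b::euclidean_space \<Rightarrow> bool"
  assumes "AE x in lborel. P x"
  shows "AE z in (lborel :: ('a::euclidean_space \<times> 'b) measure). P (snd z)"
proof -
  obtain N where N: "\<And>x. x \<notin> N \<Longrightarrow> P x" "N \<in> null_sets lborel"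
    using AE_E3[OF assms] by auto
  have "emeasure (lborel \<Otimes>\<^sub>M lborel) ((UNIV :: 'a set) \<times> N) = emeasure lborel (UNIV :: 'a set) * emeasure lborel N"
    using N(2) by (intro lborel.emeasure_pair_measure_Times) auto
  then have "(UNIV :: 'a set) \<times> N \<in> null_sets (lborel \<Otimes>\<^sub>M lborel)"
    using N(2) by (intro null_setsI) auto
  then have "(UNIV :: 'a set) \<times> N \<in> null_sets lborel" by (simp only: lborel_prod)
  then show ?thesis by (rule AE_I') (use N(1) in fastforce)
qed

text \<open>
  Tonelli for the measure of an exceptional Borel null set, sliced along the second variable.
\<close>
lemma AE_lborel_pair_swap:
  fixes P :: "'a::euclidean_space \<times> 'b::euclidean_space \<Rightarrow> bool"
  assumes "AE z in lborel. P z"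
  shows "AE x in lborel. AE t in lborel. P (t, x)"
proof -
  obtain N where N: "\<And>z. z \<notin> N \<Longrightarrow> P z" "N \<in> null_sets lborel"
    using AE_E3[OF assms] by auto
  then have N': "N \<in> null_sets (lborel \<Otimes>\<^sub>M lborel)" by (simp only: lborel_prod)
  then have sN: "N \<in> sets (lborel \<Otimes>\<^sub>M lborel)" by auto
  have "(\<integral>\<^sup>+ x. emeasure lborel ((\<lambda>t. (t, x)) -` N) \<partial>lborel) = emeasure (lborel \<Otimes>\<^sub>M lborel) N"
    by (rule lborel_pair.emeasure_pair_measure_alt2[OF sN, symmetric])
  also have "\<dots> = 0" using N' by auto
  finally have "(\<integral>\<^sup>+ x. emeasure lborel ((\<lambda>t. (t, x)) -` N) \<partial>lborel) = 0" .
  then have "AE x in lborel. emeasure lborel ((\<lambda>t. (t, x)) -` N) = 0"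
    by (subst (asm) nn_integral_0_iff_AE[OF lborel_pair.measurable_emeasure_Pair2[OF sN]]) simp
  then show ?thesis
  proof eventually_elim
    case (elim x)
    have "(\<lambda>t. (t, x)) -` N \<in> sets lborel" using sets_Pair2[OF sN, of x] by simp
    with elim have "(\<lambda>t. (t, x)) -` N \<in> null_sets lborel" by (intro null_setsI) auto
    then show ?case by (rule AE_I') (use N(1) in auto)
  qed
qed

lemma integrable_lborel_product:
  fixes a :: "'a::euclidean_space \<Rightarrow> real" and b :: "'b::euclidean_space \<Rightarrow> real"
  assumes a: "integrable lborel a" and b: "integrable lborel b"
  shows "integrable lborel (\<lambda>z. a (fst z) * b (snd z))"
proof -
  have [measurable]: "a \<in> borel_measurable borel" "b \<in> borel_measurable borel" using a b by auto
  have "integrable (lborel \<Otimes>\<^sub>M lborel) (\<lambda>z. a (fst z) * b (snd z))"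
  proof (rule lborel_pair.Fubini_integrable)
    show "integrable lborel (\<lambda>x. LINT y|lborel. norm (a (fst (x, y)) * b (snd (x, y))))"
      using a b by (simp add: abs_mult)
    show "AE x in lborel. integrable lborel (\<lambda>y. a (fst (x, y)) * b (snd (x, y)))"
      using b by simp
  qed measurable
  then show ?thesis by (simp only: lborel_prod)
qed

section \<open>Weak convergence of oscillating functions\<close>

text \<open>
  Against a fixed test function \<open>g\<close> the integrand \<open>k z y * g z\<close> is dominated by the integrable function
  \<open>g\<^sup>2 + M\<^sup>2\<close>, so the two-scale limit applies to it.
\<close>
lemma two_scale_weak_limit:
  fixes k :: "real \<times> (real ^ 'n) \<Rightarrow> real ^ 'n \<Rightarrow> real"
  assumes Z: "Z \<in> sets borel"
    and k_meas: "(\<lambda>(z, y). k z y) \<in> borel_measurable borel"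
    and cont: "\<And>z. continuous_on UNIV (k z)" and per: "\<And>z y i. k z (y + axis i 1) = k z y"
    and M: "M \<in> borel_measurable borel" "integrable lborel (\<lambda>z. (M z)\<^sup>2)" and kM: "\<And>z y. \<bar>k z y\<bar> \<le> M z"
    and u: "\<And>\<epsilon>. 0 < \<epsilon> \<Longrightarrow> AE z in lborel. z \<in> Z \<longrightarrow> u \<epsilon> z = k z (snd z /\<^sub>R \<epsilon>)"
    and l: "\<And>z. z \<in> Z \<Longrightarrow> l z = avg (k z)"
  shows "weakly_converges_L2 (lebesgue_on Z) u l (at_right 0)"
proof -
  have [measurable]: "Z \<in> sets borel" by (rule Z)
  note [measurable] = M(1)
  have [measurable]: "(\<lambda>(z, y). k z y) \<in> borel_measurable (borel \<Otimes>\<^sub>M borel)"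
    using k_meas by (simp only: borel_prod)
  have snd_meas [measurable]: "(\<lambda>z. snd z :: real ^ 'n) \<in> borel_measurable (borel :: (real \<times> (real ^ 'n)) measure)"
    by (intro borel_measurable_continuous_onI continuous_intros)
  have ke_meas: "(\<lambda>z. k z (snd z /\<^sub>R \<epsilon>)) \<in> borel_measurable borel" for \<epsilon> by measurable
  have l_meas: "(\<lambda>z. avg (k z)) \<in> borel_measurable borel" by (rule borel_measurable_avg[OF k_meas])
  have L2: "f \<in> L2 (lebesgue_on Z)"
    if ae: "AE z in lborel. z \<in> Z \<longrightarrow> f z = h z" and h [measurable]: "h \<in> borel_measurable borel"
      and hM: "\<And>z. \<bar>h z\<bar> \<le> M z" for f h
  proof -
    have "integrable lborel (\<lambda>z. indicator Z z * (h z)\<^sup>2)"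
    proof (rule Bochner_Integration.integrable_bound[OF M(2)])
      show "AE z in lborel. norm (indicator Z z * (h z)\<^sup>2) \<le> norm ((M z)\<^sup>2)"
      proof (rule AE_I2)
        fix z
        have "(h z)\<^sup>2 \<le> (M z)\<^sup>2" using power_mono[OF hM[of z], of 2] by simp
        then show "norm (indicator Z z * (h z)\<^sup>2) \<le> norm ((M z)\<^sup>2)" by (simp add: indicator_def)
      qed
    qed measurable
    moreover have "AE z in lborel. z \<in> Z \<longrightarrow> (f z)\<^sup>2 = (h z)\<^sup>2" using ae by eventually_elim simp
    ultimately have "integrable (lebesgue_on Z) (\<lambda>z. (f z)\<^sup>2)"
      by (intro lebesgue_on_cong_AE(3)[OF Z, of "\<lambda>z. (h z)\<^sup>2"]) measurable
    then show ?thesis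
      using lebesgue_on_cong_AE(1)[OF Z h ae] by (simp add: L2_def)
  qed
  show ?thesis
    unfolding weakly_converges_L2_def
  proof (intro conjI ballI)
    show "\<forall>\<^sub>F \<epsilon> in at_right 0. u \<epsilon> \<in> L2 (lebesgue_on Z)"
      using eventually_at_right_less[of 0]
      by eventually_elim (rule L2[OF u ke_meas kM])
    show "l \<in> L2 (lebesgue_on Z)"
      by (rule L2[OF _ l_meas]) (use l abs_avg_le_bound[OF kM] in auto)
    fix g assume "g \<in> L2 (lebesgue_on Z)"
    then have g: "g \<in> borel_measurable (lebesgue_on Z)" "integrable (lebesgue_on Z) (\<lambda>z. (g z)\<^sup>2)"
      by (auto simp: L2_def)
    have "(\<lambda>z. indicator Z z *\<^sub>R g z) \<in> borel_measurable lebesgue"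
      using g(1) Z by (subst (asm) borel_measurable_restrict_space_iff) auto
    then obtain g' where g' [measurable]: "g' \<in> borel_measurable lborel"
        and g'_eq: "AE z in lborel. indicator Z z *\<^sub>R g z = g' z"
      using completion_ex_borel_measurable_real by blast
    have g'_ae: "AE z in lborel. z \<in> Z \<longrightarrow> g z = g' z"
      using g'_eq by eventually_elim (auto simp: indicator_def)
    have g'2: "integrable lborel (\<lambda>z. indicator Z z * (g' z)\<^sup>2)"
      by (rule lebesgue_on_cong_AE(4)[OF Z _ _ g(2)]) (use g'_ae in \<open>auto elim!: eventually_mono\<close>)
    define K where "K z y = indicator Z z * g' z * k z y" for z y
    have K_meas: "(\<lambda>(z, y). K z y) \<in> borel_measurable borel"
    proof -
      have [measurable]: "g' \<in> borel_measurable borel" using g' by simp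
      have "(\<lambda>(z, y). K z y) \<in> borel_measurable (borel \<Otimes>\<^sub>M borel)"
        unfolding K_def by measurable
      then show ?thesis by (simp only: borel_prod)
    qed
    have K_cont: "continuous_on UNIV (K z)" for z
      unfolding K_def using cont by (intro continuous_intros)
    have K_per: "K z (y + axis i 1) = K z y" for z y i
      by (simp add: K_def per)
    let ?b = "\<lambda>z. indicator Z z * (g' z)\<^sup>2 + (M z)\<^sup>2"
    have b_int: "integrable lborel ?b" using g'2 M(2) by (rule Bochner_Integration.integrable_add)
    have K_bound: "\<bar>K z y\<bar> \<le> ?b z" for z y
    proof -
      have "\<bar>K z y\<bar> \<le> indicator Z z * \<bar>g' z\<bar> * M z"
        unfolding K_def abs_mult using kM[of z y] by (auto simp: indicator_def intro: mult_left_mono)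
      also have "\<dots> \<le> ?b z"
      proof -
        have "2 * (\<bar>g' z\<bar> * M z) \<le> (g' z)\<^sup>2 + (M z)\<^sup>2"
          using sum_squares_bound[of "\<bar>g' z\<bar>" "M z"] by simp
        moreover have "0 \<le> \<bar>g' z\<bar> * M z" using order_trans[OF abs_ge_zero kM[of z 0]] by simp
        ultimately show ?thesis by (simp add: indicator_def)
      qed
      finally show ?thesis .
    qed
    have lim: "(LINT z|lebesgue_on Z. l z * g z) = (LINT z|lborel. avg (K z))"
    proof -
      have "(LINT z|lebesgue_on Z. l z * g z) = (LINT z|lborel. indicator Z z * (avg (k z) * g' z))"
        using g'_ae l l_meas g' by (intro lebesgue_on_cong_AE(2)[OF Z]) (auto elim!: eventually_mono)
      also have "(\<lambda>z. indicator Z z * (avg (k z) * g' z)) = (\<lambda>z. avg (K z))"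
        by (rule ext) (simp add: K_def avg_def)
      finally show ?thesis .
    qed
    show "((\<lambda>\<epsilon>. LINT z|lebesgue_on Z. u \<epsilon> z * g z) \<longlongrightarrow> (LINT z|lebesgue_on Z. l z * g z)) (at_right 0)"
      unfolding tendsto_at_iff_sequentially
    proof (intro allI impI)
      \<comment> \<open>right limits are tested along sequences, for which dominated convergence is available\<close>
      fix X :: "nat \<Rightarrow> real" assume X: "\<forall>i. X i \<in> {0<..} - {0}" "X \<longlonglongrightarrow> 0"
      then have Xpos: "0 < X j" for j by auto
      have "(LINT z|lebesgue_on Z. u (X j) z * g z) = (LINT z|lborel. K z (snd z /\<^sub>R X j))" for j
      proof -
        have "AE z in lborel. z \<in> Z \<longrightarrow> u (X j) z * g z = k z (snd z /\<^sub>R X j) * g' z"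
          using u[OF Xpos[of j]] g'_ae by eventually_elim auto
        then have "(LINT z|lebesgue_on Z. u (X j) z * g z) = (LINT z|lborel. indicator Z z * (k z (snd z /\<^sub>R X j) * g' z))"
          using ke_meas g' by (intro lebesgue_on_cong_AE(2)[OF Z]) auto
        then show ?thesis by (simp add: K_def mult_ac)
      qed
      moreover have "(\<lambda>j. LINT z|lborel. K z (snd z /\<^sub>R X j)) \<longlonglongrightarrow> (LINT z|lborel. avg (K z))"
        by (rule two_scale_limit[OF K_meas K_cont K_per b_int K_bound Xpos X(2)])
      ultimately show "((\<lambda>\<epsilon>. LINT z|lebesgue_on Z. u \<epsilon> z * g z) \<circ> X) \<longlonglongrightarrow> (LINT z|lebesgue_on Z. l z * g z)"
        by (simp add: comp_def lim)
    qed
  qed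
qed

section \<open>Dependence of the cell solution on its parameters\<close>

text \<open>
  Continuity in \<open>y\<close> of the time integral is dominated convergence along sequences.
\<close>
lemma continuous_on_cell_solution:
  fixes g v :: "real ^ 'n \<Rightarrow> real" and \<phi> :: "real \<Rightarrow> real ^ 'n \<Rightarrow> real"
  assumes g: "continuous_on UNIV g" "\<And>y. \<bar>g y\<bar> \<le> G" and v: "continuous_on UNIV v"
    and \<phi>: "\<And>s. continuous_on UNIV (\<phi> s)" "\<And>y. (\<lambda>s. \<phi> s y) \<in> borel_measurable borel" "\<And>s y. \<bar>\<phi> s y\<bar> \<le> F"
  shows "continuous_on UNIV (cell_solution g v \<phi> t)"
  unfolding continuous_on_eq_continuous_within continuous_within_sequentially
proof (intro ballI allI impI, elim conjE)
  fix y :: "real ^ 'n" and x assume x: "x \<longlonglongrightarrow> y"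
  have seq: "(\<lambda>n. f (x n)) \<longlonglongrightarrow> f y" if "continuous_on UNIV f" for f :: "real ^ 'n \<Rightarrow> real"
    using that x by (metis UNIV_I continuous_on_eq_continuous_at isCont_tendsto_compose open_UNIV)
  have lim: "(\<lambda>n. LINT s|lborel. indicator {0..t} s *\<^sub>R (exp (s * g (x n)) * \<phi> s (x n)))
      \<longlonglongrightarrow> (LINT s|lborel. indicator {0..t} s *\<^sub>R (exp (s * g y) * \<phi> s y))"
  proof (rule integral_dominated_convergence[where w = "\<lambda>s. (exp (\<bar>t\<bar> * G) * F) * indicator {0..t} s"])
    show "(\<lambda>s. indicator {0..t} s *\<^sub>R (exp (s * g z) * \<phi> s z)) \<in> borel_measurable lborel" for z
      using \<phi>(2)[of z] by measurable
    then show "(\<lambda>s. indicator {0..t} s *\<^sub>R (exp (s * g (x n)) * \<phi> s (x n))) \<in> borel_measurable lborel" for n .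
    show "integrable lborel (\<lambda>s. (exp (\<bar>t\<bar> * G) * F) * indicator {0..t} s)"
      by (cases "0 \<le> t") auto
    show "AE s in lborel. (\<lambda>n. indicator {0..t} s *\<^sub>R (exp (s * g (x n)) * \<phi> s (x n)))
        \<longlonglongrightarrow> indicator {0..t} s *\<^sub>R (exp (s * g y) * \<phi> s y)"
      by (intro AE_I2 tendsto_intros seq g \<phi>)
    show "AE s in lborel. norm (indicator {0..t} s *\<^sub>R (exp (s * g (x n)) * \<phi> s (x n)))
        \<le> (exp (\<bar>t\<bar> * G) * F) * indicator {0..t} s" for n
    proof (rule AE_I2)
      fix s
      have "\<bar>exp (s * g (x n)) * \<phi> s (x n)\<bar> \<le> exp (\<bar>t\<bar> * G) * F" if "0 \<le> s" "s \<le> t"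
      proof -
        have "\<bar>s * g (x n)\<bar> \<le> \<bar>t\<bar> * G"
          unfolding abs_mult using that g(2)[of "x n"] by (intro mult_mono) auto
        then have "exp (s * g (x n)) \<le> exp (\<bar>t\<bar> * G)" by simp
        then have "exp (s * g (x n)) * \<bar>\<phi> s (x n)\<bar> \<le> exp (\<bar>t\<bar> * G) * F"
          using \<phi>(3)[of s "x n"] by (intro mult_mono) auto
        then show ?thesis by (simp add: abs_mult)
      qed
      then show "norm (indicator {0..t} s *\<^sub>R (exp (s * g (x n)) * \<phi> s (x n)))
        \<le> (exp (\<bar>t\<bar> * G) * F) * indicator {0..t} s"
        by (auto simp: indicator_def)
    qed
  qed
  show "(cell_solution g v \<phi> t \<circ> x) \<longlonglongrightarrow> cell_solution g v \<phi> t y"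
    unfolding cell_solution_def comp_def set_lebesgue_integral_def
    by (intro tendsto_mult tendsto_add tendsto_exp tendsto_const seq[OF g(1)] seq[OF v] lim)
qed

lemma cell_solution_jointly_measurable:
  fixes s v :: "'a::euclidean_space \<Rightarrow> real ^ 'n \<Rightarrow> real" and \<phi> :: "real \<times> 'a \<Rightarrow> real ^ 'n \<Rightarrow> real"
  assumes s: "(\<lambda>(x, y). s x y) \<in> borel_measurable borel" and v: "(\<lambda>(x, y). v x y) \<in> borel_measurable borel"
    and \<phi>: "(\<lambda>(z, y). \<phi> z y) \<in> borel_measurable borel"
  shows "(\<lambda>(z, y). cell_solution (s (snd z)) (v (snd z)) (\<lambda>r. \<phi> (r, snd z)) (fst z) y) \<in> borel_measurable borel"
proof -
  have [measurable]: "(\<lambda>(x, y). s x y) \<in> borel_measurable (borel \<Otimes>\<^sub>M borel)"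
    "(\<lambda>(x, y). v x y) \<in> borel_measurable (borel \<Otimes>\<^sub>M borel)"
    "(\<lambda>(z, y). \<phi> z y) \<in> borel_measurable ((borel \<Otimes>\<^sub>M borel) \<Otimes>\<^sub>M borel)"
    using s v \<phi> by (simp_all only: borel_prod)
  let ?N = "(borel \<Otimes>\<^sub>M borel) \<Otimes>\<^sub>M borel :: ((real \<times> 'a) \<times> (real ^ 'n)) measure"
  have [measurable]: "(\<lambda>w. LBINT r:{0..fst (fst w)}. exp (r * s (snd (fst w)) (snd w)) * \<phi> (r, snd (fst w)) (snd w))
      \<in> borel_measurable ?N"
    by (rule borel_measurable_LBINT_Icc) measurable
  have "(\<lambda>w. cell_solution (s (snd (fst w))) (v (snd (fst w))) (\<lambda>r. \<phi> (r, snd (fst w))) (fst (fst w)) (snd w)) \<in> borel_measurable ?N"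
    unfolding cell_solution_def by measurable
  then show ?thesis by (simp only: borel_prod split_beta')
qed

lemma borel_measurable_time_slice:
  fixes \<phi> :: "real \<times> 'a::euclidean_space \<Rightarrow> 'b::euclidean_space \<Rightarrow> real"
  assumes "(\<lambda>(z, y). \<phi> z y) \<in> borel_measurable borel"
  shows "(\<lambda>(r, y). \<phi> (r, x) y) \<in> borel_measurable borel"
    and "(\<lambda>r. \<phi> (r, x) y) \<in> borel_measurable borel"
proof -
  have "(\<lambda>w::real \<times> 'b. ((fst w, x), snd w)) \<in> borel_measurable borel"
    by (intro borel_measurable_continuous_onI continuous_intros)
  from measurable_compose[OF this assms] show "(\<lambda>(r, y). \<phi> (r, x) y) \<in> borel_measurable borel"
    by (simp add: split_beta')
  have "(\<lambda>r::real. ((r, x), y)) \<in> borel_measurable borel"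
    by (intro borel_measurable_continuous_onI continuous_intros)
  from measurable_compose[OF this assms] show "(\<lambda>r. \<phi> (r, x) y) \<in> borel_measurable borel"
    by simp
qed

section \<open>Homogenization\<close>

text \<open>
  The variation of constants formula is bounded, uniformly in \<open>y\<close>, by a constant multiple of
  \<open>b x + const\<close>, which is square integrable on the bounded cylinder.
\<close>
lemma weak_limit_of_oscillating_solutions:
  fixes s v :: "real ^ 'n \<Rightarrow> real ^ 'n \<Rightarrow> real" and \<phi> :: "real \<times> (real ^ 'n) \<Rightarrow> real ^ 'n \<Rightarrow> real"
    and \<Omega> :: "(real ^ 'n) set" and T C F :: real and b :: "real ^ 'n \<Rightarrow> real"
  assumes \<Omega>: "\<Omega> \<in> sets borel" "bounded \<Omega>"
    and s: "\<And>x y. \<bar>s x y\<bar> \<le> C" "(\<lambda>(x, y). s x y) \<in> borel_measurable borel"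
      "\<And>x. continuous_on UNIV (s x)" "\<And>x y i. s x (y + axis i 1) = s x y"
    and \<phi>: "\<And>z y. \<bar>\<phi> z y\<bar> \<le> F" "(\<lambda>(z, y). \<phi> z y) \<in> borel_measurable borel"
      "\<And>z. continuous_on UNIV (\<phi> z)" "\<And>z y i. \<phi> z (y + axis i 1) = \<phi> z y"
    and v: "\<And>x y. \<bar>v x y\<bar> \<le> b x" "(\<lambda>(x, y). v x y) \<in> borel_measurable borel"
      "\<And>x. continuous_on UNIV (v x)" "\<And>x y i. v x (y + axis i 1) = v x y"
      "b \<in> borel_measurable borel" "integrable lborel (\<lambda>x. (b x)\<^sup>2)"
    and u: "\<And>\<epsilon>. 0 < \<epsilon> \<Longrightarrow> AE x in lborel. x \<in> \<Omega> \<longrightarrow>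
      (\<forall>t\<in>{0..T}. u \<epsilon> t x = cell_solution (s x) (v x) (\<lambda>r. \<phi> (r, x)) t (x /\<^sub>R \<epsilon>))"
  shows "weakly_converges_L2 (lebesgue_on ({0<..<T} \<times> \<Omega>)) (\<lambda>\<epsilon> (t, x). u \<epsilon> t x)
      (\<lambda>(t, x). avg (cell_solution (s x) (v x) (\<lambda>r. \<phi> (r, x)) t)) (at_right 0)"
proof -
  let ?Z = "{0<..<T} \<times> \<Omega>"
  let ?U = "\<lambda>z. cell_solution (s (snd z)) (v (snd z)) (\<lambda>r. \<phi> (r, snd z)) (fst z)"
  define E where "E = exp (T * C)"
  define k where "k z y = indicator ?Z z * ?U z y" for z y
  define M where "M z = indicator ?Z z * (E * (b (snd z) + T * (E * F)))" for z :: "real \<times> (real ^ 'n)"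
  have Z: "?Z \<in> sets borel" using \<Omega>(1) by (simp add: borel_Times)
  have [measurable]: "?Z \<in> sets borel" "\<Omega> \<in> sets borel" "b \<in> borel_measurable borel" by fact+
  have [measurable]: "(\<lambda>z. snd z :: real ^ 'n) \<in> borel_measurable (borel :: (real \<times> (real ^ 'n)) measure)"
    by (intro borel_measurable_continuous_onI continuous_intros)
  have sx: "s x \<in> borel_measurable borel" and vx: "v x \<in> borel_measurable borel" for x
    using s(3) v(3) by (auto intro: borel_measurable_continuous_onI)
  note \<phi>x = borel_measurable_time_slice(1)[OF \<phi>(2)]
  note \<phi>xy = borel_measurable_time_slice(2)[OF \<phi>(2)]
  show ?thesis
  proof (rule two_scale_weak_limit[OF Z, of k M])
    show "(\<lambda>(z, y). k z y) \<in> borel_measurable borel"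
    proof -
      have "(\<lambda>w::(real \<times> (real ^ 'n)) \<times> (real ^ 'n). indicator ?Z (fst w) :: real) \<in> borel_measurable (borel \<Otimes>\<^sub>M borel)"
        by (rule measurable_compose[OF measurable_fst borel_measurable_indicator[OF Z]])
      then have "(\<lambda>w::(real \<times> (real ^ 'n)) \<times> (real ^ 'n). indicator ?Z (fst w) * (case w of (z, y) \<Rightarrow> ?U z y)) \<in> borel_measurable borel"
        unfolding borel_prod by (rule borel_measurable_times[OF _ cell_solution_jointly_measurable[OF s(2) v(2) \<phi>(2)]])
      then show ?thesis by (simp add: k_def split_beta')
    qed
    show "continuous_on UNIV (k z)" for z
      unfolding k_def
      by (intro continuous_intros continuous_on_cell_solution[where G = C and F = F] s(3) s(1) v(3) \<phi>(3) \<phi>xy \<phi>(1))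
    show "k z (y + axis i 1) = k z y" for z y i
      by (simp add: k_def cell_solution_def s(4) v(4) \<phi>(4))
    show "M \<in> borel_measurable borel" unfolding M_def by measurable
    show "\<bar>k z y\<bar> \<le> M z" for z y
    proof (cases "z \<in> ?Z")
      case True
      then have t: "0 \<le> fst z" "fst z \<le> T" by auto
      have "\<bar>?U z y\<bar> \<le> exp (T * C) * (\<bar>v (snd z) y\<bar> + T * (exp (T * C) * F))"
        by (rule cell_solution_bound[OF sx s(1) vx v(1) \<phi>x \<phi>(1) _ t]) (use t in simp)
      also have "\<dots> \<le> E * (b (snd z) + T * (E * F))"
        unfolding E_def using v(1) by (intro mult_left_mono) auto
      finally show ?thesis using True by (simp add: k_def M_def)
    qed (simp add: k_def M_def)
    show "integrable lborel (\<lambda>z. (M z)\<^sup>2)"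
    proof (rule Bochner_Integration.integrable_bound)
      let ?h = "\<lambda>x. 2 * E\<^sup>2 * (b x)\<^sup>2 + 2 * E\<^sup>2 * (T * (E * F))\<^sup>2 * indicator \<Omega> x"
      have "integrable lborel (indicator {0<..<T} :: real \<Rightarrow> real)"
        using emeasure_bounded_finite[of "{0<..<T}"] by (intro integrable_real_indicator) (auto simp: less_top)
      moreover have "integrable lborel ?h"
        using v(6) \<Omega> emeasure_bounded_finite[OF \<Omega>(2)]
        by (intro Bochner_Integration.integrable_add integrable_mult_right integrable_real_indicator)
          (auto simp: less_top)
      ultimately show "integrable lborel (\<lambda>z. indicator {0<..<T} (fst z) * ?h (snd z))"
        by (rule integrable_lborel_product)
      show "(\<lambda>z. (M z)\<^sup>2) \<in> borel_measurable lborel" unfolding M_def by measurable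
      show "AE z in lborel. norm ((M z)\<^sup>2) \<le> norm (indicator {0<..<T} (fst z) * ?h (snd z))"
      proof (rule AE_I2)
        fix z :: "real \<times> (real ^ 'n)"
        have "(b (snd z) + T * (E * F))\<^sup>2 \<le> 2 * (b (snd z))\<^sup>2 + 2 * (T * (E * F))\<^sup>2"
          using sum_squares_bound[of "b (snd z)" "T * (E * F)"] by (simp add: power2_sum)
        then have "E\<^sup>2 * (b (snd z) + T * (E * F))\<^sup>2 \<le> E\<^sup>2 * (2 * (b (snd z))\<^sup>2 + 2 * (T * (E * F))\<^sup>2)"
          by (intro mult_left_mono) auto
        also have "E\<^sup>2 * (2 * (b (snd z))\<^sup>2 + 2 * (T * (E * F))\<^sup>2)
            = 2 * E\<^sup>2 * (b (snd z))\<^sup>2 + 2 * E\<^sup>2 * (T * (E * F))\<^sup>2"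
          by (simp only: distrib_left mult_ac)
        finally have "(E * (b (snd z) + T * (E * F)))\<^sup>2 \<le> 2 * E\<^sup>2 * (b (snd z))\<^sup>2 + 2 * E\<^sup>2 * (T * (E * F))\<^sup>2"
          by (simp only: power_mult_distrib[of E "b (snd z) + T * (E * F)"])
        then have "(M z)\<^sup>2 \<le> indicator {0<..<T} (fst z) * ?h (snd z)"
          by (cases z) (auto simp: M_def indicator_def)
        then show "norm ((M z)\<^sup>2) \<le> norm (indicator {0<..<T} (fst z) * ?h (snd z))"
          by (simp add: order_trans[OF _ abs_ge_self])
      qed
    qed
    show "AE z in lborel. z \<in> ?Z \<longrightarrow> (\<lambda>(t, x). u \<epsilon> t x) z = k z (snd z /\<^sub>R \<epsilon>)" if "0 < \<epsilon>" for \<epsilon>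
      using AE_lborel_snd[OF u[OF that]]
      by eventually_elim (auto simp: k_def split_beta)
    show "(\<lambda>(t, x). avg (cell_solution (s x) (v x) (\<lambda>r. \<phi> (r, x)) t)) z = avg (k z)" if "z \<in> ?Z" for z
    proof -
      have "k z = ?U z" using that by (intro ext) (simp add: k_def)
      then show ?thesis by (simp add: split_beta)
    qed
  qed
qed

theorem theorem5:
  fixes \<Omega> :: "(real ^ 'n) set"
    and T \<sigma>_min :: real
    and \<sigma> :: "real ^ 'n \<Rightarrow> ((real ^ 'n) \<Rightarrow>\<^sub>C real)"
    and f :: "real \<times> (real ^ 'n) \<Rightarrow> ((real ^ 'n) \<Rightarrow>\<^sub>C real)"
    and u_in :: "real ^ 'n \<Rightarrow> ((real ^ 'n) \<Rightarrow>\<^sub>C real)"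
    and u :: "real \<Rightarrow> real \<Rightarrow> real ^ 'n \<Rightarrow> real"
  assumes "bounded_C1_domain \<Omega>"
    and "0 < T"
    and "\<sigma> \<in> Bochner_Linf (lebesgue_on \<Omega>) C_per"
    and "0 < \<sigma>_min"
    and "\<forall>x \<in> \<Omega>. \<forall>y \<in> unit_cell. \<sigma>_min \<le> \<sigma> x y"
    and "f \<in> Bochner_Linf (lebesgue_on ({0<..<T} \<times> \<Omega>)) C_per"
    and "u_in \<in> Bochner_L2 (lebesgue_on \<Omega>) C_per"
    and "\<forall>\<epsilon> > 0. solves_oscillating T \<Omega> \<sigma> f u_in \<epsilon> (u \<epsilon>)"
  shows "\<exists>u_hom :: real \<Rightarrow> real ^ 'n \<Rightarrow> real.
           weakly_converges_L2 (lebesgue_on ({0<..<T} \<times> \<Omega>))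
             (\<lambda>\<epsilon> (t, x). u \<epsilon> t x) (\<lambda>(t, x). u_hom t x) (at_right 0) \<and>
           solves_homogenized T \<Omega> \<sigma> f u_in u_hom"
proof -
  have \<Omega>: "open \<Omega>" "bounded \<Omega>" using assms(1) by (auto simp: bounded_C1_domain_def)
  then have \<Omega>b: "\<Omega> \<in> sets borel" by simp
  have \<Omega>L: "\<Omega> \<in> sets lebesgue" using \<Omega>b by simp
  have Zb: "{0<..<T} \<times> \<Omega> \<in> sets borel" using \<Omega>(1) by (intro borel_open open_Times) auto
  obtain s C where s: "\<And>x y. \<bar>s x y\<bar> \<le> C" "(\<lambda>(x, y). s x y) \<in> borel_measurable borel"
      "\<And>x. continuous_on UNIV (s x)" "\<And>x y i. s x (y + axis i 1) = s x y"
      and s_eq: "AE x in lborel. x \<in> \<Omega> \<longrightarrow> apply_bcontfun (\<sigma> x) = s x"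
    by (rule Bochner_Linf_borel_representative[OF \<Omega>b assms(3)]) blast
  obtain \<phi> F where \<phi>: "\<And>z y. \<bar>\<phi> z y\<bar> \<le> F" "(\<lambda>(z, y). \<phi> z y) \<in> borel_measurable borel"
      "\<And>z. continuous_on UNIV (\<phi> z)" "\<And>z y i. \<phi> z (y + axis i 1) = \<phi> z y"
      and \<phi>_eq: "AE z in lborel. z \<in> {0<..<T} \<times> \<Omega> \<longrightarrow> apply_bcontfun (f z) = \<phi> z"
    by (rule Bochner_Linf_borel_representative[OF Zb assms(6)]) blast
  obtain v b where v: "\<And>x y. \<bar>v x y\<bar> \<le> b x" "(\<lambda>(x, y). v x y) \<in> borel_measurable borel"
      "\<And>x. continuous_on UNIV (v x)" "\<And>x y i. v x (y + axis i 1) = v x y"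
      "b \<in> borel_measurable borel" "integrable lborel (\<lambda>x. (b x)\<^sup>2)"
      and v_eq: "AE x in lborel. x \<in> \<Omega> \<longrightarrow> apply_bcontfun (u_in x) = v x"
    by (rule Bochner_L2_borel_representative[OF \<Omega>b assms(7)]) blast
  have sx: "s x \<in> borel_measurable borel" and vx: "v x \<in> borel_measurable borel" for x
    using s(3) v(3) by (auto intro: borel_measurable_continuous_onI)
  note \<phi>x = borel_measurable_time_slice(1)[OF \<phi>(2)]
  note \<phi>xy = borel_measurable_time_slice(2)[OF \<phi>(2)]
  \<comment> \<open>the points at which the Borel representatives may be used\<close>
  define good where "good x \<longleftrightarrow> apply_bcontfun (\<sigma> x) = s x \<and> apply_bcontfun (u_in x) = v x \<and>
      (AE t in lborel. t \<in> {0<..<T} \<longrightarrow> apply_bcontfun (f (t, x)) = \<phi> (t, x))" for x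
  have good: "AE x in lborel. x \<in> \<Omega> \<longrightarrow> good x"
    using s_eq v_eq AE_lborel_pair_swap[OF \<phi>_eq]
    by eventually_elim (auto simp: good_def)
  let ?U = "\<lambda>x. cell_solution (s x) (v x) (\<lambda>r. \<phi> (r, x))"
  have u: "AE x in lborel. x \<in> \<Omega> \<longrightarrow> (\<forall>t\<in>{0..T}. u \<epsilon> t x = ?U x t (x /\<^sub>R \<epsilon>))" if "0 < \<epsilon>" for \<epsilon>
  proof -
    have "AE x in lborel. x \<in> \<Omega> \<longrightarrow> absolutely_continuous_fun 0 T (\<lambda>t. u \<epsilon> t x) \<and>
        (AE t in lebesgue_on {0<..<T}. \<exists>D. ((\<lambda>s. u \<epsilon> s x) has_real_derivative D) (at t) \<and>
          D + \<sigma> x (x /\<^sub>R \<epsilon>) * u \<epsilon> t x = f (t, x) (x /\<^sub>R \<epsilon>)) \<and> u \<epsilon> 0 x = u_in x (x /\<^sub>R \<epsilon>)"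
      using assms(8) that unfolding solves_oscillating_def solves_IVP_def AE_lebesgue_on_iff[OF \<Omega>L] by blast
    with good show ?thesis
    proof eventually_elim
      case (elim x)
      show ?case
      proof (intro impI ballI)
        fix t assume x: "x \<in> \<Omega>" and t: "t \<in> {0..T}"
        from elim x have ac: "absolutely_continuous_fun 0 T (\<lambda>t. u \<epsilon> t x)"
          and ode: "AE t in lebesgue_on {0<..<T}. \<exists>D. ((\<lambda>s. u \<epsilon> s x) has_real_derivative D) (at t) \<and>
            D + \<sigma> x (x /\<^sub>R \<epsilon>) * u \<epsilon> t x = f (t, x) (x /\<^sub>R \<epsilon>)"
          and init: "u \<epsilon> 0 x = u_in x (x /\<^sub>R \<epsilon>)" and gx: "good x" by auto
        have "AE t in lebesgue_on {0<..<T}. apply_bcontfun (f (t, x)) = \<phi> (t, x)"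
          using gx by (simp add: good_def AE_lebesgue_on_iff)
        with ode have "AE t in lebesgue_on {0<..<T}. \<exists>D. ((\<lambda>s. u \<epsilon> s x) has_real_derivative D) (at t) \<and>
            D + s x (x /\<^sub>R \<epsilon>) * u \<epsilon> t x = \<phi> (t, x) (x /\<^sub>R \<epsilon>)"
          by eventually_elim (use gx in \<open>simp add: good_def\<close>)
        from linear_ode_unique[OF ac \<phi>xy \<phi>(1) this, of t] t init gx
        show "u \<epsilon> t x = ?U x t (x /\<^sub>R \<epsilon>)"
          by (simp add: cell_solution_def good_def)
      qed
    qed
  qed
  define u_hom where "u_hom t x = avg (?U x t)" for t x
  have "weakly_converges_L2 (lebesgue_on ({0<..<T} \<times> \<Omega>))
             (\<lambda>\<epsilon> (t, x). u \<epsilon> t x) (\<lambda>(t, x). u_hom t x) (at_right 0)"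
    unfolding u_hom_def by (rule weak_limit_of_oscillating_solutions[OF \<Omega>b \<Omega>(2) s \<phi> v u])
  moreover have "solves_homogenized T \<Omega> \<sigma> f u_in u_hom"
    unfolding solves_homogenized_def solves_IVP_def AE_lebesgue_on_iff[OF \<Omega>L]
    using good
  proof eventually_elim
    case (elim x)
    show ?case
    proof
      assume "x \<in> \<Omega>"
      with elim have gx: "apply_bcontfun (\<sigma> x) = s x" "apply_bcontfun (u_in x) = v x"
        "AE t in lborel. t \<in> {0<..<T} \<longrightarrow> apply_bcontfun (f (t, x)) = \<phi> (t, x)"
        by (auto simp: good_def)
      have T: "0 \<le> T" using assms(2) by simp
      note cs = avg_cell_solution_solves[OF sx s(1) vx v(1) \<phi>x \<phi>(1) T, of x x x]
      have f_eq: "AE t in lebesgue_on {0<..<T}. apply_bcontfun (f (t, x)) = \<phi> (t, x)"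
        using gx(3) by (simp add: AE_lebesgue_on_iff)
      have t_in: "AE t in lebesgue_on {0<..<T}. t \<in> {0<..<T}" by (rule AE_I2) simp
      let ?k = "\<lambda>t r w. avg (\<lambda>y. s x y * semigroup_L (s x) (- (t - r)) (L_op (\<lambda>_. 1) w) y)"
      have source: "(LINT r|lebesgue_on {0<..<t}. ?k t r (apply_bcontfun (f (r, x))))
          = (LINT r|lebesgue_on {0<..<t}. ?k t r (\<phi> (r, x)))" if t: "t \<in> {0<..<T}" for t
      proof -
        have m: "(\<lambda>r. ?k t r (\<phi> (r, x))) \<in> borel_measurable borel"
          by (rule borel_measurable_avg_semigroup_L_source[OF sx s(1) vx v(1) \<phi>x \<phi>(1) T])
        have "AE r in lborel. r \<in> {0<..<t} \<longrightarrow> ?k t r (apply_bcontfun (f (r, x))) = ?k t r (\<phi> (r, x))"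
          using gx(3) by eventually_elim (use t in auto)
        then show ?thesis
          using lebesgue_on_cong_AE(2)[OF _ m, of "{0<..<t}"] by simp
      qed
      show "absolutely_continuous_fun 0 T (\<lambda>t. u_hom t x) \<and>
         (AE t in lebesgue_on {0<..<T}. \<exists>D. ((\<lambda>s. u_hom s x) has_real_derivative D) (at t) \<and>
            D + avg (\<sigma> x) * u_hom t x
              - (LINT s|lebesgue_on {0<..<t}. memory_kernel \<sigma> (t - s) x * u_hom s x)
            = source_term \<sigma> f u_in t x) \<and>
         u_hom 0 x = avg (u_in x)"
      proof (intro conjI)
        show "absolutely_continuous_fun 0 T (\<lambda>t. u_hom t x)" unfolding u_hom_def by (rule cs(1))
        show "u_hom 0 x = avg (u_in x)" unfolding u_hom_def gx(2) by (rule cs(2))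
        show "AE t in lebesgue_on {0<..<T}. \<exists>D. ((\<lambda>s. u_hom s x) has_real_derivative D) (at t) \<and>
            D + avg (\<sigma> x) * u_hom t x
              - (LINT s|lebesgue_on {0<..<t}. memory_kernel \<sigma> (t - s) x * u_hom s x)
            = source_term \<sigma> f u_in t x"
          using cs(3) f_eq t_in
        proof eventually_elim
          case (elim t)
          from elim(1) show ?case
            unfolding u_hom_def memory_kernel_def source_term_def avg_def[symmetric] gx(1,2)
              source[OF elim(3)] elim(2) .
        qed
      qed
    qed
  qed
  ultimately show ?thesis by blast
qed

end
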